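(* Let $\gamma\in(\tfrac23,2]$ and let $(\overline{M}=(0,\infty)\times M,\ \overline{g}=-dt^2+a(t)^2g)$ be a warped product spacetime of type $0$ or of type $-1$ associated with $\gamma$. Let $\psi\in C^\infty(\overline{M})$ be a smooth solution to the wave equation $\square_{\overline{g}}\psi=0$. Define $$\psi_{\mathrm{hom}}(t)=\begin{cases} t^{1-\frac{2}{\gamma}} & \text{in type } 0 \text{ with } \gamma<2,\\ \log(t) & \text{in type } 0 \text{ with } \gamma=2,\\ \int_t^\infty a(s)^{-3}\,ds & \text{in type } -1.\end{cases}$$ Then there exist unique functions $A\in C^\infty(M)$ and $r\in C^\infty(\overline{M})$ such that $$\psi(t,x)=A(x)\,\psi_{\mathrm{hom}}(t)+r(t,x)\quad\text{for all }(t,x)\in\overline{M}$$ and $\dfrac{r(t,x)}{\psi_{\mathrm{hom}}(t)}\to 0$ as $t\downarrow 0$, uniformly in $x\in M$. Moreover, if $\gamma<2$, then $\psi(t,\cdot)\,(\psi_{\mathrm{hom}}(t))^{-1}$ converges to $A$ in $C^\infty(M)$ as $t\downarrow 0$.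
   Context: $(M,g)$ is a closed (compact, without boundary) three-dimensional smooth Riemannian manifold, with no assumption on its curvature; $\Delta=g^{ij}\nabla_i\nabla_j$ is its Laplace-Beltrami operator. A warped product spacetime of type $\kappa\in\{0,-1\}$ associated with $\gamma\in(\frac23,2]$ is $\overline{M}=(0,\infty)\times M$ with metric $\overline{g}=-dt^2+a(t)^2g$, where the scale factor $a:[0,\infty)\to[0,\infty)$ is continuous, positive and smooth on $(0,\infty)$, satisfies $a(0)=0$ and, for some constant $B>0$, $$\dot a(t)=\sqrt{\tfrac{8\pi B}{3}a(t)^{2-3\gamma}-\kappa}\qquad\text{for } t>0.$$ (This is equivalent to the Friedman and continuity equations with equation of state $p=(\gamma-1)\rho$, $\rho=Ba^{-3\gamma}$.) For type $0$ the scale factor is, up to a constant factor, $a(t)=t^{\frac{2}{3\gamma}}$, and one may normalise that factor to $1$. In type $-1$ one has $a(t)\ge t$, so $\int_t^\infty a(s)^{-3}ds<\infty$ for $t>0$. The wave equation $\square_{\overline{g}}\psi=0$ reads $$-\partial_t^2\psi+a(t)^{-2}\Delta\psi-3\frac{\dot a(t)}{a(t)}\partial_t\psi=0\quad\text{on }(0,\infty)\times M .$$ Convergence in $C^\infty(M)$ means convergence in $C^k(M)$ for every $k\in\mathbb{N}$. *)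

theory Defs
  imports "HOL-Analysis.Analysis"
begin

section \<open>Smooth functions on open subsets of Euclidean spaces\<close>

fun dir_derivs :: "'a::real_normed_vector list \<Rightarrow> ('a \<Rightarrow> 'b::real_normed_vector) \<Rightarrow> 'a \<Rightarrow> 'b" where
  "dir_derivs [] f = f"
| "dir_derivs (v # vs) f = (\<lambda>x. frechet_derivative (dir_derivs vs f) (at x) v)"

text \<open>Only meant for open \<open>S\<close>. Differentiability of all iterated directional derivatives
  includes their continuity.\<close>

definition smooth_on :: "('a::euclidean_space \<Rightarrow> 'b::real_normed_vector) \<Rightarrow> 'a set \<Rightarrow> bool" where
  "smooth_on f S \<longleftrightarrow> (\<forall>vs. \<forall>x\<in>S. dir_derivs vs f differentiable (at x))"


section \<open>Smooth manifolds\<close>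

text \<open>A chart is a pair of its domain and its coordinate map; values of the coordinate map outside
  the domain are irrelevant.\<close>

type_synonym ('m, 'e) chart = "'m set \<times> ('m \<Rightarrow> 'e)"

abbreviation chart_dom :: "('m, 'e) chart \<Rightarrow> 'm set" where "chart_dom \<equiv> fst"
abbreviation chart_map :: "('m, 'e) chart \<Rightarrow> 'm \<Rightarrow> 'e" where "chart_map \<equiv> snd"

definition chart_image :: "('m, 'e) chart \<Rightarrow> 'e set" where
  "chart_image c = chart_map c ` chart_dom c"

definition chart_inv :: "('m, 'e) chart \<Rightarrow> 'e \<Rightarrow> 'm" where
  "chart_inv c = inv_into (chart_dom c) (chart_map c)"

definition is_chart :: "('m::topological_space, 'e::euclidean_space) chart \<Rightarrow> bool" where
  "is_chart c \<longleftrightarrow> open (chart_dom c) \<and> open (chart_image c) \<and>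
     homeomorphism (chart_dom c) (chart_image c) (chart_map c) (chart_inv c)"

definition smooth_atlas :: "('m::topological_space, 'e::euclidean_space) chart set \<Rightarrow> bool" where
  "smooth_atlas \<A> \<longleftrightarrow>
     (\<forall>c\<in>\<A>. is_chart c) \<and>
     (\<Union>c\<in>\<A>. chart_dom c) = UNIV \<and>
     (\<forall>c\<in>\<A>. \<forall>d\<in>\<A>. smooth_on (chart_map d \<circ> chart_inv c)
                        (chart_map c ` (chart_dom c \<inter> chart_dom d)))"

text \<open>The underlying set of the manifold is the whole type; the atlas need not be maximal.\<close>

definition closed_smooth_manifold ::
    "('m::{t2_space,second_countable_topology}, 'e::euclidean_space) chart set \<Rightarrow> bool" where
  "closed_smooth_manifold \<A> \<longleftrightarrow> compact (UNIV :: 'm set) \<and> smooth_atlas \<A>"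

text \<open>Smoothness on the union of the chart domains.\<close>

definition smooth_fun :: "('m, 'e::euclidean_space) chart set \<Rightarrow> ('m \<Rightarrow> real) \<Rightarrow> bool" where
  "smooth_fun \<A> f \<longleftrightarrow> (\<forall>c\<in>\<A>. smooth_on (f \<circ> chart_inv c) (chart_image c))"

text \<open>Product atlas of \<open>(0,\<infinity>) \<times> M\<close>.\<close>

definition cylinder_atlas :: "('m, 'e) chart set \<Rightarrow> (real \<times> 'm, real \<times> 'e) chart set" where
  "cylinder_atlas \<A> = (\<lambda>c. ({0<..} \<times> chart_dom c, \<lambda>(t, p). (t, chart_map c p))) ` \<A>"

text \<open>Convergence in \<open>C\<^sup>k(M)\<close>, for compact \<open>M\<close>: locally uniform convergence, in every chart, of all
  derivatives of order at most \<open>k\<close>. Since finitely many compact subsets of chart domains cover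
  \<open>M\<close>, this is convergence in any of the usual \<open>C\<^sup>k\<close> norms.\<close>

definition Ck_converges ::
    "nat \<Rightarrow> ('m, 'e::euclidean_space) chart set \<Rightarrow> ('i \<Rightarrow> 'm \<Rightarrow> real) \<Rightarrow> ('m \<Rightarrow> real) \<Rightarrow> 'i filter \<Rightarrow> bool" where
  "Ck_converges k \<A> F f net \<longleftrightarrow>
     (\<forall>c\<in>\<A>. \<forall>K. compact K \<and> K \<subseteq> chart_image c \<longrightarrow>
        (\<forall>vs. length vs \<le> k \<longrightarrow>
           uniform_limit K (\<lambda>i. dir_derivs vs (F i \<circ> chart_inv c)) (dir_derivs vs (f \<circ> chart_inv c)) net))"

definition Cinf_converges ::
    "('m, 'e::euclidean_space) chart set \<Rightarrow> ('i \<Rightarrow> 'm \<Rightarrow> real) \<Rightarrow> ('m \<Rightarrow> real) \<Rightarrow> 'i filter \<Rightarrow> bool" where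
  "Cinf_converges \<A> F f net \<longleftrightarrow> (\<forall>k. Ck_converges k \<A> F f net)"


section \<open>Riemannian metrics and the Laplace-Beltrami operator\<close>

text \<open>A metric is given by its component matrices: \<open>g c p\<close> is the matrix \<open>g\<^sub>i\<^sub>j\<close> at the point \<open>p\<close> with
  respect to the coordinates of the chart \<open>c\<close>. The last conjunct is the transformation law of a
  (0,2)-tensor, where \<open>J\<close> is the Jacobian matrix of the change of coordinates.\<close>

definition riemannian_metric ::
    "('m, real^'n::finite) chart set \<Rightarrow> (('m, real^'n) chart \<Rightarrow> 'm \<Rightarrow> real^'n^'n) \<Rightarrow> bool" where
  "riemannian_metric \<A> g \<longleftrightarrow>
     (\<forall>c\<in>\<A>. smooth_on (g c \<circ> chart_inv c) (chart_image c)) \<and>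
     (\<forall>c\<in>\<A>. \<forall>p\<in>chart_dom c. transpose (g c p) = g c p \<and> (\<forall>v. v \<noteq> 0 \<longrightarrow> v \<bullet> (g c p *v v) > 0)) \<and>
     (\<forall>c\<in>\<A>. \<forall>d\<in>\<A>. \<forall>p\<in>chart_dom c \<inter> chart_dom d.
        let J = matrix (frechet_derivative (chart_map d \<circ> chart_inv c) (at (chart_map c p)))
        in g c p = transpose J ** g d p ** J)"

definition pderiv_coord :: "'n::finite \<Rightarrow> (real^'n \<Rightarrow> real) \<Rightarrow> real^'n \<Rightarrow> real" where
  "pderiv_coord i f y = frechet_derivative f (at y) (axis i 1)"

text \<open>Christoffel symbols \<open>\<Gamma>\<^sup>k\<^sub>i\<^sub>j\<close> of the Levi-Civita connection of a metric \<open>G\<close> on an open subset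
  of \<open>\<real>\<^sup>n\<close>.\<close>

definition christoffel ::
    "(real^'n \<Rightarrow> real^'n^'n) \<Rightarrow> 'n \<Rightarrow> 'n \<Rightarrow> 'n \<Rightarrow> real^'n::finite \<Rightarrow> real" where
  "christoffel G k i j y = (1/2) * (\<Sum>l\<in>UNIV. matrix_inv (G y) $ k $ l *
     (pderiv_coord i (\<lambda>z. G z $ j $ l) y + pderiv_coord j (\<lambda>z. G z $ i $ l) y
        - pderiv_coord l (\<lambda>z. G z $ i $ j) y))"

definition hessian_coord ::
    "(real^'n \<Rightarrow> real^'n^'n) \<Rightarrow> 'n \<Rightarrow> 'n \<Rightarrow> (real^'n::finite \<Rightarrow> real) \<Rightarrow> real^'n \<Rightarrow> real" where
  "hessian_coord G i j f y = pderiv_coord i (pderiv_coord j f) y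
     - (\<Sum>k\<in>UNIV. christoffel G k i j y * pderiv_coord k f y)"

text \<open>\<open>\<Delta>f = g\<^sup>i\<^sup>j \<nabla>\<^sub>i \<nabla>\<^sub>j f\<close> at the point \<open>p\<close>, computed in the chart \<open>c\<close>. For a Riemannian metric and smooth \<open>f\<close>,
  the value is the same for all charts of the atlas around \<open>p\<close>.\<close>

definition laplace_beltrami ::
    "(('m, real^'n::finite) chart \<Rightarrow> 'm \<Rightarrow> real^'n^'n) \<Rightarrow> ('m, real^'n) chart \<Rightarrow> ('m \<Rightarrow> real) \<Rightarrow> 'm \<Rightarrow> real" where
  "laplace_beltrami g c f p =
     (\<Sum>i\<in>UNIV. \<Sum>j\<in>UNIV. matrix_inv (g c p) $ i $ j *
        hessian_coord (g c \<circ> chart_inv c) i j (f \<circ> chart_inv c) (chart_map c p))"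


section \<open>Warped product spacetimes and the wave equation\<close>

text \<open>Values of \<open>a\<close> at negative times are irrelevant.\<close>

definition scale_factor :: "real \<Rightarrow> real \<Rightarrow> (real \<Rightarrow> real) \<Rightarrow> bool" where
  "scale_factor \<kappa> \<gamma> a \<longleftrightarrow>
     continuous_on {0..} a \<and> a 0 = 0 \<and> (\<forall>t>0. a t > 0) \<and> smooth_on a {0<..} \<and>
     (\<exists>B>0. \<forall>t>0. (a has_real_derivative sqrt (8 * pi * B / 3 * a t powr (2 - 3 * \<gamma>) - \<kappa>)) (at t))"

text \<open>The equation is required in every chart; by invariance of the Laplace-Beltrami operator this
  is the same as requiring it in one chart around each point.\<close>

definition solves_wave_equation ::
    "('m, real^'n::finite) chart set \<Rightarrow> (('m, real^'n) chart \<Rightarrow> 'm \<Rightarrow> real^'n^'n) \<Rightarrow>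
     (real \<Rightarrow> real) \<Rightarrow> (real \<times> 'm \<Rightarrow> real) \<Rightarrow> bool" where
  "solves_wave_equation \<A> g a \<psi> \<longleftrightarrow>
     (\<forall>t>0. \<forall>c\<in>\<A>. \<forall>x\<in>chart_dom c.
        - deriv (deriv (\<lambda>s. \<psi> (s, x))) t
        + laplace_beltrami g c (\<lambda>y. \<psi> (t, y)) x / (a t)\<^sup>2
        - 3 * (deriv a t / a t) * deriv (\<lambda>s. \<psi> (s, x)) t = 0)"

definition psi_hom :: "real \<Rightarrow> real \<Rightarrow> (real \<Rightarrow> real) \<Rightarrow> real \<Rightarrow> real" where
  "psi_hom \<kappa> \<gamma> a t =
     (if \<kappa> = 0 then (if \<gamma> < 2 then t powr (1 - 2 / \<gamma>) else ln t)
      else integral {t..} (\<lambda>s. 1 / a s ^ 3))"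

definition is_decomposition ::
    "('m, 'e::euclidean_space) chart set \<Rightarrow> (real \<times> 'm \<Rightarrow> real) \<Rightarrow> (real \<Rightarrow> real) \<Rightarrow>
     ('m \<Rightarrow> real) \<Rightarrow> (real \<times> 'm \<Rightarrow> real) \<Rightarrow> bool" where
  "is_decomposition \<A> \<psi> h A r \<longleftrightarrow>
     smooth_fun \<A> A \<and> smooth_fun (cylinder_atlas \<A>) r \<and>
     (\<forall>t>0. \<forall>x. \<psi> (t, x) = A x * h t + r (t, x)) \<and>
     uniform_limit UNIV (\<lambda>t x. r (t, x) / h t) (\<lambda>x. 0) (at_right 0)"

end

theory Submission
  imports Defs
begin

text \<open>
  Write the wave equation as \<open>\<partial>\<^sub>t v = a \<Delta>\<psi>\<close> with \<open>v = a\<^sup>3 \<partial>\<^sub>t\<psi>\<close>. The energy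
  \<open>1/2 \<integral> v\<^sup>2 + a\<^sup>4 (\<bar>\<nabla>\<psi>\<bar>\<^sup>2 + \<psi>\<^sup>2)\<close> of \<open>\<psi>\<close> and of its coordinate derivatives up to a given order can
  grow towards the singularity only at the rate \<open>C / a\<close>, which is integrable at \<open>t = 0\<close> since
  \<open>\<gamma> > 2/3\<close>. For the same reason light cones have bounded coordinate width, so the
  estimate is carried out in a single chart, with a cutoff that shrinks towards the past faster
  than light. Hence \<open>a\<^sup>2 \<psi>\<close> and all its spatial derivatives are bounded, \<open>\<partial>\<^sub>t v = O(1 / a)\<close> in every \<open>C\<^sup>k\<close>,
  and \<open>v\<close> converges as \<open>t \<down> 0\<close>. Since \<open>\<psi>\<^sub>h\<^sub>o\<^sub>m\<close> is unbounded with derivative \<open>k / a\<^sup>3\<close>, the argument of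
  l'Hopital's rule gives the convergence of \<open>\<psi> / \<psi>\<^sub>h\<^sub>o\<^sub>m\<close> to \<open>A = lim v / k\<close>.
\<close>

section \<open>Smooth functions\<close>

text \<open>The weight \<open>a^4\<close> is dictated by the identity
  \<open>a \<nabla>v = a^4 \<nabla>\<partial>_t \<psi>\<close>: after integration by parts the
  second order terms form the time derivative of the gradient part of the energy, up to a term with
  the factor \<open>a'\<close>. The errors left are products \<open>a v \<partial>\<psi>\<close>; as
  \<open>|v|\<close> and \<open>a^2 |\<partial>\<psi>|\<close> are both at most a multiple of the
  root of the energy, they cost the factor \<open>1 / a\<close>. It is integrated without solving
  for \<open>a\<close>: the Friedman equation bounds \<open>1 / a\<close> by the derivative of a
  multiple of \<open>a powr p\<close> with \<open>p = 3 \<gamma> / 2 - 1\<close>, positive exactly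
  when \<open>\<gamma> > 2/3\<close>. Coordinate derivatives and Lebesgue measure in a chart replace
  invariant objects; the price is terms of lower order, which the energy controls. Bounds near each
  point suffice, because the coefficient is a pointwise limit, so that results from different charts
  agree; compactness of the manifold only makes the convergence uniform.\<close>

definition ddir :: "'a::real_normed_vector \<Rightarrow> ('a \<Rightarrow> 'b::real_normed_vector) \<Rightarrow> 'a \<Rightarrow> 'b" where
  "ddir v f x = frechet_derivative f (at x) v"

lemma dir_derivs_Cons [simp]: "dir_derivs (v # vs) f = ddir v (dir_derivs vs f)"
  by (simp add: ddir_def fun_eq_iff)

declare dir_derivs.simps(2) [simp del]

lemma dir_derivs_append: "dir_derivs (vs @ ws) f = dir_derivs vs (dir_derivs ws f)"
  by (induction vs) auto

lemma has_derivative_ddir: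
  "f differentiable (at x) \<Longrightarrow> (f has_derivative (\<lambda>v. ddir v f x)) (at x)"
  unfolding ddir_def using frechet_derivative_works[of f "at x"] by simp

lemma ddir_eqI: "(f has_derivative f') (at x) \<Longrightarrow> ddir v f x = f' v"
  unfolding ddir_def using frechet_derivative_at by metis

text \<open>Having a given derivative at a point is a local property, so both sides are the same
  choice from the same set of derivatives, whether or not that set is empty.\<close>

lemma ddir_cong:
  assumes "open S" "x \<in> S" "\<And>y. y \<in> S \<Longrightarrow> f y = g y"
  shows "ddir v f x = ddir v g x"
proof -
  have "(f has_derivative F) (at x) \<longleftrightarrow> (g has_derivative F) (at x)" for F
    using assms has_derivative_transform_within_open[of f F x UNIV S g]
      has_derivative_transform_within_open[of g F x UNIV S f] by auto
  then show ?thesis unfolding ddir_def frechet_derivative_def by simp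
qed

lemma differentiable_cong_open:
  assumes "f differentiable (at x)" "open S" "x \<in> S" "\<And>y. y \<in> S \<Longrightarrow> f y = g y"
  shows "g differentiable (at x)"
  using assms(1) has_derivative_transform_within_open[OF _ assms(2,3), of f _ UNIV g] assms(4)
  unfolding differentiable_def by blast

lemma dir_derivs_cong:
  assumes "open S" "\<And>y. y \<in> S \<Longrightarrow> f y = g y" "x \<in> S"
  shows "dir_derivs vs f x = dir_derivs vs g x"
  using assms(3)
  by (induction vs arbitrary: x) (auto simp: assms(2) intro: ddir_cong[OF assms(1)])

lemma smooth_on_cong:
  assumes "open S" "\<And>y. y \<in> S \<Longrightarrow> f y = g y" "smooth_on f S"
  shows "smooth_on g S"
  unfolding smooth_on_def
proof (intro allI ballI)
  fix vs x assume x: "x \<in> S"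
  then have "dir_derivs vs f differentiable (at x)" using assms(3) unfolding smooth_on_def by blast
  then show "dir_derivs vs g differentiable (at x)"
    by (rule differentiable_cong_open[OF _ assms(1) x]) (rule dir_derivs_cong[OF assms(1,2)])
qed

lemma smooth_onD: "smooth_on f S \<Longrightarrow> x \<in> S \<Longrightarrow> f differentiable (at x)"
  unfolding smooth_on_def using dir_derivs.simps(1) by metis

lemma smooth_on_has_derivative:
  "smooth_on f S \<Longrightarrow> x \<in> S \<Longrightarrow> (f has_derivative (\<lambda>v. ddir v f x)) (at x)"
  by (simp add: has_derivative_ddir smooth_onD)

lemma smooth_on_continuous: "smooth_on f S \<Longrightarrow> continuous_on S f"
  by (meson continuous_at_imp_continuous_on differentiable_imp_continuous_within smooth_onD)

lemma smooth_on_dir_derivs: "smooth_on f S \<Longrightarrow> smooth_on (dir_derivs vs f) S"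
  unfolding smooth_on_def by (simp flip: dir_derivs_append)

lemma smooth_on_ddir: "smooth_on f S \<Longrightarrow> smooth_on (ddir v f) S"
  using smooth_on_dir_derivs[of f S "[v]"] by simp

lemma smooth_on_UnionI: "(\<And>x. x \<in> S \<Longrightarrow> \<exists>T. x \<in> T \<and> smooth_on f T) \<Longrightarrow> smooth_on f S"
  unfolding smooth_on_def by blast

text \<open>Smoothness is the largest property that implies differentiability and is stable under
  directional derivatives, so it can be proved by exhibiting an invariant class. Closure properties
  then need a single differentiation instead of a Leibniz formula for iterated derivatives.\<close>

lemma smooth_on_coinduct:
  assumes "open S" "P f"
    and step: "\<And>f v. P f \<Longrightarrow> (\<forall>x\<in>S. f differentiable (at x)) \<and> (\<exists>g. P g \<and> (\<forall>x\<in>S. ddir v f x = g x))"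
  shows "smooth_on f S"
proof -
  have ex: "\<exists>g. P g \<and> (\<forall>x\<in>S. dir_derivs vs f x = g x)" for vs
  proof (induction vs)
    case Nil then show ?case using assms by auto
  next
    case (Cons v vs)
    then obtain g where g: "P g" "\<forall>x\<in>S. dir_derivs vs f x = g x" by blast
    then have "\<forall>x\<in>S. ddir v (dir_derivs vs f) x = ddir v g x"
      using ddir_cong[OF assms(1)] by blast
    then show ?case using step[OF g(1), of v] by (metis dir_derivs_Cons)
  qed
  show ?thesis unfolding smooth_on_def
  proof safe
    fix vs x assume x: "x \<in> S"
    obtain g where "P g" "\<forall>x\<in>S. dir_derivs vs f x = g x" using ex by blast
    then show "dir_derivs vs f differentiable (at x)"
      using differentiable_cong_open[of g x S "dir_derivs vs f"] step[of g] x assms(1) by simp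
  qed
qed

text \<open>The direction applied first is the last entry of the list, so the list is split from its
  end.\<close>

lemma smooth_on_of_ddir:
  assumes "\<And>x. x \<in> S \<Longrightarrow> f differentiable (at x)" "\<And>v. smooth_on (ddir v f) S"
  shows "smooth_on f S"
  unfolding smooth_on_def
proof (intro allI ballI)
  fix vs x assume "x \<in> S"
  then show "dir_derivs vs f differentiable (at x)"
  proof (cases vs rule: rev_cases)
    case (snoc us v)
    then show ?thesis using assms(2)[of v] \<open>x \<in> S\<close>
      by (simp add: dir_derivs_append smooth_on_def)
  qed (use assms(1) in auto)
qed

lemma ddir_const [simp]: "ddir v (\<lambda>x. c) = (\<lambda>x. 0)"
  by (simp add: fun_eq_iff ddir_def)

lemma smooth_on_const: "open S \<Longrightarrow> smooth_on (\<lambda>x. c) S"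
  by (rule smooth_on_coinduct[where P = "\<lambda>f. \<exists>c. f = (\<lambda>_. c)"]) auto

lemma smooth_on_bounded_linear:
  assumes "bounded_linear L" "smooth_on f S" "open S"
  shows "smooth_on (\<lambda>x. L (f x)) S"
proof (rule smooth_on_coinduct[where P = "\<lambda>g. \<exists>f. smooth_on f S \<and> g = (\<lambda>x. L (f x))"])
  fix g v assume "\<exists>f. smooth_on f S \<and> g = (\<lambda>x. L (f x))"
  then obtain f where f: "smooth_on f S" "g = (\<lambda>x. L (f x))" by blast
  have d: "(g has_derivative (\<lambda>v. L (ddir v f x))) (at x)" if "x \<in> S" for x
    using bounded_linear.has_derivative[OF assms(1) smooth_on_has_derivative[OF f(1) that]] f(2) by simp
  then show "(\<forall>x\<in>S. g differentiable at x) \<and>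
      (\<exists>h. (\<exists>f. smooth_on f S \<and> h = (\<lambda>x. L (f x))) \<and> (\<forall>x\<in>S. ddir v g x = h x))"
    using smooth_on_ddir[OF f(1), of v] ddir_eqI[OF d] unfolding differentiable_def by blast
qed (use assms in auto)

lemma ddir_affine:
  assumes "bounded_linear L" "f differentiable (at (c + L y))"
  shows "(\<lambda>y. f (c + L y)) differentiable (at y)" "ddir v (\<lambda>y. f (c + L y)) y = ddir (L v) f (c + L y)"
proof -
  have "((\<lambda>y. c + L y) has_derivative L) (at y)"
    using bounded_linear_imp_has_derivative[OF assms(1)] by (auto intro!: derivative_eq_intros)
  from has_derivative_compose[OF this has_derivative_ddir[OF assms(2)]]
  have "((\<lambda>y. f (c + L y)) has_derivative (\<lambda>v. ddir (L v) f (c + L y))) (at y)" .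
  then show "(\<lambda>y. f (c + L y)) differentiable (at y)"
    "ddir v (\<lambda>y. f (c + L y)) y = ddir (L v) f (c + L y)"
    using ddir_eqI[of "\<lambda>y. f (c + L y)"] unfolding differentiable_def by blast+
qed

text \<open>The linear part is the same at every point, so it only transports the directions. Time
  slices and the two projections of the cylinder are all instances.\<close>

lemma dir_derivs_affine:
  assumes "bounded_linear L" "smooth_on f S" "open S" "c + L y \<in> S"
  shows "dir_derivs vs (\<lambda>y. f (c + L y)) y = dir_derivs (map L vs) f (c + L y)"
  using assms(4)
proof (induction vs arbitrary: y)
  case (Cons v vs)
  let ?T = "(\<lambda>y. c + L y) -` S"
  have "open ?T"
    by (intro open_vimage assms continuous_intros linear_continuous_on)
  then have "ddir v (dir_derivs vs (\<lambda>y. f (c + L y))) y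
      = ddir v (\<lambda>y. dir_derivs (map L vs) f (c + L y)) y"
    by (rule ddir_cong) (use Cons in auto)
  also have "\<dots> = ddir (L v) (dir_derivs (map L vs) f) (c + L y)"
    by (rule ddir_affine(2)[OF assms(1)]) (use assms Cons smooth_on_def in blast)
  finally show ?case by simp
qed simp

lemma smooth_on_affine:
  assumes "bounded_linear L" "smooth_on f S" "open S" "\<And>y. y \<in> T \<Longrightarrow> c + L y \<in> S"
  shows "smooth_on (\<lambda>y. f (c + L y)) T"
  unfolding smooth_on_def
proof (intro allI ballI)
  fix vs y assume y: "y \<in> T"
  let ?T = "(\<lambda>y. c + L y) -` S"
  have "open ?T"
    by (intro open_vimage assms continuous_intros linear_continuous_on)
  moreover have "(\<lambda>y. dir_derivs (map L vs) f (c + L y)) differentiable (at y)"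
    by (rule ddir_affine(1)[OF assms(1)]) (use assms y smooth_on_def in blast)
  ultimately show "dir_derivs vs (\<lambda>y. f (c + L y)) differentiable (at y)"
    using assms(4)[OF y] differentiable_cong_open[of "\<lambda>y. dir_derivs (map L vs) f (c + L y)" y ?T]
    by (simp add: dir_derivs_affine[OF assms(1-3)])
qed

section \<open>Sums, products and quotients of smooth functions\<close>

context
  fixes S :: "'a::euclidean_space set" and h :: "'a \<Rightarrow> real"
begin

text \<open>One reciprocal is adjoined to the smooth functions. Its derivative
  \<open>- h' / h^2\<close> stays in the ring so generated, hence the class is stable under
  differentiation and the coinduction principle applies. Sums and products of smooth functions are
  the case \<open>h = 1\<close>.\<close>

inductive smooth_ring :: "('a \<Rightarrow> real) \<Rightarrow> bool" where
  smooth: "smooth_on f S \<Longrightarrow> smooth_ring f"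
| add: "smooth_ring f \<Longrightarrow> smooth_ring g \<Longrightarrow> smooth_ring (\<lambda>x. f x + g x)"
| mult: "smooth_ring f \<Longrightarrow> smooth_ring g \<Longrightarrow> smooth_ring (\<lambda>x. f x * g x)"
| inverse: "smooth_ring (\<lambda>x. inverse (h x))"

lemma smooth_on_smooth_ring:
  assumes S: "open S" and h: "smooth_on h S" "\<And>x. x \<in> S \<Longrightarrow> h x \<noteq> 0" and f: "smooth_ring f"
  shows "smooth_on f S"
proof (rule smooth_on_coinduct[where P = smooth_ring, OF S f])
  fix f v assume "smooth_ring f"
  then show "(\<forall>x\<in>S. f differentiable (at x)) \<and> (\<exists>g. smooth_ring g \<and> (\<forall>x\<in>S. ddir v f x = g x))"
  proof induction
    case (smooth f)
    then show ?case using smooth_on_ddir smooth_onD smooth_ring.smooth by blast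
  next
    case (add f g)
    then obtain f' g' where *: "smooth_ring f'" "smooth_ring g'"
      "\<forall>x\<in>S. ddir v f x = f' x" "\<forall>x\<in>S. ddir v g x = g' x" by auto
    have "ddir v (\<lambda>x. f x + g x) x = f' x + g' x" if "x \<in> S" for x
      using ddir_eqI[OF has_derivative_add[OF has_derivative_ddir has_derivative_ddir], of f x g v]
        add.IH that *(3,4) by simp
    then show ?case using add smooth_ring.add[OF *(1,2)] by (intro conjI) auto
  next
    case (mult f g)
    then obtain f' g' where *: "smooth_ring f'" "smooth_ring g'"
      "\<forall>x\<in>S. ddir v f x = f' x" "\<forall>x\<in>S. ddir v g x = g' x" by auto
    have "ddir v (\<lambda>x. f x * g x) x = f x * g' x + f' x * g x" if "x \<in> S" for x
      using ddir_eqI[OF has_derivative_mult[OF has_derivative_ddir has_derivative_ddir], of f x g v]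
        mult.IH that *(3,4) by simp
    moreover have "smooth_ring (\<lambda>x. f x * g' x + f' x * g x)"
      by (intro smooth_ring.add smooth_ring.mult * mult)
    ultimately show ?case using mult by auto
  next
    case inverse
    have d: "((\<lambda>x. inverse (h x)) has_derivative (\<lambda>v. - (inverse (h x) * ddir v h x * inverse (h x)))) (at x)"
      if "x \<in> S" for x
      using Deriv.has_derivative_inverse[OF h(2)[OF that] smooth_on_has_derivative[OF h(1) that]] .
    have "smooth_ring (\<lambda>x. (-1) * (inverse (h x) * ddir v h x * inverse (h x)))"
      by (intro smooth_ring.mult smooth_ring.inverse smooth_ring.smooth smooth_on_ddir h smooth_on_const S)
    then show ?case using d ddir_eqI[OF d] unfolding differentiable_def by auto
  qed
qed

end

context
  fixes S :: "'a::euclidean_space set" and f g :: "'a \<Rightarrow> real"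
  assumes S: "open S" and f: "smooth_on f S" and g: "smooth_on g S"
begin

lemma smooth_on_add: "smooth_on (\<lambda>x. f x + g x) S"
  by (rule smooth_on_smooth_ring[OF S smooth_on_const[OF S, of 1] _ smooth_ring.add])
    (simp_all add: smooth_ring.smooth f g)

lemma smooth_on_mult: "smooth_on (\<lambda>x. f x * g x) S"
  by (rule smooth_on_smooth_ring[OF S smooth_on_const[OF S, of 1] _ smooth_ring.mult])
    (simp_all add: smooth_ring.smooth f g)

lemma smooth_on_divide: "(\<And>x. x \<in> S \<Longrightarrow> g x \<noteq> 0) \<Longrightarrow> smooth_on (\<lambda>x. f x / g x) S"
  unfolding divide_inverse
  by (rule smooth_on_smooth_ring[OF S g _ smooth_ring.mult[OF smooth_ring.smooth[OF f] smooth_ring.inverse]])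

lemma ddir_add: "x \<in> S \<Longrightarrow> ddir v (\<lambda>x. f x + g x) x = ddir v f x + ddir v g x"
  by (rule ddir_eqI[OF has_derivative_add[OF smooth_on_has_derivative[OF f] smooth_on_has_derivative[OF g]]])

lemma ddir_mult: "x \<in> S \<Longrightarrow> ddir v (\<lambda>x. f x * g x) x = f x * ddir v g x + ddir v f x * g x"
  by (rule ddir_eqI[OF has_derivative_mult[OF smooth_on_has_derivative[OF f] smooth_on_has_derivative[OF g]]])

end

lemma smooth_on_cmult:
  fixes f :: "'a::euclidean_space \<Rightarrow> real"
  shows "open S \<Longrightarrow> smooth_on f S \<Longrightarrow> smooth_on (\<lambda>x. c * f x) S"
  by (intro smooth_on_mult smooth_on_const)

lemma smooth_on_diff:
  fixes f g :: "'a::euclidean_space \<Rightarrow> real"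
  assumes "open S" "smooth_on f S" "smooth_on g S"
  shows "smooth_on (\<lambda>x. f x - g x) S"
  using smooth_on_add[OF assms(1,2) smooth_on_cmult[OF assms(1,3), of "-1"]] by simp

lemma smooth_on_sum:
  fixes f :: "'i \<Rightarrow> 'a::euclidean_space \<Rightarrow> real"
  assumes "open S" "\<And>i. i \<in> I \<Longrightarrow> smooth_on (f i) S"
  shows "smooth_on (\<lambda>x. \<Sum>i\<in>I. f i x) S"
  using assms(2) by (induction I rule: infinite_finite_induct)
    (auto intro: smooth_on_add smooth_on_const assms(1))

lemma smooth_on_power:
  fixes f :: "'a::euclidean_space \<Rightarrow> real"
  assumes "open S" "smooth_on f S"
  shows "smooth_on (\<lambda>x. f x ^ n) S"
  by (induction n) (auto intro: smooth_on_mult smooth_on_const assms)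

lemma ddir_sum:
  fixes f :: "'i \<Rightarrow> 'a::euclidean_space \<Rightarrow> real"
  assumes "\<And>i. i \<in> I \<Longrightarrow> smooth_on (f i) S" "x \<in> S"
  shows "ddir v (\<lambda>x. \<Sum>i\<in>I. f i x) x = (\<Sum>i\<in>I. ddir v (f i) x)"
  by (rule ddir_eqI) (intro has_derivative_sum smooth_on_has_derivative[where S = S] assms)

lemma ddir_add_direction:
  "f differentiable (at x) \<Longrightarrow> ddir (v + w) f x = ddir v f x + ddir w f x"
  "f differentiable (at x) \<Longrightarrow> ddir (c *\<^sub>R v) f x = c *\<^sub>R ddir v f x"
  by (drule has_derivative_ddir[THEN has_derivative_linear], simp add: linear_iff)+

lemma ddir_sum_direction:
  "f differentiable (at x) \<Longrightarrow> ddir (\<Sum>i\<in>I. c i *\<^sub>R b i) f x = (\<Sum>i\<in>I. c i *\<^sub>R ddir (b i) f x)"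
proof -
  assume f: "f differentiable (at x)"
  show ?thesis
    using linear_sum[OF has_derivative_ddir[OF f, THEN has_derivative_linear], of "\<lambda>i. c i *\<^sub>R b i" I]
    by (simp add: ddir_add_direction[OF f])
qed

section \<open>Symmetry of mixed derivatives\<close>

lemma has_real_derivative_ddir:
  fixes f :: "'a::real_normed_vector \<Rightarrow> real"
  assumes "f differentiable (at (x + s *\<^sub>R v))"
  shows "((\<lambda>s. f (x + s *\<^sub>R v)) has_real_derivative ddir v f (x + s *\<^sub>R v)) (at s)"
proof -
  have "bounded_linear (\<lambda>s. s *\<^sub>R v)" by (rule bounded_linear_scaleR_left)
  note * = ddir_affine[OF this assms]
  have "((\<lambda>s. f (x + s *\<^sub>R v)) has_derivative (\<lambda>h. h * ddir v f (x + s *\<^sub>R v))) (at s)"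
    using has_derivative_ddir[OF *(1)] *(2) ddir_add_direction(2)[OF assms] by (simp add: mult.commute)
  then show ?thesis
    by (simp add: has_field_derivative_def mult_commute_abs)
qed

text \<open>By the mean value theorem, the second difference quotient with step \<open>h\<close> is a value of either
  mixed derivative at a point that tends to \<open>x\<close> with \<open>h\<close>.\<close>

lemma second_difference:
  fixes f :: "'a::euclidean_space \<Rightarrow> real"
  assumes f: "smooth_on f S" and h: "h > 0"
    and S: "\<And>s t. 0 \<le> s \<Longrightarrow> s \<le> h \<Longrightarrow> 0 \<le> t \<Longrightarrow> t \<le> h \<Longrightarrow> x + s *\<^sub>R v + t *\<^sub>R w \<in> S"
  shows "\<exists>s t. 0 \<le> s \<and> s \<le> h \<and> 0 \<le> t \<and> t \<le> h \<and>
    f (x + h *\<^sub>R v + h *\<^sub>R w) - f (x + h *\<^sub>R v) - f (x + h *\<^sub>R w) + f x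
      = h * h * ddir w (ddir v f) (x + s *\<^sub>R v + t *\<^sub>R w)"
proof -
  let ?F = "\<lambda>s. f (x + h *\<^sub>R w + s *\<^sub>R v) - f (x + s *\<^sub>R v)"
  have d1: "(?F has_real_derivative (ddir v f (x + h *\<^sub>R w + s *\<^sub>R v) - ddir v f (x + s *\<^sub>R v))) (at s)"
    if "0 \<le> s" "s \<le> h" for s
    using S[OF that, of h] S[OF that, of 0] h
    by (intro DERIV_diff has_real_derivative_ddir smooth_onD[OF f]) (auto simp: algebra_simps)
  obtain s where s: "0 < s" "s < h"
    "?F h - ?F 0 = (h - 0) * (ddir v f (x + h *\<^sub>R w + s *\<^sub>R v) - ddir v f (x + s *\<^sub>R v))"
    using MVT2[where f = ?F, OF h d1] by blast
  let ?G = "\<lambda>t. ddir v f (x + s *\<^sub>R v + t *\<^sub>R w)"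
  have d2: "(?G has_real_derivative ddir w (ddir v f) (x + s *\<^sub>R v + t *\<^sub>R w)) (at t)"
    if "0 \<le> t" "t \<le> h" for t
    using S[of s t] that s
    by (intro has_real_derivative_ddir smooth_onD[OF smooth_on_ddir[OF f]]) auto
  obtain t where t: "0 < t" "t < h"
    "?G h - ?G 0 = (h - 0) * ddir w (ddir v f) (x + s *\<^sub>R v + t *\<^sub>R w)"
    using MVT2[where f = ?G, OF h d2] by blast
  show ?thesis
    using s t by (intro exI[of _ s] exI[of _ t]) (simp add: algebra_simps)
qed

text \<open>Exchanging \<open>v\<close> and \<open>w\<close> does not change the second difference,
  so for each small step the two mixed derivatives share a value, at two points close to
  \<open>x\<close>. Their continuity yields equality at \<open>x\<close>.\<close>

lemma ddir_commute:
  fixes f :: "'a::euclidean_space \<Rightarrow> real"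
  assumes "open S" "smooth_on f S" "x \<in> S"
  shows "ddir v (ddir w f) x = ddir w (ddir v f) x"
proof -
  let ?F = "ddir w (ddir v f)" and ?G = "ddir v (ddir w f)"
  obtain d where d: "d > 0" "ball x d \<subseteq> S" using openE[OF assms(1,3)] by metis
  \<comment> \<open>The summand 1 keeps \<open>k\<close> positive when both directions
    vanish.\<close>
  define k where "k = 1 + norm v + norm w"
  have k: "k > 0" unfolding k_def by (simp add: add_pos_nonneg)
  have near: "dist x (x + s *\<^sub>R v + t *\<^sub>R w) \<le> h * k"
    if "0 \<le> s" "s \<le> h" "0 \<le> t" "t \<le> h" for s t h
  proof -
    have "norm (s *\<^sub>R v + t *\<^sub>R w) \<le> s * norm v + t * norm w"
      using norm_triangle_ineq[of "s *\<^sub>R v" "t *\<^sub>R w"] that by simp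
    also have "\<dots> \<le> h * norm v + h * norm w" using that by (intro add_mono mult_right_mono) auto
    also have "\<dots> \<le> h * k" using that by (simp add: k_def algebra_simps)
    finally show ?thesis
      using norm_minus_cancel[of "s *\<^sub>R v + t *\<^sub>R w"] by (simp add: dist_norm algebra_simps)
  qed
  have ex: "\<exists>p q. dist x p \<le> h * k \<and> dist x q \<le> h * k \<and> ?F p = ?G q" if h: "0 < h" "h * k < d" for h
  proof -
    have "x + s *\<^sub>R v + t *\<^sub>R w \<in> S" if "0 \<le> s" "s \<le> h" "0 \<le> t" "t \<le> h" for s t
      using near[OF that] h d(2) by (auto simp: subset_iff)
    from second_difference[OF assms(2) h(1) this] obtain s t where
      1: "0 \<le> s" "s \<le> h" "0 \<le> t" "t \<le> h"
      "f (x + h *\<^sub>R v + h *\<^sub>R w) - f (x + h *\<^sub>R v) - f (x + h *\<^sub>R w) + f x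
        = h * h * ?F (x + s *\<^sub>R v + t *\<^sub>R w)" by blast
    have "x + s *\<^sub>R w + t *\<^sub>R v \<in> S" if "0 \<le> s" "s \<le> h" "0 \<le> t" "t \<le> h" for s t
      using near[OF that(3,4,1,2)] h d(2) by (auto simp: subset_iff algebra_simps)
    from second_difference[OF assms(2) h(1) this] obtain s' t' where
      2: "0 \<le> s'" "s' \<le> h" "0 \<le> t'" "t' \<le> h"
      "f (x + h *\<^sub>R w + h *\<^sub>R v) - f (x + h *\<^sub>R w) - f (x + h *\<^sub>R v) + f x
        = h * h * ?G (x + s' *\<^sub>R w + t' *\<^sub>R v)" by blast
    have "?F (x + s *\<^sub>R v + t *\<^sub>R w) = ?G (x + s' *\<^sub>R w + t' *\<^sub>R v)"
      using 1(5) 2(5) h(1) by (simp add: algebra_simps)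
    moreover have "dist x (x + s' *\<^sub>R w + t' *\<^sub>R v) \<le> h * k"
      using near[OF 2(3,4,1,2)] by (simp add: algebra_simps)
    ultimately show ?thesis using near[OF 1(1-4)] by blast
  qed
  \<comment> \<open>With this choice \<open>h n * k = d / (2 + n)\<close>, which tends to 0 and is
    below \<open>d\<close> already for \<open>n = 0\<close>.\<close>
  define h where "h n = d / (k * (2 + real n))" for n
  have hk: "h n * k = d / (2 + real n)" for n using k by (simp add: h_def)
  have "0 < h n" "h n * k < d" for n
    using d(1) k by (simp_all add: hk divide_less_eq) (simp add: h_def)
  then have "\<forall>n. \<exists>p q. dist x p \<le> h n * k \<and> dist x q \<le> h n * k \<and> ?F p = ?G q"
    using ex by blast
  then obtain p q where pq: "\<And>n. dist x (p n) \<le> h n * k" "\<And>n. dist x (q n) \<le> h n * k"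
    "\<And>n. ?F (p n) = ?G (q n)" by metis
  have "(\<lambda>n. h n * k) \<longlonglongrightarrow> 0"
    unfolding hk by (intro tendsto_divide_0[OF tendsto_const] filterlim_at_top_imp_at_infinity
        filterlim_tendsto_add_at_top[OF tendsto_const] filterlim_real_sequentially)
  moreover have "r \<longlonglongrightarrow> x" if "(\<lambda>n. h n * k) \<longlonglongrightarrow> 0" "\<And>n. dist x (r n) \<le> h n * k" for r
  proof (rule metric_tendsto_imp_tendsto[OF that(1)])
    show "\<forall>\<^sub>F n in sequentially. dist (r n) x \<le> dist (h n * k) 0"
      using that(2) by (auto simp: dist_commute intro!: always_eventually order_trans[OF _ abs_ge_self])
  qed
  ultimately have "p \<longlonglongrightarrow> x" "q \<longlonglongrightarrow> x" using pq(1,2) by blast+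
  moreover have "isCont ?F x" "isCont ?G x"
    using assms smooth_on_ddir smooth_onD differentiable_imp_continuous_within by metis+
  ultimately have "(\<lambda>n. ?F (p n)) \<longlonglongrightarrow> ?F x" "(\<lambda>n. ?G (q n)) \<longlonglongrightarrow> ?G x"
    using isCont_tendsto_compose by metis+
  then show ?thesis unfolding pq(3) using LIMSEQ_unique by metis
qed

lemma smooth_on_bounded:
  fixes c :: "'a::euclidean_space \<Rightarrow> real"
  assumes "smooth_on c U" "compact K" "K \<subseteq> U"
  shows "\<exists>B. \<forall>y\<in>K. \<bar>c y\<bar> \<le> B"
proof -
  have "continuous_on K c"
    using smooth_on_continuous[OF assms(1)] assms(3) continuous_on_subset by blast
  then have "bounded (c ` K)" by (intro compact_imp_bounded compact_continuous_image assms)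
  then show ?thesis unfolding bounded_iff by auto
qed

section \<open>Integrals over cubes\<close>

text \<open>Nested pairs parametrise \<open>real^3\<close>, so that integrals over boxes can be
  split by the Fubini theorem for products.\<close>

definition vec3 :: "real \<times> real \<times> real \<Rightarrow> real^3" where
  "vec3 = (\<lambda>(x, y, z). x *\<^sub>R axis 1 1 + y *\<^sub>R axis 2 1 + z *\<^sub>R axis 3 1)"

definition unvec3 :: "real^3 \<Rightarrow> real \<times> real \<times> real" where
  "unvec3 v = (v $ 1, v $ 2, v $ 3)"

lemma vec3_nth [simp]: "vec3 (x, y, z) $ 1 = x" "vec3 (x, y, z) $ 2 = y" "vec3 (x, y, z) $ 3 = z"
  by (simp_all add: vec3_def axis_def)

lemma vec3_unvec3 [simp]: "vec3 (v $ 1, v $ 2, v $ 3) = v"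
  by (simp add: vec_eq_iff forall_3)

lemma mem_cbox_vec3: "vec3 (x, y, z) \<in> cbox p q \<longleftrightarrow> x \<in> {p$1..q$1} \<and> y \<in> {p$2..q$2} \<and> z \<in> {p$3..q$3}"
  by (auto simp: mem_box_cart forall_3)

lemma vec3_cbox: "w \<in> cbox (unvec3 p) (unvec3 q) \<Longrightarrow> vec3 w \<in> cbox p q"
  by (cases w) (auto simp: unvec3_def mem_cbox_vec3 cbox_Pair_eq)

lemma continuous_on_vec3 [continuous_intros]:
  "continuous_on S f \<Longrightarrow> continuous_on S (\<lambda>x. vec3 (f x))"
  unfolding vec3_def split_beta by (intro continuous_intros)

definition cint :: "real^3 \<Rightarrow> real^3 \<Rightarrow> (real^3 \<Rightarrow> real) \<Rightarrow> real" where
  "cint p q f = integral (cbox (unvec3 p) (unvec3 q)) (\<lambda>w. f (vec3 w))"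

lemma continuous_on_comp_vec3:
  "continuous_on (cbox p q) f \<Longrightarrow> continuous_on (cbox (unvec3 p) (unvec3 q)) (\<lambda>w. f (vec3 w))"
  by (rule continuous_on_compose2[of "cbox p q" f]) (auto intro!: continuous_intros simp: vec3_cbox)

lemma cint_integrable:
  fixes f :: "real^3 \<Rightarrow> real"
  shows "continuous_on (cbox p q) f \<Longrightarrow> (\<lambda>w. f (vec3 w)) integrable_on cbox (unvec3 p) (unvec3 q)"
  by (rule integrable_continuous[OF continuous_on_comp_vec3])

lemma cint_add:
  "continuous_on (cbox p q) f \<Longrightarrow> continuous_on (cbox p q) g \<Longrightarrow>
    cint p q (\<lambda>y. f y + g y) = cint p q f + cint p q g"
  unfolding cint_def by (intro integral_add cint_integrable)

lemma cint_cmult: "cint p q (\<lambda>y. c * f y) = c * cint p q f"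
  unfolding cint_def by simp

lemma cint_sum:
  "finite I \<Longrightarrow> (\<And>i. i \<in> I \<Longrightarrow> continuous_on (cbox p q) (f i)) \<Longrightarrow>
    cint p q (\<lambda>y. \<Sum>i\<in>I. f i y) = (\<Sum>i\<in>I. cint p q (f i))"
  unfolding cint_def by (intro integral_sum cint_integrable)

lemma cint_mono:
  "continuous_on (cbox p q) f \<Longrightarrow> continuous_on (cbox p q) g \<Longrightarrow>
    (\<And>y. y \<in> cbox p q \<Longrightarrow> f y \<le> g y) \<Longrightarrow> cint p q f \<le> cint p q g"
  unfolding cint_def by (intro integral_le cint_integrable) (auto simp: vec3_cbox)

lemma cint_nonneg:
  "continuous_on (cbox p q) f \<Longrightarrow> (\<And>y. y \<in> cbox p q \<Longrightarrow> 0 \<le> f y) \<Longrightarrow> 0 \<le> cint p q f"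
  unfolding cint_def by (intro integral_nonneg cint_integrable) (auto simp: vec3_cbox)

lemma cint_subset:
  assumes "continuous_on (cbox p q) f" "\<And>y. y \<in> cbox p q \<Longrightarrow> 0 \<le> f y" "cbox p' q' \<subseteq> cbox p q"
    and "\<And>i. p' $ i \<le> q' $ i"
  shows "cint p' q' f \<le> cint p q f"
  unfolding cint_def
proof (rule integral_subset_le)
  \<comment> \<open>A nonempty box contains its two corners, and these determine the inclusion of
    the parameter boxes.\<close>
  have "p' \<in> cbox p q" "q' \<in> cbox p q" using assms(3,4) by (auto simp: mem_box_cart subset_iff)
  then show "cbox (unvec3 p') (unvec3 q') \<subseteq> cbox (unvec3 p) (unvec3 q)"
    by (auto simp: unvec3_def mem_box_cart forall_3 cbox_Pair_eq
        intro: order_trans)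
  show "(\<lambda>w. f (vec3 w)) integrable_on cbox (unvec3 p') (unvec3 q')"
    by (intro cint_integrable continuous_on_subset[OF assms(1,3)])
qed (auto intro: cint_integrable assms simp: vec3_cbox)

lemma cint_has_real_derivative:
  assumes "convex T" "open T" "t \<in> T"
    and "\<And>t y. t \<in> T \<Longrightarrow> y \<in> cbox p q \<Longrightarrow> ((\<lambda>t. f t y) has_real_derivative f' t y) (at t)"
    and "\<And>t. t \<in> T \<Longrightarrow> continuous_on (cbox p q) (f t)"
    and "continuous_on (T \<times> cbox p q) (\<lambda>(t, y). f' t y)"
  shows "((\<lambda>t. cint p q (f t)) has_real_derivative cint p q (f' t)) (at t)"
proof -
  have "continuous_on (T \<times> cbox (unvec3 p) (unvec3 q)) (\<lambda>x. (\<lambda>(t, y). f' t y) (fst x, vec3 (snd x)))"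
    by (rule continuous_on_compose2[OF assms(6)]) (auto intro!: continuous_intros simp: vec3_cbox)
  then have "((\<lambda>t. cint p q (f t)) has_real_derivative cint p q (f' t)) (at t within T)"
    unfolding cint_def
    by (intro leibniz_rule_field_derivative cint_integrable assms has_field_derivative_at_within)
      (auto simp: split_beta vec3_cbox)
  then show ?thesis unfolding at_within_open[OF assms(3,2)] .
qed

section \<open>Fubini and integration by parts on a box\<close>

lemma vec3_line:
  "vec3 (x + s, y, z) = vec3 (x, y, z) + s *\<^sub>R axis 1 1"
  "vec3 (x, y + s, z) = vec3 (x, y, z) + s *\<^sub>R axis 2 1"
  "vec3 (x, y, z + s) = vec3 (x, y, z) + s *\<^sub>R axis 3 1"
  by (simp_all add: vec3_def algebra_simps)

lemma vec3_deriv: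
  fixes f :: "real^3 \<Rightarrow> real"
  assumes "f differentiable (at (vec3 (x, y, z)))"
  shows "((\<lambda>x. f (vec3 (x, y, z))) has_real_derivative ddir (axis 1 1) f (vec3 (x, y, z))) (at x)"
    and "((\<lambda>y. f (vec3 (x, y, z))) has_real_derivative ddir (axis 2 1) f (vec3 (x, y, z))) (at y)"
    and "((\<lambda>z. f (vec3 (x, y, z))) has_real_derivative ddir (axis 3 1) f (vec3 (x, y, z))) (at z)"
  using has_real_derivative_ddir[of f "vec3 (0, y, z)" x "axis 1 1"]
    has_real_derivative_ddir[of f "vec3 (x, 0, z)" y "axis 2 1"]
    has_real_derivative_ddir[of f "vec3 (x, y, 0)" z "axis 3 1"] assms
  by (simp_all flip: vec3_line)

lemma cint_iterated:
  assumes "continuous_on (cbox p q) f"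
  shows "cint p q f = integral {p$1..q$1} (\<lambda>x. integral {p$2..q$2} (\<lambda>y. integral {p$3..q$3} (\<lambda>z. f (vec3 (x, y, z)))))"
proof -
  have "integral (cbox (p$2, p$3) (q$2, q$3)) (\<lambda>w. f (vec3 (x, w)))
      = integral {p$2..q$2} (\<lambda>y. integral {p$3..q$3} (\<lambda>z. f (vec3 (x, y, z))))" if "x \<in> {p$1..q$1}" for x
  proof -
    have "continuous_on (cbox (p$2, p$3) (q$2, q$3)) (\<lambda>w. f (vec3 (x, w)))"
      by (rule continuous_on_compose2[OF assms])
        (use that in \<open>auto intro!: continuous_intros simp: mem_cbox_vec3 cbox_Pair_eq\<close>)
    from integral_prod_continuous[OF this] show ?thesis by simp
  qed
  then show ?thesis
    using integral_prod_continuous[OF continuous_on_comp_vec3[OF assms, unfolded unvec3_def]]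
    unfolding cint_def unvec3_def box_real by (simp cong: Henstock_Kurzweil_Integration.integral_cong del: atLeastAtMost_iff)
qed

lemma integral_deriv_eq_0:
  fixes f :: "real \<Rightarrow> real"
  assumes "l \<le> r" "\<And>x. x \<in> {l..r} \<Longrightarrow> (f has_real_derivative f' x) (at x)" "f l = 0" "f r = 0"
  shows "integral {l..r} f' = 0"
  using fundamental_theorem_of_calculus[OF assms(1), of f f'] assms
  by (auto simp: has_real_derivative_iff_has_vector_derivative intro: has_vector_derivative_at_within
      intro!: integral_unique)

text \<open>Integrating first in the direction \<open>i\<close>, the fundamental theorem leaves the
  values on the two faces orthogonal to it, where \<open>F\<close> vanishes. The cases differ only
  in how the coordinate \<open>i\<close> becomes the innermost one: 3 is there already, 2 takes one
  inner swap, and for 1 the outer integral is exchanged with the other two together.\<close>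

lemma cint_divergence:
  fixes F :: "real^3 \<Rightarrow> real"
  assumes le: "\<And>j. p $ j \<le> q $ j"
    and d: "\<And>y. y \<in> cbox p q \<Longrightarrow> F differentiable (at y)"
    and c: "continuous_on (cbox p q) (ddir (axis i 1) F)"
    and z: "\<And>y. y \<in> cbox p q \<Longrightarrow> y $ i = p $ i \<or> y $ i = q $ i \<Longrightarrow> F y = 0"
  shows "cint p q (ddir (axis i 1) F) = 0"
proof -
  let ?F = "\<lambda>x y z. ddir (axis i 1) F (vec3 (x, y, z))"
  have cont: "continuous_on S (\<lambda>u. ?F (f u) (g u) (h u))"
    if "continuous_on S f" "continuous_on S g" "continuous_on S h"
      "\<And>u. u \<in> S \<Longrightarrow> vec3 (f u, g u, h u) \<in> cbox p q" for S :: "'z::topological_space set" and f g h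
    by (rule continuous_on_compose2[OF c]) (use that in \<open>auto intro!: continuous_intros\<close>)
  have I: "cint p q (ddir (axis i 1) F) = integral {p$1..q$1} (\<lambda>x. integral {p$2..q$2} (\<lambda>y. integral {p$3..q$3} (?F x y)))"
    using cint_iterated[OF c] .
  consider "i = 1" | "i = 2" | "i = 3" using exhaust_3[of i] by blast
  then show ?thesis
  proof cases
    case 3
    then have "integral {p$3..q$3} (?F x y) = 0" if "x \<in> {p$1..q$1}" "y \<in> {p$2..q$2}" for x y
      using that le by (intro integral_deriv_eq_0[where f = "\<lambda>s. F (vec3 (x, y, s))"] z)
        (auto intro!: vec3_deriv d simp: mem_cbox_vec3)
    then show ?thesis unfolding I by (simp cong: Henstock_Kurzweil_Integration.integral_cong del: atLeastAtMost_iff)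
  next
    case 2
    have *: "integral {p$2..q$2} (\<lambda>y. ?F x y z) = 0" if "x \<in> {p$1..q$1}" "z \<in> {p$3..q$3}" for x z
      using that le 2 by (intro integral_deriv_eq_0[where f = "\<lambda>s. F (vec3 (x, s, z))"] z)
        (auto intro!: vec3_deriv d simp: mem_cbox_vec3)
    have "integral {p$2..q$2} (\<lambda>y. integral {p$3..q$3} (?F x y)) = 0" if "x \<in> {p$1..q$1}" for x
    proof -
      have "continuous_on (cbox (p$2, p$3) (q$2, q$3)) (\<lambda>(y, z). ?F x y z)"
        unfolding split_beta
        by (rule cont) (use that in \<open>auto intro!: continuous_intros simp: mem_cbox_vec3 cbox_Pair_eq\<close>)
      from integral_swap_continuous[OF this, unfolded box_real] * that show ?thesis by (simp cong: Henstock_Kurzweil_Integration.integral_cong del: atLeastAtMost_iff)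
    qed
    then show ?thesis unfolding I by (simp cong: Henstock_Kurzweil_Integration.integral_cong del: atLeastAtMost_iff)
  next
    case 1
    have *: "integral {p$1..q$1} (\<lambda>x. ?F x y z) = 0" if "y \<in> {p$2..q$2}" "z \<in> {p$3..q$3}" for y z
      using that le 1 by (intro integral_deriv_eq_0[where f = "\<lambda>s. F (vec3 (s, y, z))"] z)
        (auto intro!: vec3_deriv d simp: mem_cbox_vec3)
    have ci: "continuous_on (cbox (p$1, p$2, p$3) (q$1, q$2, q$3)) (\<lambda>(x, y, z). ?F x y z)"
      unfolding split_beta
      by (rule cont) (auto intro!: continuous_intros simp: mem_cbox_vec3 cbox_Pair_eq)
    have "cint p q (ddir (axis i 1) F) = integral {p$1..q$1} (\<lambda>x. integral (cbox (p$2, p$3) (q$2, q$3)) (\<lambda>(y, z). ?F x y z))"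
    proof -
      have "(\<lambda>(y, z). ?F x y z) = (\<lambda>w. ddir (axis i 1) F (vec3 (x, w)))" for x by auto
      moreover have "(\<lambda>(x, y, z). ?F x y z) = (\<lambda>w. ddir (axis i 1) F (vec3 w))" by auto
      ultimately show ?thesis
        unfolding cint_def unvec3_def using integral_prod_continuous[OF ci] by simp
    qed
    also have "\<dots> = integral (cbox (p$2, p$3) (q$2, q$3)) (\<lambda>w. integral {p$1..q$1} (\<lambda>x. ddir (axis i 1) F (vec3 (x, w))))"
      using integral_swap_continuous[of "p$1" "(p$2, p$3)" "q$1" "(q$2, q$3)" "\<lambda>x (y, z). ?F x y z"] ci
      by (simp add: split_beta)
    also have "\<dots> = integral (cbox (p$2, p$3) (q$2, q$3)) (\<lambda>_. 0)"
      by (rule Henstock_Kurzweil_Integration.integral_cong) (use * in \<open>auto simp: cbox_Pair_eq\<close>)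
    finally show ?thesis by simp
  qed
qed

text \<open>One-dimensional Sobolev inequality in \<open>L^1\<close>: \<open>|f x|\<close> exceeds
  any other \<open>|f s|\<close> by at most the integral of \<open>|f'|\<close>, and averaging over
  \<open>s\<close> brings in \<open>|f|\<close> with the factor \<open>1 / (r - l)\<close>. The
  stated factor is the sum of both, so that \<open>f\<close> and \<open>f'\<close> can be treated
  alike.\<close>

lemma interval_sup_bound:
  fixes f :: "real \<Rightarrow> real"
  assumes lr: "l < r" and x: "x \<in> {l..r}"
    and f: "\<And>x. x \<in> {l..r} \<Longrightarrow> (f has_real_derivative f' x) (at x)" and c: "continuous_on {l..r} f'"
  shows "\<bar>f x\<bar> \<le> (1 + 1 / (r - l)) * integral {l..r} (\<lambda>x. \<bar>f x\<bar> + \<bar>f' x\<bar>)"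
proof -
  let ?I = "integral {l..r} (\<lambda>x. \<bar>f' x\<bar>)" and ?J = "integral {l..r} (\<lambda>x. \<bar>f x\<bar>)"
  have cf: "continuous_on {l..r} f"
    using f by (meson DERIV_isCont continuous_at_imp_continuous_on)
  have i: "(\<lambda>x. \<bar>f' x\<bar>) integrable_on {l..r}" "(\<lambda>x. \<bar>f x\<bar>) integrable_on {l..r}"
    using c cf by (auto intro!: integrable_continuous_interval continuous_intros)
  have diff: "\<bar>f v - f u\<bar> \<le> ?I" if "l \<le> u" "u \<le> v" "v \<le> r" for u v
  proof -
    have "(f' has_integral (f v - f u)) {u..v}"
      using that f by (intro fundamental_theorem_of_calculus)
        (auto simp: has_real_derivative_iff_has_vector_derivative intro: has_vector_derivative_at_within)
    moreover have ic: "(\<lambda>x. \<bar>f' x\<bar>) integrable_on {u..v}" "f' integrable_on {u..v}"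
      using that continuous_on_subset[OF c, of "{u..v}"]
      by (auto intro!: integrable_continuous_interval continuous_intros)
    ultimately have "\<bar>f v - f u\<bar> \<le> integral {u..v} (\<lambda>x. \<bar>f' x\<bar>)"
      using integral_norm_bound_integral[OF ic(2,1)] by (auto simp: integral_unique)
    also have "\<dots> \<le> ?I" using that ic i by (intro integral_subset_le) auto
    finally show ?thesis .
  qed
  have "\<bar>f x\<bar> - ?I \<le> \<bar>f s\<bar>" if "s \<in> {l..r}" for s
    using diff[of s x] diff[of x s] that x by (cases "s \<le> x") auto
  then have "integral {l..r} (\<lambda>s. \<bar>f x\<bar> - ?I) \<le> ?J"
    by (intro integral_le i) auto
  then have "(r - l) * (\<bar>f x\<bar> - ?I) \<le> ?J" using lr by simp
  then have "\<bar>f x\<bar> - ?I \<le> ?J / (r - l)" using lr by (simp add: field_simps)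
  moreover have "0 \<le> ?I" "0 \<le> ?J" by (auto intro!: integral_nonneg i)
  ultimately have "\<bar>f x\<bar> \<le> (?J + ?I) + (?J + ?I) / (r - l)"
    using lr divide_nonneg_nonneg[of ?I "r - l"] unfolding add_divide_distrib by linarith
  then have "\<bar>f x\<bar> \<le> (1 + 1 / (r - l)) * (?J + ?I)" by (simp add: algebra_simps add_divide_distrib)
  then show ?thesis using i by (simp add: integral_add)
qed

lemma integral_continuous_on_param':
  fixes f :: "real \<Rightarrow> real \<Rightarrow> real"
  assumes "continuous_on (U \<times> {a..b}) (\<lambda>x. f (fst x) (snd x))"
  shows "continuous_on U (\<lambda>x. integral {a..b} (f x))"
  using integral_continuous_on_param[of U a b f] assms by (simp add: split_beta)

text \<open>The derivatives of order at most one in each variable, written as they arise when the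
  one-dimensional inequality is applied in the variables 1, 2 and 3 in turn: the last entry acts
  first.\<close>

definition corner_derivs :: "3 list set" where
  "corner_derivs = {[], [1], [2], [2,1], [3], [3,1], [3,2], [3,2,1]}"

abbreviation axes :: "'n list \<Rightarrow> (real^'n::finite) list" where "axes \<equiv> map (\<lambda>i. axis i 1)"

text \<open>Using the one-dimensional inequality in each of the three variables doubles the set of
  derivatives three times. Only \<open>L^1\<close> norms of at most three derivatives enter, and
  these the energy can supply.\<close>

lemma sobolev_cube:
  fixes f :: "real^3 \<Rightarrow> real"
  assumes lt: "\<And>i. p $ i < q $ i" and f: "smooth_on f S" and S: "cbox p q \<subseteq> S" and x: "x \<in> cbox p q"
  shows "\<bar>f x\<bar> \<le> (1 + 1 / (q$1 - p$1)) * ((1 + 1 / (q$2 - p$2)) * (1 + 1 / (q$3 - p$3))) *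
    (\<Sum>ws\<in>corner_derivs. cint p q (\<lambda>y. \<bar>dir_derivs (axes ws) f y\<bar>))"
proof -
  let ?D = "\<lambda>ws. dir_derivs (axes ws) f"
  let ?c = "\<lambda>i::3. 1 + 1 / (q $ i - p $ i)"
  have c0: "0 \<le> ?c i" for i using lt[of i] by simp
  have D: "?D ws differentiable (at y)" if "y \<in> cbox p q" for ws y
    using f S that unfolding smooth_on_def by blast
  have DC: "continuous_on (cbox p q) (?D ws)" for ws
    using D by (meson continuous_at_imp_continuous_on differentiable_imp_continuous_within)
  have cont [continuous_intros]: "continuous_on T (\<lambda>u. ?D ws (vec3 (g u, h u, k u)))"
    if "continuous_on T g" "continuous_on T h" "continuous_on T k"
      "\<And>u. u \<in> T \<Longrightarrow> vec3 (g u, h u, k u) \<in> cbox p q" for T :: "'z::topological_space set" and g h k ws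
    by (rule continuous_on_compose2[OF DC]) (use that in \<open>auto intro!: continuous_intros\<close>)
  have cont' [continuous_intros]: "continuous_on T (\<lambda>u. ddir (axis i 1) (?D ws) (vec3 (g u, h u, k u)))"
    if "continuous_on T g" "continuous_on T h" "continuous_on T k"
      "\<And>u. u \<in> T \<Longrightarrow> vec3 (g u, h u, k u) \<in> cbox p q" for T :: "'z::topological_space set" and g h k ws i
    using cont[OF that, of "i # ws"] by simp
  have s1: "\<bar>?D ws (vec3 (x, y, z))\<bar> \<le> ?c 1 * integral {p$1..q$1} (\<lambda>x. \<bar>?D ws (vec3 (x, y, z))\<bar> + \<bar>?D (1 # ws) (vec3 (x, y, z))\<bar>)"
    if "vec3 (x, y, z) \<in> cbox p q" for ws x y z
    using that lt[of 1] by (intro interval_sup_bound)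
      (auto intro!: vec3_deriv D continuous_intros simp: mem_cbox_vec3)
  have s2: "\<bar>?D ws (vec3 (x, y, z))\<bar> \<le> ?c 2 * integral {p$2..q$2} (\<lambda>y. \<bar>?D ws (vec3 (x, y, z))\<bar> + \<bar>?D (2 # ws) (vec3 (x, y, z))\<bar>)"
    if "vec3 (x, y, z) \<in> cbox p q" for ws x y z
    using that lt[of 2] by (intro interval_sup_bound)
      (auto intro!: vec3_deriv D continuous_intros simp: mem_cbox_vec3)
  have s3: "\<bar>?D ws (vec3 (x, y, z))\<bar> \<le> ?c 3 * integral {p$3..q$3} (\<lambda>z. \<bar>?D ws (vec3 (x, y, z))\<bar> + \<bar>?D (3 # ws) (vec3 (x, y, z))\<bar>)"
    if "vec3 (x, y, z) \<in> cbox p q" for ws x y z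
    using that lt[of 3] by (intro interval_sup_bound)
      (auto intro!: vec3_deriv D continuous_intros simp: mem_cbox_vec3)
  define E where "E A v = (\<Sum>ws\<in>A. \<bar>?D ws v\<bar>)" for A v
  have E_cont [continuous_intros]: "continuous_on T (\<lambda>u. E A (vec3 (g u, h u, k u)))"
    if "continuous_on T g" "continuous_on T h" "continuous_on T k"
      "\<And>u. u \<in> T \<Longrightarrow> vec3 (g u, h u, k u) \<in> cbox p q" for T :: "'z::topological_space set" and g h k A
    unfolding E_def using that by (intro continuous_intros) auto
  have int_E: "(\<lambda>z. E A (vec3 (g z, h z, k z))) integrable_on {a..b}"
    if "continuous_on {a..b} g" "continuous_on {a..b} h" "continuous_on {a..b} k"
      "\<And>u. u \<in> {a..b} \<Longrightarrow> vec3 (g u, h u, k u) \<in> cbox p q" for a b :: real and g h k A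
    using that by (intro integrable_continuous_interval continuous_intros)
  note mem = mem_cbox_vec3
  \<comment> \<open>\<open>A\<close> and \<open>B\<close> are the derivatives present after one and
    two of the three applications.\<close>
  define A where "A = {[], [1::3]}"
  define B where "B = {[], [1::3], [2], [2,1]}"
  have e1: "E {[]} (vec3 (x, y, z)) \<le> ?c 1 * integral {p$1..q$1} (\<lambda>x. E A (vec3 (x, y, z)))"
    if "vec3 (x, y, z) \<in> cbox p q" for x y z
    using s1[OF that, of "[]"] unfolding E_def A_def by simp
  have e2: "E A (vec3 (x, y, z)) \<le> ?c 2 * integral {p$2..q$2} (\<lambda>y. E B (vec3 (x, y, z)))"
    if v: "vec3 (x, y, z) \<in> cbox p q" for x y z
  proof -
    have i: "(\<lambda>y. \<bar>?D ws (vec3 (x, y, z))\<bar> + \<bar>?D ws' (vec3 (x, y, z))\<bar>) integrable_on {p$2..q$2}" for ws ws'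
      using v by (intro integrable_continuous_interval continuous_intros) (auto simp: mem)
    have eq: "E B (vec3 (x, y, z)) = (\<bar>?D [] (vec3 (x, y, z))\<bar> + \<bar>?D [2] (vec3 (x, y, z))\<bar>)
      + (\<bar>?D [1] (vec3 (x, y, z))\<bar> + \<bar>?D [2,1] (vec3 (x, y, z))\<bar>)" for y
      unfolding E_def B_def by simp
    show ?thesis unfolding eq integral_add[OF i i]
      using s2[OF v, of "[]"] s2[OF v, of "[1]"] by (simp add: E_def A_def algebra_simps)
  qed
  have e3: "E B (vec3 (x, y, z)) \<le> ?c 3 * integral {p$3..q$3} (\<lambda>z. E corner_derivs (vec3 (x, y, z)))"
    if v: "vec3 (x, y, z) \<in> cbox p q" for x y z
  proof -
    have i: "(\<lambda>z. \<bar>?D ws (vec3 (x, y, z))\<bar> + \<bar>?D ws' (vec3 (x, y, z))\<bar>) integrable_on {p$3..q$3}" for ws ws'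
      using v by (intro integrable_continuous_interval continuous_intros) (auto simp: mem)
    have eq: "E corner_derivs (vec3 (x, y, z)) =
        ((\<bar>?D [] (vec3 (x, y, z))\<bar> + \<bar>?D [3] (vec3 (x, y, z))\<bar>)
      + (\<bar>?D [1] (vec3 (x, y, z))\<bar> + \<bar>?D [3,1] (vec3 (x, y, z))\<bar>))
      + ((\<bar>?D [2] (vec3 (x, y, z))\<bar> + \<bar>?D [3,2] (vec3 (x, y, z))\<bar>)
      + (\<bar>?D [2,1] (vec3 (x, y, z))\<bar> + \<bar>?D [3,2,1] (vec3 (x, y, z))\<bar>))" for z
      unfolding E_def corner_derivs_def by simp
    show ?thesis unfolding eq integral_add[OF integrable_add[OF i i] integrable_add[OF i i]] integral_add[OF i i]
      using s3[OF v, of "[]"] s3[OF v, of "[1]"] s3[OF v, of "[2]"] s3[OF v, of "[2,1]"]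
      by (simp add: E_def B_def algebra_simps)
  qed
  obtain a b c where xe: "x = vec3 (a, b, c)" using vec3_unvec3[of x] by metis
  have abc: "a \<in> {p$1..q$1}" "b \<in> {p$2..q$2}" "c \<in> {p$3..q$3}" using x unfolding xe mem by auto
  let ?N = corner_derivs
  have n3: "continuous_on {p$2..q$2} (\<lambda>y. integral {p$3..q$3} (\<lambda>z. E ?N (vec3 (x, y, z))))" if "x \<in> {p$1..q$1}" for x
    by (intro integral_continuous_on_param' continuous_intros) (use that in \<open>auto simp: mem\<close>)
  have "continuous_on ({p$1..q$1} \<times> {p$2..q$2}) (\<lambda>x. integral (cbox (p$3) (q$3)) (\<lambda>z. E ?N (vec3 (fst x, snd x, z))))"
    unfolding split_beta by (rule integral_continuous_on_param) (auto intro!: continuous_intros simp: mem split_beta)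
  then have n4: "continuous_on {p$1..q$1} (\<lambda>x. integral {p$2..q$2} (\<lambda>y. integral {p$3..q$3} (\<lambda>z. E ?N (vec3 (x, y, z)))))"
    by (intro integral_continuous_on_param') simp
  have b2: "E A (vec3 (x, b, c)) \<le> ?c 2 * (?c 3 * integral {p$2..q$2} (\<lambda>y. integral {p$3..q$3} (\<lambda>z. E ?N (vec3 (x, y, z)))))"
    if x: "x \<in> {p$1..q$1}" for x
  proof -
    have "integral {p$2..q$2} (\<lambda>y. E B (vec3 (x, y, c))) \<le>
        integral {p$2..q$2} (\<lambda>y. ?c 3 * integral {p$3..q$3} (\<lambda>z. E ?N (vec3 (x, y, z))))"
    proof (rule integral_le)
      show "(\<lambda>y. E B (vec3 (x, y, c))) integrable_on {p$2..q$2}"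
        using x abc by (intro int_E continuous_intros) (auto simp: mem)
      show "(\<lambda>y. ?c 3 * integral {p$3..q$3} (\<lambda>z. E ?N (vec3 (x, y, z)))) integrable_on {p$2..q$2}"
        using n3[OF x] by (intro integrable_continuous_interval continuous_intros)
    qed (use x abc in \<open>auto intro!: e3 simp: mem\<close>)
    then show ?thesis
      using order_trans[OF e2[of x b c] mult_left_mono[OF _ c0[of 2]]] x abc by (simp add: mem)
  qed
  have "integral {p$1..q$1} (\<lambda>x. E A (vec3 (x, b, c))) \<le>
        integral {p$1..q$1} (\<lambda>x. ?c 2 * (?c 3 * integral {p$2..q$2} (\<lambda>y. integral {p$3..q$3} (\<lambda>z. E ?N (vec3 (x, y, z))))))"
  proof (rule integral_le)
    show "(\<lambda>x. E A (vec3 (x, b, c))) integrable_on {p$1..q$1}"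
      using abc by (intro int_E continuous_intros) (auto simp: mem)
    show "(\<lambda>x. ?c 2 * (?c 3 * integral {p$2..q$2} (\<lambda>y. integral {p$3..q$3} (\<lambda>z. E ?N (vec3 (x, y, z)))))) integrable_on {p$1..q$1}"
      using n4 by (intro integrable_continuous_interval continuous_intros)
  qed (use b2 in auto)
  then have b1: "E {[]} x \<le> ?c 1 * (?c 2 * (?c 3 * integral {p$1..q$1} (\<lambda>x. integral {p$2..q$2} (\<lambda>y. integral {p$3..q$3} (\<lambda>z. E ?N (vec3 (x, y, z)))))))"
    using order_trans[OF e1[of a b c] mult_left_mono[OF _ c0[of 1]]] abc by (simp add: mem xe)
  have "continuous_on (cbox p q) (E ?N)" unfolding E_def by (intro continuous_intros DC)
  from cint_iterated[OF this] b1 have b: "E {[]} x \<le> ?c 1 * (?c 2 * (?c 3 * cint p q (E ?N)))" by simp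
  have sum: "cint p q (E ?N) = (\<Sum>ws\<in>?N. cint p q (\<lambda>y. \<bar>?D ws y\<bar>))"
    unfolding E_def by (intro cint_sum continuous_intros DC) (simp add: corner_derivs_def)
  have "E {[]} x = \<bar>f x\<bar>" by (simp add: E_def)
  with b show ?thesis unfolding sum mult.assoc by simp
qed

text \<open>The differential inequality says that \<open>E * exp (C * s)\<close> is nondecreasing.
  So \<open>E\<close> is bounded towards the past by its value at \<open>t0\<close>, uniformly in
  \<open>t\<close> once \<open>C * s\<close> is nonnegative.\<close>

lemma gronwall_backward:
  fixes E :: "real \<Rightarrow> real"
  assumes "\<And>t. 0 < t \<Longrightarrow> t \<le> t0 \<Longrightarrow> (E has_real_derivative E' t) (at t)"
    and "\<And>t. 0 < t \<Longrightarrow> t \<le> t0 \<Longrightarrow> (s has_real_derivative s' t) (at t)"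
    and ineq: "\<And>t. 0 < t \<Longrightarrow> t \<le> t0 \<Longrightarrow> - (C * s' t * E t) \<le> E' t"
    and "0 < t" "t \<le> t0"
  shows "E t * exp (C * s t) \<le> E t0 * exp (C * s t0)"
proof (rule DERIV_nonneg_imp_nondecreasing[OF \<open>t \<le> t0\<close>])
  fix x assume x: "t \<le> x" "x \<le> t0"
  have "((\<lambda>t. E t * exp (C * s t)) has_real_derivative (E' x + C * s' x * E x) * exp (C * s x)) (at x)"
    using DERIV_mult[OF assms(1)[of x] DERIV_fun_exp[OF DERIV_cmult[OF assms(2)[of x], of C]]] x assms(4)
    by (simp add: algebra_simps)
  moreover have "0 \<le> (E' x + C * s' x * E x) * exp (C * s x)"
    using ineq[of x] x assms(4) by simp
  ultimately show "\<exists>y. ((\<lambda>t. E t * exp (C * s t)) has_real_derivative y) (at x) \<and> 0 \<le> y" by blast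
qed

section \<open>The wave equation in a chart\<close>

lemma ddir_0 [simp]: "f differentiable (at x) \<Longrightarrow> ddir 0 f x = 0"
  using ddir_add_direction(2)[of f x 0 0] by simp

abbreviation "Dt \<equiv> ddir (1::real, 0::real^3)"
abbreviation "Dx i \<equiv> ddir (0::real, axis i 1 :: (real^3))"

lemma ddir_comp_fst:
  fixes c :: "real \<Rightarrow> 'b::real_normed_vector"
  assumes "c differentiable (at (fst p))"
  shows "ddir v (\<lambda>p. c (fst p)) p = ddir (fst v) c (fst p)"
  using ddir_affine(2)[OF bounded_linear_fst, of c 0 p v] assms by simp

lemma ddir_comp_snd:
  assumes "c differentiable (at (snd p))"
  shows "ddir v (\<lambda>p. c (snd p)) p = ddir (snd v) c (snd p)"
  using ddir_affine(2)[OF bounded_linear_snd, of c 0 p v] assms by simp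

lemma smooth_on_comp_fst:
  "open T \<Longrightarrow> smooth_on c T \<Longrightarrow> S \<subseteq> T \<times> UNIV \<Longrightarrow> smooth_on (\<lambda>p. c (fst p)) S"
  by (rule smooth_on_affine[OF bounded_linear_fst, of c T S 0, unfolded add_0]) auto

lemma smooth_on_comp_snd:
  "open U \<Longrightarrow> smooth_on c U \<Longrightarrow> S \<subseteq> UNIV \<times> U \<Longrightarrow> smooth_on (\<lambda>p. c (snd p)) S"
  by (rule smooth_on_affine[OF bounded_linear_snd, of c U S 0, unfolded add_0]) auto

lemma bounded_linear_Pair0: "bounded_linear (Pair 0)"
  using bounded_linear_Pair[OF bounded_linear_zero bounded_linear_ident] .

lemma dir_derivs_slice:
  fixes F :: "real \<times> 'e::euclidean_space \<Rightarrow> 'b::real_normed_vector"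
  assumes "open S" "smooth_on F S" "(t, y) \<in> S"
  shows "dir_derivs vs (\<lambda>y. F (t, y)) y = dir_derivs (map (Pair 0) vs) F (t, y)"
  using dir_derivs_affine[OF bounded_linear_Pair0 assms(2,1), of "(t, 0)" y vs] assms(3) by simp

lemma smooth_on_slice:
  fixes F :: "real \<times> 'e::euclidean_space \<Rightarrow> 'b::real_normed_vector"
  assumes "open S" "smooth_on F S" "\<And>y. y \<in> T \<Longrightarrow> (t, y) \<in> S"
  shows "smooth_on (\<lambda>y. F (t, y)) T"
  using smooth_on_affine[OF bounded_linear_Pair0 assms(2,1), of T "(t, 0)"] assms(3) by simp

lemma has_real_derivative_Dt:
  fixes F :: "real \<times> (real^3) \<Rightarrow> real"
  assumes "F differentiable (at (t, y))"
  shows "((\<lambda>t. F (t, y)) has_real_derivative Dt F (t, y)) (at t)"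
  using has_real_derivative_ddir[of F "(0, y)" t "(1, 0)"] assms by simp

text \<open>\<open>s\<close> stands in for the conformal time \<open>\<integral> 1 / a\<close>: it only has to grow at least as fast and to
  vanish at the singularity.\<close>

locale local_wave =
  fixes U :: "(real^3) set" and u :: "real \<times> (real^3) \<Rightarrow> real"
    and H :: "3 \<Rightarrow> 3 \<Rightarrow> real^3 \<Rightarrow> real" and b :: "3 \<Rightarrow> real^3 \<Rightarrow> real"
    and a a' s s' :: "real \<Rightarrow> real"
  assumes open_U: "open U"
    and smooth_u: "smooth_on u ({0<..} \<times> U)"
    and smooth_H: "smooth_on (H i j) U"
    and sym_H: "y \<in> U \<Longrightarrow> H i j y = H j i y"
    and pos_H: "y \<in> U \<Longrightarrow> z \<noteq> 0 \<Longrightarrow> 0 < (\<Sum>i\<in>UNIV. \<Sum>j\<in>UNIV. H i j y * z $ i * z $ j)"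
    and smooth_b: "smooth_on (b k) U"
    and a_pos: "0 < t \<Longrightarrow> 0 < a t"
    and smooth_a: "smooth_on a {0<..}"
    and a': "0 < t \<Longrightarrow> (a has_real_derivative a' t) (at t)" "0 < t \<Longrightarrow> 0 \<le> a' t"
    and wave: "0 < t \<Longrightarrow> y \<in> U \<Longrightarrow> Dt (Dt u) (t, y) =
      ((\<Sum>i\<in>UNIV. \<Sum>j\<in>UNIV. H i j y * Dx i (Dx j u) (t, y)) + (\<Sum>k\<in>UNIV. b k y * Dx k u (t, y))) / (a t)\<^sup>2
        - 3 * (a' t / a t) * Dt u (t, y)"
    and s': "0 < t \<Longrightarrow> (s has_real_derivative s' t) (at t)" "0 < t \<Longrightarrow> 1 / a t \<le> s' t" "continuous_on {0<..} s'"
    and s: "0 < t \<Longrightarrow> 0 < s t" "(s \<longlongrightarrow> 0) (at_right 0)"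
begin

section \<open>Spatial derivatives and the commuted equation\<close>

definition S :: "(real \<times> (real^3)) set" where "S = {0<..} \<times> U"

lemma open_S: "open S" unfolding S_def by (intro open_Times open_U open_greaterThan)

lemma smooth_fst: "smooth_on c {0<..} \<Longrightarrow> smooth_on (\<lambda>p. c (fst p)) S"
  by (rule smooth_on_comp_fst[of "{0<..}"]) (auto simp: S_def)

lemma smooth_snd: "smooth_on c U \<Longrightarrow> smooth_on (\<lambda>p. c (snd p)) S"
  by (rule smooth_on_comp_snd[OF open_U]) (auto simp: S_def)

lemma smooth_a_power: "smooth_on (\<lambda>p. a (fst p) ^ n) S"
  by (intro smooth_on_power open_S smooth_fst smooth_a)

lemma smooth_a_S: "smooth_on (\<lambda>p. a (fst p)) S"
  by (intro smooth_fst smooth_a)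

lemma ddir_fst_mult:
  fixes c :: "real \<Rightarrow> real" and F :: "real \<times> (real^3) \<Rightarrow> real"
  assumes "smooth_on c {0<..}" "smooth_on F S" "p \<in> S"
  shows "ddir (0, e) (\<lambda>p. c (fst p) * F p) p = c (fst p) * ddir (0, e) F p"
  using ddir_mult[OF open_S smooth_fst[OF assms(1)] assms(2,3), of "(0, e)"] smooth_onD[OF assms(1), of "fst p"] assms(3)
  by (simp add: ddir_comp_fst S_def mem_Times_iff)

lemma ddir_snd_mult:
  fixes c :: "real^3 \<Rightarrow> real" and F :: "real \<times> (real^3) \<Rightarrow> real"
  assumes "smooth_on c U" "smooth_on F S" "p \<in> S"
  shows "Dt (\<lambda>p. c (snd p) * F p) p = c (snd p) * Dt F p"
    and "ddir (0, e) (\<lambda>p. c (snd p) * F p) p = c (snd p) * ddir (0, e) F p + ddir e c (snd p) * F p"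
  using ddir_mult[OF open_S smooth_snd[OF assms(1)] assms(2,3)] smooth_onD[OF assms(1), of "snd p"] assms(3)
  by (simp_all add: ddir_comp_snd S_def mem_Times_iff)

lemma Dt_a_power: "p \<in> S \<Longrightarrow> Dt (\<lambda>p. a (fst p) ^ n) p = n * a (fst p) ^ (n - 1) * a' (fst p)"
proof -
  assume p: "p \<in> S"
  let ?t = "fst p"
  have t: "?t > 0" using p by (auto simp: S_def)
  have d: "((\<lambda>t. a t ^ n) has_real_derivative n * a ?t ^ (n - 1) * a' ?t) (at ?t)"
    using a'(1)[OF t] by (auto intro!: derivative_eq_intros)
  then have "(\<lambda>t. a t ^ n) differentiable (at ?t)"
    unfolding has_field_derivative_def differentiable_def by blast
  from ddir_comp_fst[OF this, of "(1, 0)"] ddir_eqI[OF d[unfolded has_field_derivative_def], of 1]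
  show ?thesis by simp
qed

text \<open>Indexing by coordinate numbers instead of vectors leaves only finitely many derivatives
  of each order, so that the energy can sum over all of them.\<close>

definition w :: "3 list \<Rightarrow> real \<times> (real^3) \<Rightarrow> real" where
  "w ws = dir_derivs (map (Pair 0) (axes ws)) u"

definition v :: "3 list \<Rightarrow> real \<times> (real^3) \<Rightarrow> real" where
  "v ws = (\<lambda>p. a (fst p) ^ 3 * Dt (w ws) p)"

lemma w_Nil: "w [] = u" and w_Cons: "w (i # ws) = Dx i (w ws)"
  by (simp_all add: w_def)

lemma smooth_w: "smooth_on (w ws) S"
  unfolding w_def S_def by (rule smooth_on_dir_derivs[OF smooth_u])

lemma smooth_v: "smooth_on (v ws) S"
  unfolding v_def by (intro smooth_on_mult open_S smooth_a_power smooth_on_ddir smooth_w)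

lemma Dx_v: "p \<in> S \<Longrightarrow> Dx i (v ws) p = v (i # ws) p"
  unfolding v_def w_Cons
  using ddir_fst_mult[OF smooth_on_power[OF open_greaterThan smooth_a] smooth_on_ddir[OF smooth_w]]
    ddir_commute[OF open_S smooth_w] by simp

text \<open>Spatial differential operators of order at most \<open>n\<close> applied to \<open>u\<close>.\<close>

inductive lin :: "nat \<Rightarrow> (real \<times> (real^3) \<Rightarrow> real) \<Rightarrow> bool" where
  base: "length ws \<le> n \<Longrightarrow> lin n (w ws)"
| mult: "smooth_on c U \<Longrightarrow> lin n F \<Longrightarrow> lin n (\<lambda>p. c (snd p) * F p)"
| add: "lin n F \<Longrightarrow> lin n G \<Longrightarrow> lin n (\<lambda>p. F p + G p)"
| eq_on: "lin n F \<Longrightarrow> (\<And>p. p \<in> S \<Longrightarrow> F p = G p) \<Longrightarrow> lin n G"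

lemma lin_mono: "lin n F \<Longrightarrow> n \<le> m \<Longrightarrow> lin m F"
  by (induction rule: lin.induct) (auto intro: lin.intros)

lemma lin_smooth: "lin n F \<Longrightarrow> smooth_on F S"
proof (induction rule: lin.induct)
  case (eq_on n F G)
  then show ?case using smooth_on_cong[OF open_S, of F G] by blast
qed (auto intro: smooth_w smooth_on_mult smooth_on_add smooth_snd open_S)

lemma lin_zero: "lin n (\<lambda>p. 0)"
  using lin.mult[OF smooth_on_const[OF open_U, of 0] lin.base[of "[]" n]] by simp

lemma lin_sum: "finite I \<Longrightarrow> (\<And>i. i \<in> I \<Longrightarrow> lin n (F i)) \<Longrightarrow> lin n (\<lambda>p. \<Sum>i\<in>I. F i p)"
  by (induction I rule: finite_induct) (auto intro: lin.add lin_zero)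

text \<open>Derivatives of coefficients are again coefficients, and a direction applied to
  \<open>w ws\<close> is expanded in the coordinate axes, so any spatial direction raises the order
  by one.\<close>

lemma lin_ddir: "lin n F \<Longrightarrow> lin (Suc n) (ddir (0, e) F)"
proof (induction rule: lin.induct)
  case (base ws n)
  have "lin (Suc n) (\<lambda>p. \<Sum>i\<in>UNIV. (\<lambda>_. e $ i) (snd p) * w (i # ws) p)"
    using base by (intro lin_sum lin.mult lin.base smooth_on_const open_U) auto
  then show ?case
  proof (rule lin.eq_on)
    fix p assume "p \<in> S"
    have e: "(\<Sum>i\<in>UNIV. e $ i *\<^sub>R (0, axis i 1)) = (0::real, e)"
      by (simp add: prod_eq_iff fst_sum snd_sum basis_expansion[of e, unfolded scalar_mult_eq_scaleR])
    show "(\<Sum>i\<in>UNIV. e $ i * w (i # ws) p) = ddir (0, e) (w ws) p"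
      using ddir_sum_direction[OF smooth_onD[OF smooth_w \<open>p \<in> S\<close>], of "\<lambda>i. e $ i" "\<lambda>i. (0, axis i 1)" UNIV ws]
      unfolding e w_Cons by simp
  qed
next
  case (mult c n F)
  have "smooth_on (ddir e c) U" by (rule smooth_on_ddir[OF mult(1)])
  then have "lin (Suc n) (\<lambda>p. c (snd p) * ddir (0, e) F p + ddir e c (snd p) * F p)"
    using mult lin_mono[of n F "Suc n"] by (intro lin.add lin.mult) auto
  then show ?case
    by (rule lin.eq_on) (simp add: ddir_snd_mult(2)[OF mult(1) lin_smooth[OF mult(2)]])
next
  case (add n F G)
  then have "lin (Suc n) (\<lambda>p. ddir (0, e) F p + ddir (0, e) G p)" by (intro lin.add)
  then show ?case
    by (rule lin.eq_on) (simp add: ddir_add[OF open_S lin_smooth[OF add(1)] lin_smooth[OF add(2)]])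
next
  case (eq_on n F G)
  show ?case by (rule lin.eq_on[OF eq_on(3)]) (rule ddir_cong[OF open_S _ eq_on(2)])
qed

lemma finite_lists_le: "finite {ws :: 3 list. length ws \<le> n}"
  using finite_lists_length_le[of "UNIV :: 3 set" n] by simp

text \<open>The coefficients do not depend on \<open>t\<close>, so their bounds on the compact set
  hold at all times, however close to the singularity.\<close>

lemma lin_bound:
  assumes "lin n F" "compact K" "K \<subseteq> U"
  shows "\<exists>C\<ge>0. \<forall>t>0. \<forall>y\<in>K. \<bar>F (t, y)\<bar> \<le> C * (\<Sum>ws | length ws \<le> n. \<bar>w ws (t, y)\<bar>)"
  using assms(1)
proof (induction rule: lin.induct)
  case (base ws n)
  then show ?case
    by (intro exI[of _ 1]) (auto intro!: member_le_sum[of ws] finite_lists_le)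
next
  case (mult c n F)
  then obtain C where C: "C \<ge> 0" "\<And>t y. t > 0 \<Longrightarrow> y \<in> K \<Longrightarrow> \<bar>F (t, y)\<bar> \<le> C * (\<Sum>ws | length ws \<le> n. \<bar>w ws (t, y)\<bar>)"
    by blast
  obtain B where B: "\<And>y. y \<in> K \<Longrightarrow> \<bar>c y\<bar> \<le> B"
    using smooth_on_bounded[OF mult(1) assms(2,3)] by blast
  show ?case
  proof (intro exI[of _ "\<bar>B\<bar> * C"] conjI allI impI ballI)
    fix t y assume ty: "(t::real) > 0" "y \<in> K"
    have "\<bar>c y\<bar> * \<bar>F (t, y)\<bar> \<le> \<bar>B\<bar> * (C * (\<Sum>ws | length ws \<le> n. \<bar>w ws (t, y)\<bar>))"
      using B[OF ty(2)] C(2)[OF ty] by (intro mult_mono) auto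
    then show "\<bar>c (snd (t, y)) * F (t, y)\<bar> \<le> \<bar>B\<bar> * C * (\<Sum>ws | length ws \<le> n. \<bar>w ws (t, y)\<bar>)"
      by (simp add: abs_mult mult.assoc)
  qed (use C in auto)
next
  case (add n F G)
  then obtain C D where CD: "C \<ge> 0" "D \<ge> 0"
    "\<And>t y. t > 0 \<Longrightarrow> y \<in> K \<Longrightarrow> \<bar>F (t, y)\<bar> \<le> C * (\<Sum>ws | length ws \<le> n. \<bar>w ws (t, y)\<bar>)"
    "\<And>t y. t > 0 \<Longrightarrow> y \<in> K \<Longrightarrow> \<bar>G (t, y)\<bar> \<le> D * (\<Sum>ws | length ws \<le> n. \<bar>w ws (t, y)\<bar>)"
    by metis
  show ?case
  proof (intro exI[of _ "C + D"] conjI allI impI ballI)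
    fix t y assume ty: "(t::real) > 0" "y \<in> K"
    show "\<bar>F (t, y) + G (t, y)\<bar> \<le> (C + D) * (\<Sum>ws | length ws \<le> n. \<bar>w ws (t, y)\<bar>)"
      using CD(3)[OF ty] CD(4)[OF ty] by (simp add: distrib_right)
  qed (use CD in auto)
next
  case (eq_on n F G)
  then have "\<And>t y. t > 0 \<Longrightarrow> y \<in> K \<Longrightarrow> F (t, y) = G (t, y)" using assms(3) by (auto simp: S_def)
  then show ?case using eq_on by simp
qed

definition principal :: "(real \<times> (real^3) \<Rightarrow> real) \<Rightarrow> real \<times> (real^3) \<Rightarrow> real" where
  "principal F p = (\<Sum>i\<in>UNIV. \<Sum>j\<in>UNIV. H i j (snd p) * Dx i (Dx j F) p)"

text \<open>\<open>a^3\<close> is the integrating factor of the friction term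
  \<open>3 * a' / a\<close>.\<close>

lemma wave_v:
  assumes "p \<in> S"
  shows "Dt (v []) p = a (fst p) * (principal u p + (\<Sum>k\<in>UNIV. b k (snd p) * Dx k u p))"
proof -
  obtain t y where p: "p = (t, y)" "t > 0" "y \<in> U" using assms by (auto simp: S_def)
  have "Dt (v []) p = a t ^ 3 * Dt (Dt u) p + 3 * a t ^ 2 * a' t * Dt u p"
    unfolding v_def w_Nil
    using ddir_mult[OF open_S smooth_a_power[of 3] smooth_on_ddir[OF smooth_u[folded S_def]] assms, of "(1,0)" "(1,0)"]
      Dt_a_power[OF assms, of 3] p by simp
  also have "\<dots> = a t * (principal u p + (\<Sum>k\<in>UNIV. b k (snd p) * Dx k u p))"
    unfolding p(1) wave[OF p(2,3)] principal_def
    using a_pos[OF p(2)] by (simp add: field_simps power2_eq_square power3_eq_cube)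
  finally show ?thesis unfolding p by simp
qed

lemma lin_principal: "lin (length ws + 2) (principal (w ws))"
proof -
  have "lin (length ws + 2) (\<lambda>p. \<Sum>i\<in>UNIV. \<Sum>j\<in>UNIV. H i j (snd p) * w (i # j # ws) p)"
    by (intro lin_sum lin.mult smooth_H lin.base) auto
  then show ?thesis by (simp add: w_Cons principal_def[abs_def])
qed

text \<open>Commuting with a coordinate derivative moves one derivative onto a coefficient of the
  principal part and leaves two on the unknown. The remainder is therefore of order one above
  \<open>ws\<close> and not two, which the gradient terms of the energy can bound.\<close>

lemma commuted_wave:
  "\<exists>R. lin (Suc (length ws)) R \<and> (\<forall>p\<in>S. Dt (v ws) p = a (fst p) * (principal (w ws) p + R p))"
proof (induction ws)
  case Nil
  have "lin (Suc 0) (\<lambda>p. \<Sum>k\<in>UNIV. b k (snd p) * w [k] p)"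
    by (intro lin_sum lin.mult smooth_b lin.base) auto
  then show ?case using wave_v unfolding w_Cons w_Nil by auto
next
  case (Cons k ws)
  then obtain R where R: "lin (Suc (length ws)) R"
    "\<And>p. p \<in> S \<Longrightarrow> Dt (v ws) p = a (fst p) * (principal (w ws) p + R p)" by blast
  define R' where "R' p = (\<Sum>i\<in>UNIV. \<Sum>j\<in>UNIV. ddir (axis k 1) (H i j) (snd p) * w (i # j # ws) p) + Dx k R p" for p
  have "lin (Suc (length (k # ws))) R'"
    unfolding R'_def[abs_def]
    using lin_ddir[OF R(1)] by (intro lin.add lin_sum lin.mult smooth_on_ddir smooth_H lin.base) auto
  moreover have "Dt (v (k # ws)) p = a (fst p) * (principal (w (k # ws)) p + R' p)" if p: "p \<in> S" for p
  proof -
    have sP: "smooth_on (\<lambda>p. H i j (snd p) * Dx i (Dx j (w ws)) p) S" for i j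
      by (intro smooth_on_mult open_S smooth_snd smooth_H smooth_on_ddir smooth_w)
    have smP: "smooth_on (principal (w ws)) S"
      unfolding principal_def[abs_def] by (intro smooth_on_sum open_S sP)
    have DP: "Dx k (principal (w ws)) p = principal (w (k # ws)) p
        + (\<Sum>i\<in>UNIV. \<Sum>j\<in>UNIV. ddir (axis k 1) (H i j) (snd p) * w (i # j # ws) p)"
    proof -
      have com: "Dx k (Dx i (Dx j (w ws))) p = Dx i (Dx j (Dx k (w ws))) p" for i j
        by (rule trans[OF ddir_commute[OF open_S smooth_on_ddir[OF smooth_w] p]
              ddir_cong[OF open_S p ddir_commute[OF open_S smooth_w]]])
      have "Dx k (principal (w ws)) p = (\<Sum>i\<in>UNIV. \<Sum>j\<in>UNIV. Dx k (\<lambda>p. H i j (snd p) * Dx i (Dx j (w ws)) p) p)"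
        unfolding principal_def[abs_def]
        by (simp add: ddir_sum[OF _ p] smooth_on_sum[OF open_S] sP)
      also have "\<dots> = (\<Sum>i\<in>UNIV. \<Sum>j\<in>UNIV. H i j (snd p) * Dx i (Dx j (Dx k (w ws))) p
          + ddir (axis k 1) (H i j) (snd p) * Dx i (Dx j (w ws)) p)"
        by (simp add: ddir_snd_mult(2)[OF smooth_H smooth_on_ddir[OF smooth_on_ddir[OF smooth_w]] p] com)
      finally show ?thesis by (simp add: principal_def w_Cons sum.distrib)
    qed
    have "Dt (v (k # ws)) p = Dt (Dx k (v ws)) p"
      by (rule ddir_cong[OF open_S p]) (simp add: Dx_v)
    also have "\<dots> = Dx k (Dt (v ws)) p" by (rule ddir_commute[OF open_S smooth_v p])
    also have "\<dots> = Dx k (\<lambda>p. a (fst p) * (principal (w ws) p + R p)) p"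
      by (rule ddir_cong[OF open_S p R(2)])
    also have "\<dots> = a (fst p) * Dx k (\<lambda>p. principal (w ws) p + R p) p"
      by (intro ddir_fst_mult smooth_a smooth_on_add open_S smP lin_smooth[OF R(1)] p)
    also have "Dx k (\<lambda>p. principal (w ws) p + R p) p = Dx k (principal (w ws)) p + Dx k R p"
      by (rule ddir_add[OF open_S smP lin_smooth[OF R(1)] p])
    finally show ?thesis unfolding DP R'_def by (simp add: algebra_simps)
  qed
  ultimately show ?case by blast
qed

text \<open>Used for the limits, when all spatial derivatives of \<open>u\<close> are already
  bounded: an operator of order two above is then admissible, and the principal part is not kept
  apart. The directions are arbitrary as in the definition of \<open>C^k\<close>
  convergence.\<close>

lemma commuted_wave_directions:
  "\<exists>F. lin (length es + 2) F \<and> (\<forall>p\<in>S. Dt (dir_derivs (map (Pair 0) es) (v [])) p = a (fst p) * F p)"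
proof (induction es)
  case Nil
  obtain R where R: "lin 1 R" "\<And>p. p \<in> S \<Longrightarrow> Dt (v []) p = a (fst p) * (principal (w []) p + R p)"
    using commuted_wave[of "[]"] by auto
  have "lin 2 (\<lambda>p. principal (w []) p + R p)"
    using lin_principal[of "[]"] lin_mono[OF R(1), of 2] by (intro lin.add) (auto simp: numeral_2_eq_2)
  then show ?case using R(2)
    by (intro exI[of _ "\<lambda>p. principal (w []) p + R p"]) (simp add: numeral_2_eq_2)
next
  case (Cons e es)
  then obtain F where F: "lin (length es + 2) F"
    "\<And>p. p \<in> S \<Longrightarrow> Dt (dir_derivs (map (Pair 0) es) (v [])) p = a (fst p) * F p" by blast
  have "Dt (dir_derivs (map (Pair 0) (e # es)) (v [])) p = a (fst p) * ddir (0, e) F p" if p: "p \<in> S" for p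
  proof -
    have "Dt (dir_derivs (map (Pair 0) (e # es)) (v [])) p = ddir (0, e) (Dt (dir_derivs (map (Pair 0) es) (v []))) p"
      using ddir_commute[OF open_S smooth_on_dir_derivs[OF smooth_v] p] by simp
    also have "\<dots> = ddir (0, e) (\<lambda>p. a (fst p) * F p) p"
      by (rule ddir_cong[OF open_S p F(2)])
    also have "\<dots> = a (fst p) * ddir (0, e) F p"
      by (rule ddir_fst_mult[OF smooth_a lin_smooth[OF F(1)] p])
    finally show ?thesis .
  qed
  then show ?case using lin_ddir[OF F(1), of e] by auto
qed

lemma dir_derivs_v:
  "p \<in> S \<Longrightarrow> dir_derivs (map (Pair 0) es) (v []) p = a (fst p) ^ 3 * Dt (dir_derivs (map (Pair 0) es) u) p"
proof (induction es arbitrary: p)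
  case (Cons e es)
  let ?D = "dir_derivs (map (Pair 0) es)"
  have su: "smooth_on (?D u) S" using smooth_on_dir_derivs smooth_u S_def by metis
  have "dir_derivs (map (Pair 0) (e # es)) (v []) p = ddir (0, e) (\<lambda>p. a (fst p) ^ 3 * Dt (?D u) p) p"
    using ddir_cong[OF open_S Cons(2) Cons(1)] by simp
  also have "\<dots> = a (fst p) ^ 3 * ddir (0, e) (Dt (?D u)) p"
    by (rule ddir_fst_mult[OF smooth_on_power[OF open_greaterThan smooth_a] smooth_on_ddir[OF su] Cons(2)])
  also have "ddir (0, e) (Dt (?D u)) p = Dt (ddir (0, e) (?D u)) p"
    by (rule ddir_commute[OF open_S su Cons(2)])
  finally show ?case by simp
qed (simp add: v_def w_Nil)

end

section \<open>Energy estimate\<close>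

text \<open>The profile of the cutoff. It is continuously differentiable, enough for one integration
  by parts, and its derivative is a multiple of the positive part, which makes the effects of moving
  and of differentiating the cutoff comparable.\<close>

lemma pos_part_square_deriv:
  "((\<lambda>x::real. (max 0 x)\<^sup>2) has_real_derivative 2 * max 0 x) (at x)"
proof -
  consider "x > 0" | "x < 0" | "x = 0" by linarith
  then show ?thesis
  proof cases
    case 1
    have "((\<lambda>x. x\<^sup>2) has_real_derivative 2 * max 0 x) (at x)"
      using 1 by (auto intro!: derivative_eq_intros)
    then show ?thesis
      by (rule has_field_derivative_transform_within_open[of _ _ _ "{0<..}"]) (use 1 in auto)
  next
    case 2
    have "((\<lambda>x. 0) has_real_derivative 2 * max 0 x) (at x)" using 2 by (auto intro!: derivative_eq_intros)
    then show ?thesis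
      by (rule has_field_derivative_transform_within_open[of _ _ _ "{..<0}"]) (use 2 in auto)
  next
    case 3
    have "((\<lambda>h::real. max 0 h) \<longlongrightarrow> max 0 0) (at 0)" by (intro tendsto_intros)
    then have "((\<lambda>h::real. (max 0 h)\<^sup>2 / h) \<longlongrightarrow> 0) (at 0)"
      by (rule filterlim_cong[THEN iffD1, rotated 3, simplified])
        (auto simp: eventually_at_filter max_def power2_eq_square)
    then show ?thesis using 3 by (simp add: DERIV_def)
  qed
qed

lemma finite_uniform_bound:
  fixes f :: "'i::finite \<Rightarrow> 'y \<Rightarrow> real"
  assumes "\<And>i. \<exists>B. \<forall>y\<in>K. \<bar>f i y\<bar> \<le> B"
  shows "\<exists>B. \<forall>y\<in>K. \<forall>i. \<bar>f i y\<bar> \<le> B"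
proof -
  obtain B where B: "\<And>i y. y \<in> K \<Longrightarrow> \<bar>f i y\<bar> \<le> B i" using assms by metis
  have "B i \<le> (\<Sum>i\<in>UNIV. \<bar>B i\<bar>)" for i
    using member_le_sum[of i UNIV "\<lambda>i. \<bar>B i\<bar>"] by auto
  then show ?thesis using B order_trans by blast
qed

lemma norm_power2_vec: "(norm (z :: real^'n))\<^sup>2 = (\<Sum>i\<in>UNIV. (z $ i)\<^sup>2)"
  unfolding power2_norm_eq_inner inner_vec_def by (simp add: power2_eq_square)

section \<open>Energy density, flux and ellipticity\<close>

context local_wave
begin

text \<open>On the compact product of \<open>Q\<close> with the unit sphere the quadratic form
  attains a positive minimum; homogeneity extends the bound to all vectors.\<close>

lemma H_bounds:
  assumes "compact Q" "Q \<subseteq> U" "Q \<noteq> {}"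
  obtains c h where "0 < c" "c \<le> 1" "0 < h"
    "\<And>y z. y \<in> Q \<Longrightarrow> c * (\<Sum>i\<in>UNIV. (z $ i)\<^sup>2) \<le> (\<Sum>i\<in>UNIV. \<Sum>j\<in>UNIV. H i j y * z $ i * z $ j)"
    "\<And>y i j. y \<in> Q \<Longrightarrow> \<bar>H i j y\<bar> \<le> h"
    "\<And>y i j k. y \<in> Q \<Longrightarrow> \<bar>ddir (axis k 1) (H i j) y\<bar> \<le> h"
proof -
  let ?f = "\<lambda>w. \<Sum>i\<in>UNIV. \<Sum>j\<in>UNIV. H i j (fst w) * snd w $ i * snd w $ j"
  have cH: "continuous_on (Q \<times> sphere 0 1) (\<lambda>w. H i j (fst w))" for i j
    by (rule continuous_on_compose2[OF smooth_on_continuous[OF smooth_H]])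
      (use assms in \<open>auto intro!: continuous_intros\<close>)
  have "compact (Q \<times> sphere (0::real^3) 1)" by (intro compact_Times assms compact_sphere)
  moreover have "Q \<times> sphere (0::real^3) 1 \<noteq> {}" using assms(3) by simp
  moreover have "continuous_on (Q \<times> sphere 0 1) ?f"
    by (intro continuous_intros cH)
  ultimately obtain w0 where w0: "w0 \<in> Q \<times> sphere 0 1" "\<And>w. w \<in> Q \<times> sphere 0 1 \<Longrightarrow> ?f w0 \<le> ?f w"
    using continuous_attains_inf[of "Q \<times> sphere 0 1" ?f] by blast
  have "snd w0 \<noteq> 0" "fst w0 \<in> U" using w0(1) assms(2) by auto
  then have f0: "?f w0 > 0" using pos_H by blast
  \<comment> \<open>The cap at 1 lets \<open>c\<close> serve also as a lower bound for the
    coefficients of \<open>v^2\<close> and \<open>w^2\<close> in the energy density.\<close>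
  define c where "c = min 1 (?f w0)"
  have c: "0 < c" "c \<le> 1" "c \<le> ?f w0" unfolding c_def using f0 by auto
  have low: "c * (\<Sum>i\<in>UNIV. (z $ i)\<^sup>2) \<le> (\<Sum>i\<in>UNIV. \<Sum>j\<in>UNIV. H i j y * z $ i * z $ j)" if "y \<in> Q" for y z
  proof (cases "z = 0")
    case False
    let ?z = "(1 / norm z) *\<^sub>R z"
    have "c \<le> ?f (y, ?z)" using c(3) w0(2)[of "(y, ?z)"] that False by simp
    then have "c * (norm z)\<^sup>2 \<le> ?f (y, ?z) * (norm z)\<^sup>2" by (intro mult_right_mono) auto
    also have "\<dots> = (\<Sum>i\<in>UNIV. \<Sum>j\<in>UNIV. H i j y * z $ i * z $ j)"
      using False by (simp add: sum_distrib_right power2_eq_square)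
    finally show ?thesis by (simp add: norm_power2_vec)
  qed simp
  have "\<exists>B. \<forall>y\<in>Q. \<bar>H i j y\<bar> \<le> B" for i j by (rule smooth_on_bounded[OF smooth_H assms(1,2)])
  then have "\<exists>B. \<forall>y\<in>Q. \<forall>ij. \<bar>H (fst ij) (snd ij) y\<bar> \<le> B" by (intro finite_uniform_bound)
  then obtain B where B: "\<And>y i j. y \<in> Q \<Longrightarrow> \<bar>H i j y\<bar> \<le> B" by auto
  have "\<exists>B. \<forall>y\<in>Q. \<bar>ddir (axis k 1) (H i j) y\<bar> \<le> B" for i j k
    by (rule smooth_on_bounded[OF smooth_on_ddir[OF smooth_H] assms(1,2)])
  then have "\<exists>B. \<forall>y\<in>Q. \<forall>ijk. \<bar>ddir (axis (snd (snd ijk)) 1) (H (fst ijk) (fst (snd ijk))) y\<bar> \<le> B"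
    by (intro finite_uniform_bound)
  then obtain B' where B': "\<And>y i j k. y \<in> Q \<Longrightarrow> \<bar>ddir (axis k 1) (H i j) y\<bar> \<le> B'" by fastforce
  \<comment> \<open>The entry 1 makes \<open>h\<close> positive.\<close>
  let ?h = "max 1 (max B B')"
  have "\<bar>H i j y\<bar> \<le> ?h" "\<bar>ddir (axis k 1) (H i j) y\<bar> \<le> ?h" if "y \<in> Q" for y i j k
    using B[OF that, of i j] B'[OF that, of k i j] by (simp_all add: le_max_iff_disj)
  then show ?thesis using that[of c ?h] c low by auto
qed

text \<open>Twice the energy density of the Euclidean metric: the form in which error terms are
  estimated. On a compact set it is controlled by \<open>dens\<close>, the density adapted to
  \<open>H\<close>.\<close>

definition m :: "3 list \<Rightarrow> real \<times> (real^3) \<Rightarrow> real" where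
  "m ws p = (v ws p)\<^sup>2 + a (fst p) ^ 4 * ((\<Sum>j\<in>UNIV. (Dx j (w ws) p)\<^sup>2) + (w ws p)\<^sup>2)"

definition quad :: "3 list \<Rightarrow> real \<times> (real^3) \<Rightarrow> real" where
  "quad ws p = (\<Sum>i\<in>UNIV. \<Sum>j\<in>UNIV. H i j (snd p) * Dx i (w ws) p * Dx j (w ws) p)"

definition dens :: "3 list \<Rightarrow> real \<times> (real^3) \<Rightarrow> real" where
  "dens ws p = 1/2 * ((v ws p)\<^sup>2 + a (fst p) ^ 4 * (quad ws p + (w ws p)\<^sup>2))"

text \<open>Its divergence carries the second order terms of the time derivative of
  \<open>dens\<close>. Integration is with respect to the coordinate volume; the derivatives of
  \<open>H\<close> left over by this choice are of lower order.\<close>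

definition flux :: "3 list \<Rightarrow> 3 \<Rightarrow> real \<times> (real^3) \<Rightarrow> real" where
  "flux ws j p = a (fst p) * ((\<Sum>i\<in>UNIV. H i j (snd p) * Dx i (w ws) p) * v ws p)"

lemma smooth_HDw: "smooth_on (\<lambda>p. H i j (snd p) * Dx k (w ws) p) S"
  by (intro smooth_on_mult open_S smooth_snd smooth_H smooth_on_ddir smooth_w)

lemma smooth_quad: "smooth_on (quad ws) S"
  unfolding quad_def[abs_def]
  by (intro smooth_on_sum smooth_on_mult smooth_HDw open_S smooth_on_ddir smooth_w smooth_snd smooth_H)

lemma smooth_dens: "smooth_on (dens ws) S"
  unfolding dens_def[abs_def]
  by (intro smooth_on_mult smooth_on_add smooth_on_power smooth_on_const smooth_a_power
      smooth_quad smooth_w smooth_v open_S)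

lemma smooth_flux: "smooth_on (flux ws j) S"
  unfolding flux_def[abs_def]
  by (intro smooth_on_mult smooth_on_sum smooth_HDw smooth_v smooth_a_S open_S smooth_snd smooth_H smooth_on_ddir smooth_w)

lemma Dx_flux:
  assumes p: "p \<in> S"
  shows "Dx j (flux ws j) p = a (fst p) *
    ((\<Sum>i\<in>UNIV. H i j (snd p) * Dx i (w ws) p) * v (j # ws) p
     + (\<Sum>i\<in>UNIV. H i j (snd p) * Dx i (Dx j (w ws)) p + ddir (axis j 1) (H i j) (snd p) * Dx i (w ws) p) * v ws p)"
proof -
  have s: "smooth_on (\<lambda>p. \<Sum>i\<in>UNIV. H i j (snd p) * Dx i (w ws) p) S"
    by (intro smooth_on_sum smooth_HDw open_S)
  have "Dx j (\<lambda>p. \<Sum>i\<in>UNIV. H i j (snd p) * Dx i (w ws) p) p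
      = (\<Sum>i\<in>UNIV. H i j (snd p) * Dx i (Dx j (w ws)) p + ddir (axis j 1) (H i j) (snd p) * Dx i (w ws) p)"
    by (simp add: ddir_sum[OF smooth_HDw p] ddir_snd_mult(2)[OF smooth_H smooth_on_ddir[OF smooth_w] p]
        ddir_commute[OF open_S smooth_w p])
  then show ?thesis
    unfolding flux_def[abs_def]
    using ddir_fst_mult[OF smooth_a smooth_on_mult[OF open_S s smooth_v] p] ddir_mult[OF open_S s smooth_v p]
    by (simp add: Dx_v[OF p])
qed

text \<open>Since \<open>a^4 * Dt w = a * v\<close>, the terms with two derivatives combine to a
  divergence; the symmetry of \<open>H\<close> enters when the quadratic form is differentiated. The
  last line comes from the weight \<open>a^4\<close> and is nonnegative in an expanding universe, so
  it helps towards the past.\<close>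

lemma Dt_dens:
  assumes p: "p \<in> S" and R: "Dt (v ws) p = a (fst p) * (principal (w ws) p + R)"
  shows "Dt (dens ws) p = (\<Sum>j\<in>UNIV. Dx j (flux ws j) p)
    + a (fst p) * (v ws p * R - (\<Sum>j\<in>UNIV. \<Sum>i\<in>UNIV. ddir (axis j 1) (H i j) (snd p) * Dx i (w ws) p) * v ws p + w ws p * v ws p)
    + 2 * a (fst p) ^ 3 * a' (fst p) * (quad ws p + (w ws p)\<^sup>2)"
proof -
  obtain t y where ty: "p = (t, y)" "t > 0" "y \<in> U" using p by (auto simp: S_def)
  let ?w = "\<lambda>i. Dx i (w ws) p" and ?V = "\<lambda>i. v (i # ws) p"
  have D: "((\<lambda>t. F (t, y)) has_real_derivative Dt F p) (at t)" if "smooth_on F S" for F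
    using has_real_derivative_Dt[OF smooth_onD[OF that]] p ty by simp
  have Dv: "((\<lambda>t. v ws (t, y)) has_real_derivative Dt (v ws) p) (at t)" by (rule D[OF smooth_v])
  have Dw: "((\<lambda>t. w ws (t, y)) has_real_derivative Dt (w ws) p) (at t)" by (rule D[OF smooth_w])
  have DDw: "((\<lambda>t. Dx i (w ws) (t, y)) has_real_derivative Dt (Dx i (w ws)) p) (at t)" for i
    by (rule D[OF smooth_on_ddir[OF smooth_w]])
  have Dquad: "((\<lambda>t. quad ws (t, y)) has_real_derivative
      (\<Sum>i\<in>UNIV. \<Sum>j\<in>UNIV. H i j y * Dt (Dx i (w ws)) p * ?w j + H i j y * ?w i * Dt (Dx j (w ws)) p)) (at t)"
    unfolding quad_def[abs_def] snd_conv
    by (intro DERIV_sum DERIV_cong[OF DERIV_mult[OF DERIV_cmult[OF DDw] DDw]])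
      (simp add: ty algebra_simps)
  have "((\<lambda>t. dens ws (t, y)) has_real_derivative
      1/2 * (2 * v ws p * Dt (v ws) p + (4 * a t ^ 3 * a' t * (quad ws p + (w ws p)\<^sup>2)
      + a t ^ 4 * ((\<Sum>i\<in>UNIV. \<Sum>j\<in>UNIV. H i j y * Dt (Dx i (w ws)) p * ?w j + H i j y * ?w i * Dt (Dx j (w ws)) p)
        + 2 * w ws p * Dt (w ws) p)))) (at t)"
    unfolding dens_def[abs_def] fst_conv
    by (rule DERIV_cong[OF DERIV_cmult[OF DERIV_add[OF DERIV_power[OF Dv, of 2]
            DERIV_mult[OF DERIV_power[OF a'(1)[OF ty(2)], of 4] DERIV_add[OF Dquad DERIV_power[OF Dw, of 2]]]], of "1/2"]])
      (simp add: ty algebra_simps)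
  from DERIV_unique[OF D[OF smooth_dens] this]
  have 1: "Dt (dens ws) p = 1/2 * (2 * v ws p * Dt (v ws) p + (4 * a t ^ 3 * a' t * (quad ws p + (w ws p)\<^sup>2)
      + a t ^ 4 * ((\<Sum>i\<in>UNIV. \<Sum>j\<in>UNIV. H i j y * Dt (Dx i (w ws)) p * ?w j + H i j y * ?w i * Dt (Dx j (w ws)) p)
        + 2 * w ws p * Dt (w ws) p)))" .
  have sym: "(\<Sum>i\<in>UNIV. \<Sum>j\<in>UNIV. H i j y * Dt (Dx i (w ws)) p * ?w j + H i j y * ?w i * Dt (Dx j (w ws)) p)
      = 2 * (\<Sum>i\<in>UNIV. \<Sum>j\<in>UNIV. H i j y * ?w i * Dt (Dx j (w ws)) p)"
  proof -
    have "(\<Sum>i\<in>UNIV. \<Sum>j\<in>UNIV. H i j y * Dt (Dx i (w ws)) p * ?w j)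
        = (\<Sum>i\<in>UNIV. \<Sum>j\<in>UNIV. H i j y * ?w i * Dt (Dx j (w ws)) p)"
      by (subst sum.swap) (simp add: sym_H[OF ty(3)] mult_ac)
    then show ?thesis by (simp add: sum.distrib)
  qed
  have V: "a t ^ 3 * Dt (Dx j (w ws)) p = ?V j" for j
    by (simp add: v_def w_Cons ty)
  have Vs: "a t ^ 4 * (\<Sum>i\<in>UNIV. \<Sum>j\<in>UNIV. H i j y * ?w i * Dt (Dx j (w ws)) p)
      = a t * (\<Sum>i\<in>UNIV. \<Sum>j\<in>UNIV. H i j y * ?w i * ?V j)"
    unfolding V[symmetric] by (simp add: sum_distrib_left power4_eq_xxxx power3_eq_cube mult_ac)
  have v1: "a t ^ 4 * Dt (w ws) p = a t * v ws p"
    by (simp add: v_def ty power4_eq_xxxx power3_eq_cube mult_ac)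
  have 2: "Dt (dens ws) p = v ws p * (a t * (principal (w ws) p + R)) + 2 * a t ^ 3 * a' t * (quad ws p + (w ws p)\<^sup>2)
      + a t * (\<Sum>i\<in>UNIV. \<Sum>j\<in>UNIV. H i j y * ?w i * ?V j) + w ws p * (a t * v ws p)"
    unfolding 1 sym R using Vs v1 ty by (simp add: algebra_simps)
  have f: "(\<Sum>j\<in>UNIV. Dx j (flux ws j) p) = a t * (\<Sum>i\<in>UNIV. \<Sum>j\<in>UNIV. H i j y * ?w i * ?V j)
      + a t * (principal (w ws) p + (\<Sum>j\<in>UNIV. \<Sum>i\<in>UNIV. ddir (axis j 1) (H i j) y * ?w i)) * v ws p"
  proof -
    have "(\<Sum>j\<in>UNIV. Dx j (flux ws j) p) = a t * ((\<Sum>j\<in>UNIV. (\<Sum>i\<in>UNIV. H i j y * ?w i) * ?V j)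
      + (\<Sum>j\<in>UNIV. \<Sum>i\<in>UNIV. H i j y * Dx i (Dx j (w ws)) p + ddir (axis j 1) (H i j) y * ?w i) * v ws p)"
      unfolding Dx_flux[OF p] by (simp add: ty sum.distrib flip: sum_distrib_left sum_distrib_right)
    moreover have "(\<Sum>j\<in>UNIV. (\<Sum>i\<in>UNIV. H i j y * ?w i) * ?V j) = (\<Sum>i\<in>UNIV. \<Sum>j\<in>UNIV. H i j y * ?w i * ?V j)"
      unfolding sum_distrib_right by (rule sum.swap)
    moreover have "(\<Sum>j\<in>UNIV. \<Sum>i\<in>UNIV. H i j y * Dx i (Dx j (w ws)) p) = principal (w ws) p"
      unfolding principal_def by (subst sum.swap) (simp add: ty)
    ultimately show ?thesis by (simp add: sum.distrib algebra_simps)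
  qed
  show ?thesis unfolding 2 f using ty by (simp add: algebra_simps)
qed

end

text \<open>The weighted inequality between arithmetic and geometric mean. With
  \<open>A = a t\<close> it is the source of the factor \<open>1 / a\<close> in all error
  terms.\<close>

lemma cross_term_le:
  fixes A x V B :: real
  assumes "V\<^sup>2 \<le> B" "A ^ 4 * x\<^sup>2 \<le> B"
  shows "A\<^sup>2 * (\<bar>x\<bar> * \<bar>V\<bar>) \<le> B"
proof -
  have "2 * (A\<^sup>2 * \<bar>x\<bar>) * \<bar>V\<bar> \<le> (A\<^sup>2 * \<bar>x\<bar>)\<^sup>2 + \<bar>V\<bar>\<^sup>2" by (rule sum_squares_bound)
  also have "\<dots> = A ^ 4 * x\<^sup>2 + V\<^sup>2" by (simp add: power_mult_distrib)
  finally show ?thesis using assms by simp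
qed

section \<open>Differential inequality for the energy density\<close>

context local_wave
begin

lemma m_nonneg: "0 \<le> m ws p"
  unfolding m_def by (intro add_nonneg_nonneg mult_nonneg_nonneg sum_nonneg) auto

lemma v_le_m: "(v ws p)\<^sup>2 \<le> m ws p"
  unfolding m_def by (simp add: sum_nonneg)

lemma w_le_m: "a (fst p) ^ 4 * (w ws p)\<^sup>2 \<le> m ws p"
  unfolding m_def by (simp add: sum_nonneg distrib_left add_nonneg_nonneg)

lemma Dw_le_m: "a (fst p) ^ 4 * (Dx j (w ws) p)\<^sup>2 \<le> m ws p"
proof -
  have "(Dx j (w ws) p)\<^sup>2 \<le> (\<Sum>j\<in>UNIV. (Dx j (w ws) p)\<^sup>2)"
    using member_le_sum[of j UNIV "\<lambda>j. (Dx j (w ws) p)\<^sup>2"] by auto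
  then have "a (fst p) ^ 4 * (Dx j (w ws) p)\<^sup>2 \<le> a (fst p) ^ 4 * (\<Sum>j\<in>UNIV. (Dx j (w ws) p)\<^sup>2)"
    by (intro mult_left_mono) auto
  also have "\<dots> \<le> m ws p" unfolding m_def by (simp add: distrib_left)
  finally show ?thesis .
qed

definition M :: "nat \<Rightarrow> real \<times> (real^3) \<Rightarrow> real" where
  "M n p = (\<Sum>ws | length ws \<le> n. m ws p)"

lemma m_le_M: "length ws \<le> n \<Longrightarrow> m ws p \<le> M n p"
  unfolding M_def using member_le_sum[of ws "{ws. length ws \<le> n}" "\<lambda>ws. m ws p"]
  by (simp add: m_nonneg finite_lists_le)

text \<open>The gradient in \<open>m\<close> reaches one order beyond \<open>n\<close>, which
  matches the order of the commutator remainder.\<close>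

lemma w_le_M: "length ws \<le> Suc n \<Longrightarrow> a (fst p) ^ 4 * (w ws p)\<^sup>2 \<le> M n p"
proof (cases ws)
  case Nil
  then show ?thesis using w_le_m[of p "[]"] m_le_M[of "[]" n p] by simp
next
  case (Cons i vs)
  assume "length ws \<le> Suc n"
  then show ?thesis using Cons Dw_le_m[of p i vs] m_le_M[of vs n p] by (simp add: w_Cons)
qed

lemma M_nonneg: "0 \<le> M n p"
  unfolding M_def by (intro sum_nonneg m_nonneg)

context
  fixes Q c h
  assumes Q: "compact Q" "Q \<subseteq> U" and c: "0 < c" "c \<le> 1" and h: "0 < h"
    and elliptic: "\<And>y z. y \<in> Q \<Longrightarrow> c * (\<Sum>i\<in>UNIV. (z $ i)\<^sup>2) \<le> (\<Sum>i\<in>UNIV. \<Sum>j\<in>UNIV. H i j y * z $ i * z $ j)"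
    and H_le: "\<And>y i j. y \<in> Q \<Longrightarrow> \<bar>H i j y\<bar> \<le> h"
    and DH_le: "\<And>y i j k. y \<in> Q \<Longrightarrow> \<bar>ddir (axis k 1) (H i j) y\<bar> \<le> h"
begin

lemma quad_ge: "y \<in> Q \<Longrightarrow> c * (\<Sum>i\<in>UNIV. (Dx i (w ws) (t, y))\<^sup>2) \<le> quad ws (t, y)"
  using elliptic[of y "\<chi> i. Dx i (w ws) (t, y)"] by (simp add: quad_def)

lemma quad_nonneg: "y \<in> Q \<Longrightarrow> 0 \<le> quad ws (t, y)"
  using c(1) by (intro order_trans[OF _ quad_ge[of y ws t]] mult_nonneg_nonneg sum_nonneg) auto

lemma dens_ge:
  assumes "y \<in> Q"
  shows "m ws (t, y) \<le> 2 / c * dens ws (t, y)"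
proof -
  let ?D = "\<Sum>i\<in>UNIV. (Dx i (w ws) (t, y))\<^sup>2"
  have "c * (v ws (t, y))\<^sup>2 \<le> (v ws (t, y))\<^sup>2" "c * (w ws (t, y))\<^sup>2 \<le> (w ws (t, y))\<^sup>2"
    using c by (auto intro!: mult_left_le_one_le)
  moreover have "a t ^ 4 * (c * ?D + c * (w ws (t, y))\<^sup>2) \<le> a t ^ 4 * (quad ws (t, y) + (w ws (t, y))\<^sup>2)"
    using quad_ge[OF assms] calculation by (intro mult_left_mono add_mono) auto
  ultimately have "c * m ws (t, y) \<le> 2 * dens ws (t, y)"
    unfolding m_def dens_def by (simp add: algebra_simps)
  then show ?thesis using c by (simp add: field_simps)
qed

lemma dens_nonneg: "y \<in> Q \<Longrightarrow> 0 \<le> dens ws (t, y)"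
  using quad_nonneg[of y ws t] unfolding dens_def by simp

text \<open>The ratio of flux to density is the coordinate speed of propagation, here at most a
  multiple of \<open>1 / a\<close>. The factor 3 counts the summands over \<open>i\<close>.\<close>

lemma flux_le:
  assumes "y \<in> Q" "0 < t"
  shows "\<bar>flux ws j (t, y)\<bar> \<le> 3 * h / a t * m ws (t, y)"
proof -
  let ?p = "(t, y)"
  have a: "a t > 0" using a_pos[OF assms(2)] .
  have "(a t)\<^sup>2 * \<bar>(\<Sum>i\<in>UNIV. H i j y * Dx i (w ws) ?p) * v ws ?p\<bar>
      \<le> (a t)\<^sup>2 * ((\<Sum>i\<in>UNIV. h * \<bar>Dx i (w ws) ?p\<bar>) * \<bar>v ws ?p\<bar>)"
    unfolding abs_mult using H_le[OF assms(1)]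
    by (intro mult_left_mono mult_right_mono order_trans[OF sum_abs] sum_mono) (auto simp: abs_mult intro!: mult_right_mono)
  also have "\<dots> = (\<Sum>i\<in>UNIV. h * ((a t)\<^sup>2 * (\<bar>Dx i (w ws) ?p\<bar> * \<bar>v ws ?p\<bar>)))"
    by (simp add: sum_distrib_left sum_distrib_right mult_ac)
  also have "\<dots> \<le> (\<Sum>i\<in>(UNIV::3 set). h * m ws ?p)"
    using h by (intro sum_mono mult_left_mono cross_term_le v_le_m Dw_le_m[of ?p, simplified]) auto
  also have "\<dots> = 3 * h * m ws ?p" by simp
  finally have "a t * (a t * \<bar>(\<Sum>i\<in>UNIV. H i j y * Dx i (w ws) ?p) * v ws ?p\<bar>) \<le> 3 * h * m ws ?p"
    by (simp add: power2_eq_square)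
  then show ?thesis using a unfolding flux_def by (simp add: field_simps abs_mult)
qed

text \<open>Of the terms in \<open>Dt_dens\<close> the divergence is kept and the one with
  \<open>a'\<close> is dropped as nonnegative. The others are products of \<open>v\<close> with
  terms of order at most one above \<open>ws\<close>, each at most a multiple of
  \<open>M n / a\<close>.\<close>

lemma Dt_dens_ge:
  assumes "length ws \<le> n"
  shows "\<exists>C\<ge>0. \<forall>t>0. \<forall>y\<in>Q.
    (\<Sum>j\<in>UNIV. Dx j (flux ws j) (t, y)) - C / a t * M n (t, y) \<le> Dt (dens ws) (t, y)"
proof -
  obtain R where R: "lin (Suc (length ws)) R"
    "\<And>p. p \<in> S \<Longrightarrow> Dt (v ws) p = a (fst p) * (principal (w ws) p + R p)"
    using commuted_wave[of ws] by blast
  let ?L = "{vs :: 3 list. length vs \<le> Suc (length ws)}"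
  obtain C where C: "C \<ge> 0" "\<And>t y. t > 0 \<Longrightarrow> y \<in> Q \<Longrightarrow> \<bar>R (t, y)\<bar> \<le> C * (\<Sum>vs\<in>?L. \<bar>w vs (t, y)\<bar>)"
    using lin_bound[OF R(1) Q] by blast
  \<comment> \<open>The summands belong to the commutator remainder, to the nine derivatives of
    \<open>H\<close> left by the divergence, and to the product of \<open>w\<close> and
    \<open>v\<close>.\<close>
  let ?C = "C * card ?L + 9 * h + 1"
  show ?thesis
  proof (intro exI[of _ ?C] conjI allI impI ballI)
    fix t y assume t: "(t::real) > 0" and y: "y \<in> Q"
    let ?p = "(t, y)" and ?a = "a t"
    let ?V = "v ws ?p" and ?M = "M n (t, y)"
    let ?Z = "\<Sum>j\<in>UNIV. \<Sum>i\<in>UNIV. ddir (axis j 1) (H i j) y * Dx i (w ws) ?p"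
    have a: "?a > 0" using a_pos[OF t] .
    have p: "?p \<in> S" using t y Q by (auto simp: S_def)
    have mM: "m ws ?p \<le> ?M" by (rule m_le_M[OF assms])
    have VM: "?V\<^sup>2 \<le> ?M" using v_le_m[of ws ?p] mM by linarith
    have vR: "?a\<^sup>2 * \<bar>?V * R ?p\<bar> \<le> C * card ?L * ?M"
    proof -
      have "?a\<^sup>2 * \<bar>?V * R ?p\<bar> \<le> ?a\<^sup>2 * (\<bar>?V\<bar> * (C * (\<Sum>vs\<in>?L. \<bar>w vs ?p\<bar>)))"
        unfolding abs_mult using C(2)[OF t y] by (intro mult_left_mono) auto
      also have "\<dots> = C * (\<Sum>vs\<in>?L. ?a\<^sup>2 * (\<bar>w vs ?p\<bar> * \<bar>?V\<bar>))"
        by (simp add: sum_distrib_left mult_ac)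
      also have "\<dots> \<le> C * (\<Sum>vs\<in>?L. ?M)"
        using assms C(1) by (intro mult_left_mono sum_mono cross_term_le VM w_le_M[of _ n ?p, simplified]) auto
      finally show ?thesis by simp
    qed
    have Zv: "?a\<^sup>2 * \<bar>?Z * ?V\<bar> \<le> 9 * h * ?M"
    proof -
      have "\<bar>?Z\<bar> \<le> (\<Sum>j\<in>UNIV. \<bar>\<Sum>i\<in>UNIV. ddir (axis j 1) (H i j) y * Dx i (w ws) ?p\<bar>)" by (rule sum_abs)
      also have "\<dots> \<le> (\<Sum>j\<in>(UNIV::3 set). \<Sum>i\<in>UNIV. h * \<bar>Dx i (w ws) ?p\<bar>)"
        using DH_le[OF y]
        by (intro sum_mono order_trans[OF sum_abs]) (auto simp: abs_mult intro!: mult_right_mono)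
      finally have "?a\<^sup>2 * \<bar>?Z * ?V\<bar> \<le> ?a\<^sup>2 * ((\<Sum>j\<in>(UNIV::3 set). \<Sum>i\<in>UNIV. h * \<bar>Dx i (w ws) ?p\<bar>) * \<bar>?V\<bar>)"
        unfolding abs_mult by (intro mult_left_mono mult_right_mono) auto
      also have "\<dots> = (\<Sum>j\<in>(UNIV::3 set). \<Sum>i\<in>UNIV. h * (?a\<^sup>2 * (\<bar>Dx i (w ws) ?p\<bar> * \<bar>?V\<bar>)))"
        by (simp add: sum_distrib_left sum_distrib_right mult_ac)
      also have "\<dots> \<le> (\<Sum>j\<in>(UNIV::3 set). \<Sum>i\<in>(UNIV::3 set). h * ?M)"
        using h order_trans[OF Dw_le_m[of ?p _ ws, simplified] mM]
        by (intro sum_mono mult_left_mono cross_term_le VM) auto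
      finally show ?thesis by simp
    qed
    have wv: "?a\<^sup>2 * \<bar>w ws ?p * ?V\<bar> \<le> ?M"
      unfolding abs_mult using order_trans[OF w_le_m[of ?p ws, simplified] mM] by (intro cross_term_le VM) auto
    have "?a\<^sup>2 * \<bar>?V * R ?p - ?Z * ?V + w ws ?p * ?V\<bar> \<le> ?a\<^sup>2 * (\<bar>?V * R ?p\<bar> + \<bar>?Z * ?V\<bar> + \<bar>w ws ?p * ?V\<bar>)"
      by (intro mult_left_mono) auto
    also have "\<dots> \<le> ?C * ?M" using vR Zv wv by (simp add: algebra_simps)
    finally have "?a * (?a * \<bar>?V * R ?p - ?Z * ?V + w ws ?p * ?V\<bar>) \<le> ?C * ?M" by (simp add: power2_eq_square)
    then have "?a * \<bar>?V * R ?p - ?Z * ?V + w ws ?p * ?V\<bar> \<le> ?C / ?a * ?M"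
      using a by (simp add: pos_le_divide_eq mult.commute)
    moreover have "- (?a * \<bar>x\<bar>) \<le> ?a * x" for x
      using mult_left_mono[of "- \<bar>x\<bar>" x ?a] a by simp
    from this[of "?V * R ?p - ?Z * ?V + w ws ?p * ?V"]
    have "- (?a * \<bar>?V * R ?p - ?Z * ?V + w ws ?p * ?V\<bar>) \<le> ?a * (?V * R ?p - ?Z * ?V + w ws ?p * ?V)" .
    moreover have "0 \<le> 2 * ?a ^ 3 * a' t * (quad ws ?p + (w ws ?p)\<^sup>2)"
      using a a'(2)[OF t] quad_nonneg[OF y] by (intro mult_nonneg_nonneg add_nonneg_nonneg) auto
    ultimately show "(\<Sum>j\<in>UNIV. Dx j (flux ws j) ?p) - ?C / ?a * ?M \<le> Dt (dens ws) ?p"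
      unfolding Dt_dens[OF p R(2)[OF p]] fst_conv snd_conv by linarith
  qed (use C h in auto)
qed

lemma Dt_dens_sum_ge:
  "\<exists>C\<ge>0. \<forall>t>0. \<forall>y\<in>Q.
    (\<Sum>ws | length ws \<le> n. \<Sum>j\<in>UNIV. Dx j (flux ws j) (t, y)) - C / a t * M n (t, y)
      \<le> (\<Sum>ws | length ws \<le> n. Dt (dens ws) (t, y))"
proof -
  let ?L = "{ws :: 3 list. length ws \<le> n}"
  have "\<forall>ws\<in>?L. \<exists>C. C \<ge> 0 \<and> (\<forall>t>0. \<forall>y\<in>Q.
      (\<Sum>j\<in>UNIV. Dx j (flux ws j) (t, y)) - C / a t * M n (t, y) \<le> Dt (dens ws) (t, y))"
    using Dt_dens_ge[of _ n] by simp
  from bchoice[OF this] obtain C where C: "\<And>ws. ws \<in> ?L \<Longrightarrow> C ws \<ge> 0" "\<And>ws t y. ws \<in> ?L \<Longrightarrow> t > 0 \<Longrightarrow> y \<in> Q \<Longrightarrow>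
      (\<Sum>j\<in>UNIV. Dx j (flux ws j) (t, y)) - C ws / a t * M n (t, y) \<le> Dt (dens ws) (t, y)"
    by blast
  show ?thesis
  proof (intro exI[of _ "sum C ?L"] conjI allI impI ballI sum_nonneg)
    fix t y assume t: "(t::real) > 0" and y: "y \<in> Q"
    have "(\<Sum>ws\<in>?L. (\<Sum>j\<in>UNIV. Dx j (flux ws j) (t, y)) - C ws / a t * M n (t, y)) \<le> (\<Sum>ws\<in>?L. Dt (dens ws) (t, y))"
      by (intro sum_mono C(2) t y)
    then show "(\<Sum>ws\<in>?L. \<Sum>j\<in>UNIV. Dx j (flux ws j) (t, y)) - sum C ?L / a t * M n (t, y) \<le> (\<Sum>ws\<in>?L. Dt (dens ws) (t, y))"
      by (simp add: sum_subtractf sum_distrib_right sum_divide_distrib)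
  qed (use C in auto)
qed

end

end

section \<open>Localised energy estimate\<close>

lemma mem_cube: "y \<in> cbox (y0 - vec d) (y0 + vec d) \<longleftrightarrow> (\<forall>i. \<bar>(y - y0) $ i\<bar> \<le> d)"
  for y y0 :: "real^'n"
proof -
  have "(y0 $ i - d \<le> y $ i \<and> y $ i \<le> y0 $ i + d) \<longleftrightarrow> \<bar>(y - y0) $ i\<bar> \<le> d" for i
    by (simp only: abs_le_iff vector_minus_component) linarith
  then show ?thesis by (simp add: mem_box_cart)
qed

text \<open>The cutoff is supported where \<open>|y - y0|^2\<close> is at most
  \<open>\<rho>^2 / 4 + N * s t\<close>, a ball that shrinks towards the past at a rate dominating
  the speed of propagation. Its time derivative outweighs the flux through its slope, so the
  localised energy obeys the inequality of a global one, and the backward Gronwall estimate holds up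
  to the singularity. The ball keeps a radius of at least \<open>\<rho> / 2\<close>, as
  \<open>s\<close> is positive.\<close>

lemma (in local_wave) energy_bounded:
  fixes y0 :: "real^3"
  assumes \<rho>: "0 < \<rho>" and QU: "cbox (y0 - vec \<rho>) (y0 + vec \<rho>) \<subseteq> U"
  shows "\<exists>C. \<exists>t0>0. \<forall>t. 0 < t \<and> t < t0 \<longrightarrow> (\<forall>ws. length ws \<le> n \<longrightarrow>
    cint (y0 - vec (\<rho>/8)) (y0 + vec (\<rho>/8)) (\<lambda>y. a t ^ 4 * (w ws (t, y))\<^sup>2) \<le> C)"
proof -
  define p where "p = y0 - vec \<rho>"
  define q where "q = y0 + vec \<rho>"
  define Q where "Q = cbox p q"
  define K where "K = cbox (y0 - vec (\<rho>/8)) (y0 + vec (\<rho>/8))"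
  have mem_Q: "y \<in> Q \<longleftrightarrow> (\<forall>i. \<bar>(y - y0) $ i\<bar> \<le> \<rho>)" for y
    unfolding Q_def p_def q_def by (rule mem_cube)
  have mem_K: "y \<in> K \<longleftrightarrow> (\<forall>i. \<bar>(y - y0) $ i\<bar> \<le> \<rho>/8)" for y
    unfolding K_def by (rule mem_cube)
  have KQ: "K \<subseteq> Q" using \<rho> unfolding subset_iff mem_K mem_Q by (auto intro: order_trans[of _ "\<rho>/8"])
  have Q: "compact Q" "Q \<subseteq> U" "Q \<noteq> {}"
    using QU \<rho> mem_Q[of y0] by (auto simp: Q_def p_def q_def)
  obtain c h where c: "0 < c" "c \<le> 1" and h: "0 < h"
    and ell: "\<And>y z. y \<in> Q \<Longrightarrow> c * (\<Sum>i\<in>UNIV. (z $ i)\<^sup>2) \<le> (\<Sum>i\<in>UNIV. \<Sum>j\<in>UNIV. H i j y * z $ i * z $ j)"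
    and Hh: "\<And>y i j. y \<in> Q \<Longrightarrow> \<bar>H i j y\<bar> \<le> h"
    and DHh: "\<And>y i j k. y \<in> Q \<Longrightarrow> \<bar>ddir (axis k 1) (H i j) y\<bar> \<le> h"
    by (rule H_bounds[OF Q]) (rule that)
  note est = Q(1,2) c h ell Hh DHh
  let ?L = "{ws :: 3 list. length ws \<le> n}"
  note fin = finite_lists_le[of n]
  obtain C where C: "C \<ge> 0" "\<And>t y. t > 0 \<Longrightarrow> y \<in> Q \<Longrightarrow>
      (\<Sum>ws\<in>?L. \<Sum>j\<in>UNIV. Dx j (flux ws j) (t, y)) - C / a t * M n (t, y) \<le> (\<Sum>ws\<in>?L. Dt (dens ws) (t, y))"
    using Dt_dens_sum_ge[OF est, of n] by blast
  \<comment> \<open>Each of the three directions contributes 4 times a coordinate of size at most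
    \<open>\<rho>\<close> from the slope of the cutoff, the flux factor \<open>3 * h\<close> and the
    comparison factor \<open>2 / c\<close>. The total \<open>72 * \<rho> * h / c\<close> has to be
    matched by \<open>2 * N\<close>.\<close>
  define N where "N = 36 * \<rho> * h / c"
  have N: "N \<ge> 0" using \<rho> h c by (simp add: N_def)
  define e where "e p = (\<Sum>ws\<in>?L. dens ws p)" for p
  define F where "F j p = (\<Sum>ws\<in>?L. flux ws j p)" for j p
  have e_smooth: "smooth_on e S" unfolding e_def[abs_def] by (intro smooth_on_sum open_S smooth_dens)
  have F_smooth: "smooth_on (F j) S" for j unfolding F_def[abs_def] by (intro smooth_on_sum open_S smooth_flux)
  have SI: "(t, y) \<in> S" if "t > 0" "y \<in> Q" for t y using that Q by (auto simp: S_def)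
  have Dte: "Dt e (t, y) = (\<Sum>ws\<in>?L. Dt (dens ws) (t, y))" if "t > 0" "y \<in> Q" for t y
    unfolding e_def[abs_def] by (rule ddir_sum[OF smooth_dens SI[OF that]])
  have DxF: "Dx j (F j) (t, y) = (\<Sum>ws\<in>?L. Dx j (flux ws j) (t, y))" if "t > 0" "y \<in> Q" for t y j
    unfolding F_def[abs_def] by (rule ddir_sum[OF smooth_flux SI[OF that]])
  have e0: "0 \<le> e (t, y)" if "y \<in> Q" for t y
    unfolding e_def by (intro sum_nonneg dens_nonneg[OF est that])
  have Me: "M n (t, y) \<le> 2 / c * e (t, y)" if "y \<in> Q" for t y
    unfolding M_def e_def sum_distrib_left by (intro sum_mono dens_ge[OF est that])
  have F_le: "\<bar>F j (t, y)\<bar> \<le> 3 * h / a t * M n (t, y)" if "t > 0" "y \<in> Q" for t y j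
    unfolding M_def F_def sum_distrib_left
    by (intro order_trans[OF sum_abs] sum_mono flux_le[OF est that(2,1)])

  define g where "g t y = max 0 (\<rho>\<^sup>2/4 + N * s t - (y - y0) \<bullet> (y - y0))" for t y
  define cut where "cut t y = (g t y)\<^sup>2" for t y
  have g0: "0 \<le> g t y" for t y unfolding g_def by simp
  have cut_dt: "((\<lambda>t. cut t y) has_real_derivative 2 * g t y * (N * s' t)) (at t)" if "t > 0" for t y
    unfolding cut_def g_def
    by (rule DERIV_chain2[OF pos_part_square_deriv])
      (use s'(1)[OF that] in \<open>auto intro!: derivative_eq_intros\<close>)
  have "((\<lambda>y. \<rho>\<^sup>2/4 + N * s t - (y - y0) \<bullet> (y - y0)) has_derivative (\<lambda>k. - 2 * ((y - y0) \<bullet> k))) (at y)" for t y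
    by (auto intro!: derivative_eq_intros simp: inner_commute)
  from DERIV_compose_FDERIV[OF pos_part_square_deriv this]
  have cut_dy: "(cut t has_derivative (\<lambda>k. - 2 * ((y - y0) \<bullet> k) * (2 * g t y))) (at y)" for t y
    unfolding cut_def[abs_def] g_def .
  have cs: "continuous_on {0<..} s"
    using s'(1) by (intro DERIV_continuous_on) (auto intro: has_field_derivative_at_within)
  have g_cont: "continuous_on ({0<..} \<times> Q) (\<lambda>x. g (fst x) (snd x))"
    unfolding g_def by (intro continuous_intros continuous_on_compose2[OF cs]) auto
  have slice: "continuous_on Q (\<lambda>y. f (t, y))" if "smooth_on f S" "t > 0" for f :: "real \<times> (real^3) \<Rightarrow> real" and t
    by (rule continuous_on_compose2[OF smooth_on_continuous[OF that(1)]])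
      (use SI that in \<open>auto intro!: continuous_intros\<close>)
  have joint: "continuous_on ({0<..} \<times> Q) f" if "smooth_on f S" for f :: "real \<times> (real^3) \<Rightarrow> real"
    by (rule continuous_on_subset[OF smooth_on_continuous[OF that]]) (use SI in auto)
  have g_slice: "continuous_on Q (g t)" for t
    unfolding g_def by (intro continuous_intros)
  have cut_slice: "continuous_on Q (cut t)" for t
    unfolding cut_def by (intro continuous_intros g_slice)

  define E where "E t = cint p q (\<lambda>y. cut t y * e (t, y))" for t
  define D where "D t y = cut t y * Dt e (t, y) + 2 * g t y * (N * s' t) * e (t, y)" for t y
  have E_deriv: "(E has_real_derivative cint p q (D t)) (at t)" if t: "t > 0" for t
    unfolding E_def[abs_def]
  proof (rule cint_has_real_derivative[where T = "{0<..}"])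
    fix t :: real and y assume ty: "t \<in> {0<..}" "y \<in> cbox p q"
    then have "((\<lambda>t. e (t, y)) has_real_derivative Dt e (t, y)) (at t)"
      using has_real_derivative_Dt[OF smooth_onD[OF e_smooth SI]] by (simp add: Q_def)
    from DERIV_mult'[OF cut_dt this]
    show "((\<lambda>t. cut t y * e (t, y)) has_real_derivative D t y) (at t)"
      using ty by (simp add: D_def)
  next
    fix t :: real assume "t \<in> {0<..}"
    then show "continuous_on (cbox p q) (\<lambda>y. cut t y * e (t, y))"
      by (intro continuous_intros cut_slice[unfolded Q_def] slice[OF e_smooth, unfolded Q_def]) auto
  next
    have "continuous_on ({0<..} \<times> Q) (\<lambda>x. D (fst x) (snd x))"
      unfolding D_def cut_def prod.collapse
      by (intro continuous_intros g_cont joint e_smooth smooth_on_ddir continuous_on_compose2[OF s'(3)]) auto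
    then show "continuous_on ({0<..} \<times> cbox p q) (\<lambda>(t, y). D t y)" by (simp add: split_beta Q_def)
  qed (use t in auto)

  define Y where "Y t j y = cut t y * F j (t, y)" for t j y
  have Y_deriv: "(Y t j) differentiable (at y)"
    "ddir (axis j 1) (Y t j) y = cut t y * Dx j (F j) (t, y) - 4 * g t y * (y - y0) $ j * F j (t, y)"
    if ty: "t > 0" "y \<in> Q" for t j y
  proof -
    have sm: "smooth_on (\<lambda>y. F j (t, y)) U"
      by (rule smooth_on_slice[OF open_S F_smooth]) (use ty in \<open>auto simp: S_def\<close>)
    have yU: "y \<in> U" using ty Q by auto
    have dF: "ddir (axis j 1) (\<lambda>y. F j (t, y)) y = Dx j (F j) (t, y)"
      using dir_derivs_slice[OF open_S F_smooth SI[OF ty], of "[axis j 1]"] by simp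
    note d = has_derivative_mult[OF cut_dy smooth_on_has_derivative[OF sm yU], of t]
    show "(Y t j) differentiable (at y)" unfolding Y_def[abs_def] using d differentiable_def by blast
    show "ddir (axis j 1) (Y t j) y = cut t y * Dx j (F j) (t, y) - 4 * g t y * (y - y0) $ j * F j (t, y)"
      unfolding Y_def[abs_def] ddir_eqI[OF d] dF by (simp add: inner_axis algebra_simps)
  qed
  have Y_cont: "continuous_on Q (ddir (axis j 1) (Y t j))" if "t > 0" for t j
  proof -
    have "continuous_on Q (\<lambda>y. cut t y * Dx j (F j) (t, y) - 4 * g t y * (y - y0) $ j * F j (t, y))"
      by (intro continuous_intros cut_slice g_slice slice[OF F_smooth that] slice[OF smooth_on_ddir[OF F_smooth] that])
    then show ?thesis by (rule continuous_on_eq) (simp add: Y_deriv(2)[OF that])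
  qed

  have "((\<lambda>t. N * s t) \<longlongrightarrow> N * 0) (at_right 0)" by (intro tendsto_intros s)
  then have "\<forall>\<^sub>F t in at_right 0. N * s t < 3 * \<rho>\<^sup>2 / 4"
    by (rule order_tendstoD) (use \<rho> in simp)
  then obtain t1 where t1: "t1 > 0" "\<And>t. 0 < t \<Longrightarrow> t < t1 \<Longrightarrow> N * s t < 3 * \<rho>\<^sup>2 / 4"
    unfolding eventually_at_right_field by auto
  \<comment> \<open>While \<open>N * s t\<close> is below \<open>3 * \<rho>^2 / 4\<close>, the
    cutoff vanishes on the faces of the cube. Halving \<open>t1\<close> includes the starting time
    \<open>t0\<close> itself.\<close>
  define t0 where "t0 = t1 / 2"
  have t0: "t0 > 0" "\<And>t. 0 < t \<Longrightarrow> t \<le> t0 \<Longrightarrow> N * s t < 3 * \<rho>\<^sup>2 / 4"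
    using t1 by (auto simp: t0_def)
  have div: "cint p q (ddir (axis j 1) (Y t j)) = 0" if t: "0 < t" "t \<le> t0" for t j
  proof (rule cint_divergence)
    fix y assume y: "y \<in> cbox p q" "y $ j = p $ j \<or> y $ j = q $ j"
    then have "\<bar>(y - y0) $ j\<bar> = \<rho>" using \<rho> by (auto simp: p_def q_def)
    then have "\<rho> \<le> norm (y - y0)" using component_le_norm_cart[of "y - y0" j] by simp
    then have "\<rho>\<^sup>2 \<le> (y - y0) \<bullet> (y - y0)" using \<rho> by (simp flip: power2_norm_eq_inner)
    then have "g t y = 0" unfolding g_def using t0(2)[OF t] by simp
    then show "Y t j y = 0" by (simp add: Y_def cut_def)
  qed (use Y_deriv(1) Y_cont t \<rho> in \<open>auto simp: Q_def p_def q_def\<close>)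

  define k where "k = 2 * C / c"
  have k: "k \<ge> 0" using C c by (simp add: k_def)
  have ineq: "(\<Sum>j\<in>UNIV. ddir (axis j 1) (Y t j) y) - k * s' t * (cut t y * e (t, y)) \<le> D t y"
    if ty: "t > 0" "y \<in> Q" for t y
  proof -
    let ?e = "e (t, y)" and ?M = "M n (t, y)"
    have a1: "1 / a t \<le> s' t" "0 \<le> 1 / a t" using s'(2)[OF ty(1)] a_pos[OF ty(1)] by auto
    then have "0 \<le> s' t" by linarith
    have aM: "1 / a t * ?M \<le> s' t * (2 / c * ?e)"
      using Me[OF ty(2), of t] a1(1) \<open>0 \<le> s' t\<close> M_nonneg by (intro mult_mono)
    have 1: "(\<Sum>ws\<in>?L. \<Sum>j\<in>UNIV. Dx j (flux ws j) (t, y)) - k * s' t * ?e \<le> Dt e (t, y)"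
    proof -
      have "C * (1 / a t * ?M) \<le> C * (s' t * (2 / c * ?e))" using aM C by (intro mult_left_mono)
      then show ?thesis using C(2)[OF ty] unfolding Dte[OF ty] k_def by (simp add: field_simps)
    qed
    \<comment> \<open>Up to the factor \<open>g\<close>, the left side is what differentiating the
      cutoff in space adds to the divergence; the time derivative of the cutoff pays for it.\<close>
    have 2: "- (4 * (y - y0) $ j * F j (t, y)) \<le> 24 * \<rho> * h / c * s' t * ?e" for j
    proof -
      have "- (4 * (y - y0) $ j * F j (t, y)) \<le> 4 * (\<bar>(y - y0) $ j\<bar> * \<bar>F j (t, y)\<bar>)"
        unfolding abs_mult[symmetric] by linarith
      also have "\<bar>(y - y0) $ j\<bar> * \<bar>F j (t, y)\<bar> \<le> \<rho> * (3 * h * (1 / a t * ?M))"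
        using ty(2) F_le[OF ty, of j] \<rho> unfolding mem_Q by (intro mult_mono) auto
      also have "\<dots> \<le> \<rho> * (3 * h * (s' t * (2 / c * ?e)))"
        using \<rho> h aM by (intro mult_left_mono) auto
      finally show ?thesis by (simp add: field_simps)
    qed
    have "(\<Sum>j\<in>UNIV. - (4 * (y - y0) $ j * F j (t, y))) \<le> (\<Sum>j\<in>(UNIV::3 set). 24 * \<rho> * h / c * s' t * ?e)"
      by (intro sum_mono 2)
    also have "\<dots> = 2 * (N * s' t) * ?e" by (simp add: N_def)
    finally have 3: "g t y * (\<Sum>j\<in>UNIV. - (4 * (y - y0) $ j * F j (t, y))) \<le> g t y * (2 * (N * s' t) * ?e)"
      using g0 by (intro mult_left_mono)
    have 4: "cut t y * ((\<Sum>ws\<in>?L. \<Sum>j\<in>UNIV. Dx j (flux ws j) (t, y)) - k * s' t * ?e) \<le> cut t y * Dt e (t, y)"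
      using 1 by (intro mult_left_mono) (auto simp: cut_def)
    have "(\<Sum>j\<in>UNIV. ddir (axis j 1) (Y t j) y) = cut t y * (\<Sum>j\<in>UNIV. Dx j (F j) (t, y))
        + g t y * (\<Sum>j\<in>UNIV. - (4 * (y - y0) $ j * F j (t, y)))"
      by (simp add: Y_deriv(2)[OF ty] sum_subtractf sum_distrib_left sum_negf mult_ac)
    moreover have "(\<Sum>j\<in>UNIV. Dx j (F j) (t, y)) = (\<Sum>ws\<in>?L. \<Sum>j\<in>UNIV. Dx j (flux ws j) (t, y))"
      by (simp add: DxF[OF ty] sum.swap[of _ UNIV])
    ultimately show ?thesis using 3 4 by (simp add: D_def algebra_simps)
  qed
  have E_ineq: "- (k * s' t * E t) \<le> cint p q (D t)" if t: "0 < t" "t \<le> t0" for t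
  proof -
    have cY: "continuous_on (cbox p q) (\<lambda>y. \<Sum>j\<in>UNIV. ddir (axis j 1) (Y t j) y)"
      using Y_cont[OF t(1), unfolded Q_def] by (intro continuous_intros)
    have ce: "continuous_on (cbox p q) (\<lambda>y. cut t y * e (t, y))"
      using t by (intro continuous_intros cut_slice[unfolded Q_def] slice[OF e_smooth, unfolded Q_def])
    have cD: "continuous_on (cbox p q) (D t)"
      unfolding D_def[abs_def] using t
      by (intro continuous_intros cut_slice[unfolded Q_def] g_slice[unfolded Q_def]
          slice[OF e_smooth, unfolded Q_def] slice[OF smooth_on_ddir[OF e_smooth], unfolded Q_def])
    have "cint p q (\<lambda>y. (\<Sum>j\<in>UNIV. ddir (axis j 1) (Y t j) y) + (- (k * s' t)) * (cut t y * e (t, y))) \<le> cint p q (D t)"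
      using ineq[OF t(1)] by (intro cint_mono continuous_intros cY ce cD) (auto simp: Q_def)
    also have "cint p q (\<lambda>y. (\<Sum>j\<in>UNIV. ddir (axis j 1) (Y t j) y) + (- (k * s' t)) * (cut t y * e (t, y)))
        = (\<Sum>j\<in>UNIV. cint p q (ddir (axis j 1) (Y t j))) + (- (k * s' t)) * E t"
      unfolding E_def
      by (subst cint_add, intro cY, intro continuous_intros ce, subst cint_cmult, subst cint_sum)
        (use Y_cont[OF t(1), unfolded Q_def] in auto)
    finally show ?thesis using div[OF t] by simp
  qed
  have E_le: "E t \<le> E t0 * exp (k * s t0)" if t: "0 < t" "t \<le> t0" for t
  proof -
    have "0 \<le> E t" unfolding E_def using t e0
      by (intro cint_nonneg continuous_intros cut_slice[unfolded Q_def] slice[OF e_smooth, unfolded Q_def])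
        (auto simp: cut_def Q_def)
    then have "E t * 1 \<le> E t * exp (k * s t)"
      using k s(1)[OF t(1)] by (intro mult_left_mono) auto
    also have "\<dots> \<le> E t0 * exp (k * s t0)"
      by (rule gronwall_backward[of t0 E "\<lambda>t. cint p q (D t)" s s' k t]) (use E_deriv s'(1) E_ineq t in auto)
    finally show ?thesis by simp
  qed

  \<comment> \<open>On \<open>K\<close> the squared distance is at most
    \<open>3 * \<rho>^2 / 64\<close>, hence below \<open>\<rho>^2 / 8\<close>, which leaves
    \<open>g\<close> at least \<open>\<rho>^2 / 8\<close> at all times.\<close>
  define r where "r = (\<rho>\<^sup>2/8)\<^sup>2"
  have r: "r > 0" using \<rho> by (simp add: r_def)
  have cut_K: "r \<le> cut t y" if "0 < t" "y \<in> K" for t y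
  proof -
    have "((y - y0) $ i)\<^sup>2 \<le> (\<rho>/8)\<^sup>2" for i
      using that(2) \<rho> unfolding mem_K by (metis abs_ge_zero power2_abs power_mono)
    then have "(\<Sum>i\<in>UNIV. ((y - y0) $ i)\<^sup>2) \<le> (\<Sum>i\<in>(UNIV::3 set). (\<rho>/8)\<^sup>2)" by (intro sum_mono)
    then have "(y - y0) \<bullet> (y - y0) \<le> 3 * (\<rho>/8)\<^sup>2"
      by (simp add: norm_power2_vec flip: power2_norm_eq_inner)
    moreover have "0 \<le> N * s t" using N s(1)[OF that(1)] by simp
    moreover have "(\<rho>/8)\<^sup>2 = \<rho>\<^sup>2/64" by (simp add: power_divide)
    ultimately have "\<rho>\<^sup>2/8 \<le> \<rho>\<^sup>2/4 + N * s t - (y - y0) \<bullet> (y - y0)"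
      using zero_le_power2[of \<rho>] by linarith
    then have "\<rho>\<^sup>2/8 \<le> g t y" unfolding g_def by (rule max.coboundedI2)
    then show ?thesis unfolding r_def cut_def by (intro power_mono) auto
  qed
  define B where "B = 2 / (c * r) * (E t0 * exp (k * s t0))"
  have "cint (y0 - vec (\<rho>/8)) (y0 + vec (\<rho>/8)) (\<lambda>y. a t ^ 4 * (w ws (t, y))\<^sup>2) \<le> B"
    if t: "0 < t" "t < t0" and ws: "length ws \<le> n" for t ws
  proof -
    have ptw: "a t ^ 4 * (w ws (t, y))\<^sup>2 \<le> 2 / (c * r) * (cut t y * e (t, y))" if y: "y \<in> K" for y
    proof -
      have yQ: "y \<in> Q" using y KQ by auto
      have "a t ^ 4 * (w ws (t, y))\<^sup>2 \<le> 2 / c * e (t, y)"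
        using w_le_m[of "(t, y)" ws] m_le_M[OF ws, of "(t, y)"] Me[OF yQ, of t] by simp
      also have "\<dots> = 2 / (c * r) * (r * e (t, y))" using r by simp
      also have "\<dots> \<le> 2 / (c * r) * (cut t y * e (t, y))"
        using c r cut_K[OF t(1) y] e0[OF yQ] by (intro mult_left_mono mult_right_mono) auto
      finally show ?thesis .
    qed
    have ce: "continuous_on Q (\<lambda>y. cut t y * e (t, y))"
      using t by (intro continuous_intros cut_slice slice[OF e_smooth])
    have cw: "continuous_on Q (\<lambda>y. a t ^ 4 * (w ws (t, y))\<^sup>2)"
      using t by (intro continuous_intros slice[OF smooth_w])
    have "cint (y0 - vec (\<rho>/8)) (y0 + vec (\<rho>/8)) (\<lambda>y. a t ^ 4 * (w ws (t, y))\<^sup>2)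
        \<le> cint (y0 - vec (\<rho>/8)) (y0 + vec (\<rho>/8)) (\<lambda>y. 2 / (c * r) * (cut t y * e (t, y)))"
      by (rule cint_mono[OF continuous_on_subset[OF cw KQ, unfolded K_def]
            continuous_on_mult_left[OF continuous_on_subset[OF ce KQ, unfolded K_def]] ptw[unfolded K_def]])
    also have "\<dots> = 2 / (c * r) * cint (y0 - vec (\<rho>/8)) (y0 + vec (\<rho>/8)) (\<lambda>y. cut t y * e (t, y))"
      by (rule cint_cmult)
    also have "\<dots> \<le> 2 / (c * r) * E t"
      unfolding E_def using c r e0 KQ \<rho> ce
      by (intro mult_left_mono cint_subset) (auto simp: K_def Q_def cut_def)
    also have "\<dots> \<le> B" unfolding B_def using E_le[of t] t c r by (intro mult_left_mono) auto
    finally show ?thesis .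
  qed
  then show ?thesis using t0(1) by blast
qed

section \<open>Limits at the singularity\<close>

lemma dir_derivs_cmult:
  fixes f :: "'a::euclidean_space \<Rightarrow> real"
  assumes "open S" "smooth_on f S" "y \<in> S"
  shows "dir_derivs es (\<lambda>y. c * f y) y = c * dir_derivs es f y"
  using assms(3)
proof (induction es arbitrary: y)
  case (Cons e es)
  have "((\<lambda>y. c * dir_derivs es f y) has_derivative (\<lambda>v. c * ddir v (dir_derivs es f) y)) (at y)"
    by (intro has_derivative_mult_right smooth_on_has_derivative[OF smooth_on_dir_derivs[OF assms(2)] Cons(2)])
  from ddir_eqI[OF this, of e] ddir_cong[OF assms(1) Cons(2) Cons(1)]
  show ?case by simp
qed simp

text \<open>Termwise differentiation at every order at once: uniform convergence of the next
  derivatives makes \<open>Z es\<close> differentiable with derivative \<open>Z (h # es)\<close> in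
  the direction \<open>h\<close>. Convexity enters through the theorem on sequences of
  derivatives.\<close>

lemma uniform_limit_dir_derivs:
  fixes f :: "nat \<Rightarrow> 'a::euclidean_space \<Rightarrow> real"
  assumes B: "open B" "convex B" and f: "\<And>n. smooth_on (f n) B"
    and lim: "\<And>es. uniform_limit B (\<lambda>n. dir_derivs es (f n)) (Z es) sequentially"
  shows "smooth_on (Z []) B" and "y \<in> B \<Longrightarrow> dir_derivs es (Z []) y = Z es y"
proof -
  \<comment> \<open>The candidate derivative is written in a basis: finitely many uniform limits
    then give an estimate uniform in the direction.\<close>
  let ?g = "\<lambda>es x h. \<Sum>b\<in>Basis. (h \<bullet> b) * Z (b # es) x"
  have expand: "ddir h (dir_derivs es (f n)) x = (\<Sum>b\<in>Basis. (h \<bullet> b) * dir_derivs (b # es) (f n) x)"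
    if "x \<in> B" for h es n x
    using ddir_sum_direction[OF smooth_onD[OF smooth_on_dir_derivs[OF f] that], of "\<lambda>b. h \<bullet> b" id Basis]
    by (simp add: euclidean_representation)
  have ptlim: "(\<lambda>n. dir_derivs es (f n) x) \<longlonglongrightarrow> Z es x" if "x \<in> B" for es x
    using tendsto_uniform_limitI[OF lim that] .
  have Zlin: "Z (h # es) x = ?g es x h" if x: "x \<in> B" for h es x
  proof (rule LIMSEQ_unique)
    show "(\<lambda>n. dir_derivs (h # es) (f n) x) \<longlonglongrightarrow> Z (h # es) x" by (rule ptlim[OF x])
    have eq: "dir_derivs (h # es) (f n) x = (\<Sum>b\<in>Basis. (h \<bullet> b) * dir_derivs (b # es) (f n) x)" for n
      by (subst dir_derivs_Cons) (rule expand[OF x])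
    show "(\<lambda>n. dir_derivs (h # es) (f n) x) \<longlonglongrightarrow> ?g es x h"
      unfolding eq by (intro tendsto_intros ptlim x)
  qed
  have Zd: "(Z es has_derivative (\<lambda>h. Z (h # es) x)) (at x)" if x: "x \<in> B" for es x
  proof -
    have "\<exists>g. \<forall>x\<in>B. (\<lambda>n. dir_derivs es (f n) x) \<longlonglongrightarrow> g x \<and> (g has_derivative ?g es x) (at x within B)"
    proof (rule has_derivative_sequence[OF B(2)])
      show "(dir_derivs es (f n) has_derivative (\<lambda>h. ddir h (dir_derivs es (f n)) y)) (at y within B)" if "y \<in> B" for n y
        by (rule has_derivative_at_withinI[OF smooth_on_has_derivative[OF smooth_on_dir_derivs[OF f] that]])
      show "\<forall>\<^sub>F n in sequentially. \<forall>x\<in>B. \<forall>h. norm (ddir h (dir_derivs es (f n)) x - ?g es x h) \<le> \<epsilon> * norm h"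
        if \<epsilon>: "\<epsilon> > 0" for \<epsilon>
      proof -
        let ?d = "\<epsilon> / DIM('a)"
        have "?d > 0" using \<epsilon> by simp
        then have "\<forall>\<^sub>F n in sequentially. \<forall>b\<in>Basis. \<forall>x\<in>B. dist (dir_derivs (b # es) (f n) x) (Z (b # es) x) < ?d"
          by (intro eventually_ball_finite ballI uniform_limitD[OF lim]) auto
        then show ?thesis
        proof (rule eventually_mono, intro ballI allI)
          fix n x h assume n: "\<forall>b\<in>Basis. \<forall>x\<in>B. dist (dir_derivs (b # es) (f n) x) (Z (b # es) x) < ?d" and x: "x \<in> B"
          have "norm (ddir h (dir_derivs es (f n)) x - ?g es x h)
              = norm (\<Sum>b\<in>Basis. (h \<bullet> b) * (dir_derivs (b # es) (f n) x - Z (b # es) x))"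
            by (simp only: expand[OF x] sum_subtractf right_diff_distrib)
          also have "\<dots> \<le> (\<Sum>b\<in>(Basis::'a set). norm h * ?d)"
          proof (rule order_trans[OF norm_sum], rule sum_mono)
            fix b :: 'a assume b: "b \<in> Basis"
            have "\<bar>dir_derivs (b # es) (f n) x - Z (b # es) x\<bar> \<le> ?d"
              using n b x unfolding dist_real_def by (meson less_imp_le)
            then show "norm ((h \<bullet> b) * (dir_derivs (b # es) (f n) x - Z (b # es) x)) \<le> norm h * ?d"
              using Basis_le_norm[OF b, of h] by (simp only: real_norm_def abs_mult) (intro mult_mono; simp)
          qed
          finally show "norm (ddir h (dir_derivs es (f n)) x - ?g es x h) \<le> \<epsilon> * norm h" by (simp add: mult.commute)
        qed
      qed
    qed (use x ptlim in auto)
    then obtain g where g: "\<And>x. x \<in> B \<Longrightarrow> (\<lambda>n. dir_derivs es (f n) x) \<longlonglongrightarrow> g x"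
      "\<And>x. x \<in> B \<Longrightarrow> (g has_derivative ?g es x) (at x within B)" by blast
    have eq: "g x = Z es x" if "x \<in> B" for x using LIMSEQ_unique[OF g(1)[OF that] ptlim[OF that]] .
    have "(g has_derivative ?g es x) (at x)" using g(2)[OF x] unfolding at_within_open[OF x B(1)] .
    then have "(Z es has_derivative ?g es x) (at x)"
      by (rule has_derivative_transform_within_open[OF _ B(1) x]) (rule eq)
    moreover have lin: "(\<lambda>h. Z (h # es) x) = ?g es x" by (rule ext) (rule Zlin[OF x])
    ultimately show ?thesis by (subst lin)
  qed
  have D: "dir_derivs es (Z []) y = Z es y" if "y \<in> B" for es y
    using that
  proof (induction es arbitrary: y)
    case (Cons e es)
    have "ddir e (dir_derivs es (Z [])) y = ddir e (Z es) y" using ddir_cong[OF B(1) Cons(2) Cons(1)] .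
    also have "\<dots> = Z (e # es) y" by (rule ddir_eqI[OF Zd[OF Cons(2)]])
    finally show ?case by simp
  qed simp
  then show "y \<in> B \<Longrightarrow> dir_derivs es (Z []) y = Z es y" .
  show "smooth_on (Z []) B"
    unfolding smooth_on_def
  proof (intro allI ballI)
    fix es x assume x: "x \<in> B"
    have "Z es differentiable (at x)" using Zd[OF x] differentiable_def by blast
    then show "dir_derivs es (Z []) differentiable (at x)"
      by (rule differentiable_cong_open[OF _ B(1) x]) (simp add: D)
  qed
qed

section \<open>Pointwise bounds and limits on a smaller cube\<close>

context local_wave
begin

context
  fixes y0 :: "real^3" and \<rho> :: real
  assumes \<rho>: "0 < \<rho>" and cube: "cbox (y0 - vec \<rho>) (y0 + vec \<rho>) \<subseteq> U"
begin

definition K :: "(real^3) set" where "K = cbox (y0 - vec (\<rho>/8)) (y0 + vec (\<rho>/8))"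

lemma compact_K: "compact K" and K_subset_U: "K \<subseteq> U"
proof -
  have "K \<subseteq> cbox (y0 - vec \<rho>) (y0 + vec \<rho>)"
    using \<rho> unfolding subset_iff K_def mem_cube by (auto intro: order_trans[of _ "\<rho>/8"])
  then show "K \<subseteq> U" using cube by blast
qed (simp add: K_def)

lemma K_in_S: "0 < t \<Longrightarrow> y \<in> K \<Longrightarrow> (t, y) \<in> S"
  using K_subset_U by (auto simp: S_def)

text \<open>The Sobolev inequality asks for up to three derivatives beyond \<open>ws\<close>, and
  the energy bounds these in \<open>L^2\<close> with the weight \<open>a^4\<close>.\<close>

lemma w_bounded: "\<exists>C. \<forall>\<^sub>F t in at_right 0. \<forall>y\<in>K. (a t)\<^sup>2 * \<bar>w ws (t, y)\<bar> \<le> C"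
proof -
  let ?p = "y0 - vec (\<rho>/8)" and ?q = "y0 + vec (\<rho>/8)"
  obtain C t0 where t0: "t0 > 0" and C: "\<And>t ws'. 0 < t \<Longrightarrow> t < t0 \<Longrightarrow> length ws' \<le> length ws + 3 \<Longrightarrow>
      cint ?p ?q (\<lambda>y. a t ^ 4 * (w ws' (t, y))\<^sup>2) \<le> C"
    using energy_bounded[OF \<rho> cube, of "length ws + 3"] by blast
  let ?c = "(1 + 1 / (?q$1 - ?p$1)) * ((1 + 1 / (?q$2 - ?p$2)) * (1 + 1 / (?q$3 - ?p$3)))"
  have c0: "?c \<ge> 0" using \<rho> by simp
  let ?B = "?c * (\<Sum>vs\<in>corner_derivs. cint ?p ?q (\<lambda>y. 1) + C)"
  have "(a t)\<^sup>2 * \<bar>w ws (t, x)\<bar> \<le> ?B" if t: "0 < t" "t < t0" and x: "x \<in> K" for t x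
  proof -
    let ?f = "\<lambda>y. w ws (t, y)"
    have f: "smooth_on ?f U" by (rule smooth_on_slice[OF open_S smooth_w]) (use t in \<open>auto simp: S_def\<close>)
    have D: "dir_derivs (axes vs) ?f y = w (vs @ ws) (t, y)" if "y \<in> K" for vs y
      using dir_derivs_slice[OF open_S smooth_w K_in_S[OF t(1) that]]
      by (simp add: w_def dir_derivs_append)
    have cw: "continuous_on K (\<lambda>y. w vs (t, y))" for vs
      by (rule continuous_on_compose2[OF smooth_on_continuous[OF smooth_w]])
        (use K_in_S t in \<open>auto intro!: continuous_intros\<close>)
    have cD: "continuous_on K (dir_derivs (axes vs) ?f)" for vs
      by (rule continuous_on_eq[OF cw[of "vs @ ws"]]) (simp add: D)
    have 1: "(a t)\<^sup>2 * cint ?p ?q (\<lambda>y. \<bar>dir_derivs (axes vs) ?f y\<bar>) \<le> cint ?p ?q (\<lambda>y. 1) + C"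
      if vs: "vs \<in> corner_derivs" for vs
    proof -
      have len: "length (vs @ ws) \<le> length ws + 3" using vs by (auto simp: corner_derivs_def)
      have "(a t)\<^sup>2 * cint ?p ?q (\<lambda>y. \<bar>dir_derivs (axes vs) ?f y\<bar>)
          = cint ?p ?q (\<lambda>y. (a t)\<^sup>2 * \<bar>dir_derivs (axes vs) ?f y\<bar>)" by (rule cint_cmult[symmetric])
      also have "\<dots> \<le> cint ?p ?q (\<lambda>y. 1 + a t ^ 4 * (w (vs @ ws) (t, y))\<^sup>2)"
      proof (rule cint_mono)
        fix y assume "y \<in> cbox ?p ?q"
        then have y: "y \<in> K" by (simp add: K_def)
        \<comment> \<open>This passes from the \<open>L^2\<close> bound to the \<open>L^1\<close>
          norms of the Sobolev inequality, at the price of the volume of the cube.\<close>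
        have "z \<le> 1 + z\<^sup>2" for z :: real using sum_squares_bound[of z 1] zero_le_power2[of z]
          unfolding mult_1_right one_power2 by linarith
        from this[of "(a t)\<^sup>2 * \<bar>w (vs @ ws) (t, y)\<bar>"]
        show "(a t)\<^sup>2 * \<bar>dir_derivs (axes vs) ?f y\<bar> \<le> 1 + a t ^ 4 * (w (vs @ ws) (t, y))\<^sup>2"
          unfolding D[OF y] by (simp add: power_mult_distrib)
      qed (use cw cD in \<open>auto simp: K_def intro!: continuous_intros\<close>)
      also have "\<dots> = cint ?p ?q (\<lambda>y. 1) + cint ?p ?q (\<lambda>y. a t ^ 4 * (w (vs @ ws) (t, y))\<^sup>2)"
        by (rule cint_add) (use cw in \<open>auto simp: K_def intro!: continuous_intros\<close>)
      finally show ?thesis using C[OF t len] by linarith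
    qed
    have "\<bar>?f x\<bar> \<le> ?c * (\<Sum>vs\<in>corner_derivs. cint ?p ?q (\<lambda>y. \<bar>dir_derivs (axes vs) ?f y\<bar>))"
      by (rule sobolev_cube[OF _ f]) (use \<rho> x K_subset_U in \<open>auto simp: K_def\<close>)
    then have "(a t)\<^sup>2 * \<bar>?f x\<bar> \<le> (a t)\<^sup>2 * (?c * (\<Sum>vs\<in>corner_derivs. cint ?p ?q (\<lambda>y. \<bar>dir_derivs (axes vs) ?f y\<bar>)))"
      by (intro mult_left_mono) auto
    also have "\<dots> = ?c * (\<Sum>vs\<in>corner_derivs. (a t)\<^sup>2 * cint ?p ?q (\<lambda>y. \<bar>dir_derivs (axes vs) ?f y\<bar>))"
      by (simp only: sum_distrib_left mult.left_commute)
    also have "\<dots> \<le> ?B" using c0 by (intro mult_left_mono sum_mono 1)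
    finally show ?thesis .
  qed
  then show ?thesis using t0 unfolding eventually_at_right_field by (intro exI[of _ ?B] exI[of _ t0]) auto
qed

lemma lin_bounded:
  assumes "lin n F"
  shows "\<exists>C. \<forall>\<^sub>F t in at_right 0. \<forall>y\<in>K. (a t)\<^sup>2 * \<bar>F (t, y)\<bar> \<le> C"
proof -
  let ?L = "{ws :: 3 list. length ws \<le> n}"
  obtain C where C: "C \<ge> 0" "\<And>t y. t > 0 \<Longrightarrow> y \<in> K \<Longrightarrow> \<bar>F (t, y)\<bar> \<le> C * (\<Sum>ws\<in>?L. \<bar>w ws (t, y)\<bar>)"
    using lin_bound[OF assms compact_K K_subset_U] by blast
  have "\<forall>ws. \<exists>C. \<forall>\<^sub>F t in at_right 0. \<forall>y\<in>K. (a t)\<^sup>2 * \<bar>w ws (t, y)\<bar> \<le> C" using w_bounded by blast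
  from choice[OF this] obtain B where
    B: "\<And>ws. \<forall>\<^sub>F t in at_right 0. \<forall>y\<in>K. (a t)\<^sup>2 * \<bar>w ws (t, y)\<bar> \<le> B ws" by blast
  have "\<forall>\<^sub>F t in at_right 0. \<forall>ws\<in>?L. \<forall>y\<in>K. (a t)\<^sup>2 * \<bar>w ws (t, y)\<bar> \<le> B ws"
    by (intro eventually_ball_finite ballI B finite_lists_le)
  moreover have "\<forall>\<^sub>F t in at_right (0::real). 0 < t" by (rule eventually_at_right_less)
  ultimately have "\<forall>\<^sub>F t in at_right 0. \<forall>y\<in>K. (a t)\<^sup>2 * \<bar>F (t, y)\<bar> \<le> C * sum B ?L"
  proof (eventually_elim, intro ballI)
    fix t y assume b: "\<forall>ws\<in>?L. \<forall>y\<in>K. (a t)\<^sup>2 * \<bar>w ws (t, y)\<bar> \<le> B ws" and t: "0 < t" and y: "y \<in> K"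
    have "(a t)\<^sup>2 * \<bar>F (t, y)\<bar> \<le> (a t)\<^sup>2 * (C * (\<Sum>ws\<in>?L. \<bar>w ws (t, y)\<bar>))"
      by (intro mult_left_mono C t y) auto
    also have "\<dots> = C * (\<Sum>ws\<in>?L. (a t)\<^sup>2 * \<bar>w ws (t, y)\<bar>)" by (simp add: sum_distrib_left mult_ac)
    also have "\<dots> \<le> C * sum B ?L" using b y by (intro mult_left_mono sum_mono C) auto
    finally show "(a t)\<^sup>2 * \<bar>F (t, y)\<bar> \<le> C * sum B ?L" .
  qed
  then show ?thesis by blast
qed

abbreviation V where "V es \<equiv> dir_derivs (map (Pair 0) es) (v [])"

text \<open>The time derivative is at most \<open>C / a\<close>, hence at most
  \<open>C * s'\<close>. So adding \<open>C * s\<close> makes \<open>V es\<close> nondecreasing in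
  \<open>t\<close> and subtracting it makes it nonincreasing; as \<open>s\<close> tends to 0, both
  have the same limit, which \<open>V es\<close> approaches at the rate
  \<open>C * s t\<close>.\<close>

lemma V_limit: "\<exists>Z C. \<exists>t0>0. C \<ge> 0 \<and> (\<forall>t. 0 < t \<and> t < t0 \<longrightarrow> (\<forall>y\<in>K. \<bar>V es (t, y) - Z y\<bar> \<le> C * s t))"
proof -
  obtain F where F: "lin (length es + 2) F" "\<And>p. p \<in> S \<Longrightarrow> Dt (V es) p = a (fst p) * F p"
    using commuted_wave_directions[of es] by blast
  obtain C t0 where t0: "t0 > 0" and C: "\<And>t y. 0 < t \<Longrightarrow> t < t0 \<Longrightarrow> y \<in> K \<Longrightarrow> (a t)\<^sup>2 * \<bar>F (t, y)\<bar> \<le> C"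
    using lin_bounded[OF F(1)] unfolding eventually_at_right_field by fastforce
  let ?C = "\<bar>C\<bar>"
  have VD: "((\<lambda>t. V es (t, y)) has_real_derivative Dt (V es) (t, y)) (at t)" if "0 < t" "y \<in> K" for t y
    by (rule has_real_derivative_Dt[OF smooth_onD[OF smooth_on_dir_derivs[OF smooth_v] K_in_S[OF that]]])
  have bd: "\<bar>Dt (V es) (t, y)\<bar> \<le> ?C * s' t" if t: "0 < t" "t < t0" and y: "y \<in> K" for t y
  proof -
    have a: "a t > 0" using a_pos[OF t(1)] .
    have "a t * (a t * \<bar>F (t, y)\<bar>) \<le> ?C" using C[OF t y] by (simp add: power2_eq_square mult.assoc)
    then have "a t * \<bar>F (t, y)\<bar> \<le> ?C * (1 / a t)" using a by (simp add: pos_le_divide_eq mult.commute)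
    also have "\<dots> \<le> ?C * s' t" using s'(2)[OF t(1)] by (intro mult_left_mono) auto
    finally show ?thesis unfolding F(2)[OF K_in_S[OF t(1) y]] using a by (simp add: abs_mult)
  qed
  have up: "V es (x, y) + ?C * s x \<le> V es (z, y) + ?C * s z"
    and down: "V es (z, y) - ?C * s z \<le> V es (x, y) - ?C * s x"
    if xz: "0 < x" "x \<le> z" "z < t0" and y: "y \<in> K" for x z y
  proof -
    have "\<exists>d. ((\<lambda>t. V es (t, y) + ?C * s t) has_real_derivative d) (at t) \<and> 0 \<le> d"
      "\<exists>d. ((\<lambda>t. V es (t, y) - ?C * s t) has_real_derivative d) (at t) \<and> d \<le> 0"
      if t: "x \<le> t" "t \<le> z" for t
    proof -
      have t': "0 < t" "t < t0" using t xz by auto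
      show "\<exists>d. ((\<lambda>t. V es (t, y) + ?C * s t) has_real_derivative d) (at t) \<and> 0 \<le> d"
        using DERIV_add[OF VD[OF t'(1) y] DERIV_cmult[OF s'(1)[OF t'(1)], of ?C]] bd[OF t' y] by fastforce
      show "\<exists>d. ((\<lambda>t. V es (t, y) - ?C * s t) has_real_derivative d) (at t) \<and> d \<le> 0"
        using DERIV_diff[OF VD[OF t'(1) y] DERIV_cmult[OF s'(1)[OF t'(1)], of ?C]] bd[OF t' y] by fastforce
    qed
    then show "V es (x, y) + ?C * s x \<le> V es (z, y) + ?C * s z"
      "V es (z, y) - ?C * s z \<le> V es (x, y) - ?C * s x"
      by (intro DERIV_nonneg_imp_nondecreasing[OF xz(2)] DERIV_nonpos_imp_nonincreasing[OF xz(2)]; blast)+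
  qed
  \<comment> \<open>The infimum of a nondecreasing function of \<open>t\<close> is its limit at 0;
    the nonincreasing companion bounds it from below.\<close>
  define Z where "Z y = (INF t\<in>{0<..<t0}. V es (t, y) + ?C * s t)" for y
  have "\<bar>V es (t, y) - Z y\<bar> \<le> ?C * s t" if t: "0 < t" "t < t0" and y: "y \<in> K" for t y
  proof -
    have low: "V es (t, y) - ?C * s t \<le> V es (r, y) + ?C * s r" if r: "r \<in> {0<..<t0}" for r
    proof -
      have "0 \<le> ?C * s r" "0 \<le> ?C * s t" using s(1)[of r] s(1)[OF t(1)] r by auto
      then show ?thesis
        using up[of r t y] down[of r t y] up[of t r y] r t y by (cases "r \<le> t") auto
    qed
    have "Z y \<le> V es (t, y) + ?C * s t"
      unfolding Z_def by (rule cINF_lower[OF bdd_belowI2[OF low]]) (use t in auto)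
    moreover have "V es (t, y) - ?C * s t \<le> Z y"
      unfolding Z_def by (rule cINF_greatest) (use low t0 in auto)
    ultimately show ?thesis by linarith
  qed
  then show ?thesis using t0 by (intro exI[of _ Z] exI[of _ ?C] exI[of _ t0]) auto
qed

text \<open>Subtracting \<open>Z y * h / k\<close> leaves a function whose derivative is at most
  \<open>e / a^3\<close>, that is, \<open>e\<close> times the derivative of \<open>h / k\<close>. It
  grows at most like \<open>e / |k| * |h|\<close>, and dividing by the unbounded \<open>h\<close>
  removes its value at the fixed time \<open>r\<close>. The sign of \<open>k\<close> is irrelevant
  because \<open>h / k\<close> always increases.\<close>

lemma quotient_limit:
  fixes h :: "real \<Rightarrow> real"
  assumes h: "\<And>t. 0 < t \<Longrightarrow> (h has_real_derivative k / a t ^ 3) (at t)" and k: "k \<noteq> 0"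
    and h_inf: "filterlim (\<lambda>t. \<bar>h t\<bar>) at_top (at_right 0)"
    and Z: "t0 > 0" "C \<ge> 0" "\<And>t y. 0 < t \<Longrightarrow> t < t0 \<Longrightarrow> y \<in> K \<Longrightarrow> \<bar>V es (t, y) - Z y\<bar> \<le> C * s t"
  shows "uniform_limit K (\<lambda>t y. dir_derivs (map (Pair 0) es) u (t, y) / h t) (\<lambda>y. Z y / k) (at_right 0)"
proof (rule uniform_limitI)
  fix e0 :: real assume "e0 > 0"
  \<comment> \<open>Half of \<open>e0\<close> is for the growth of \<open>\<phi>\<close> relative to
    \<open>h\<close>, half for the constant \<open>B\<close>.\<close>
  define e where "e = e0 * \<bar>k\<bar> / 2"
  have e: "e > 0" "e / \<bar>k\<bar> = e0 / 2" using \<open>e0 > 0\<close> k by (auto simp: e_def)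
  let ?W = "dir_derivs (map (Pair 0) es) u"
  have sW: "smooth_on ?W S" using smooth_on_dir_derivs smooth_u S_def by metis
  define \<phi> where "\<phi> t y = ?W (t, y) - Z y * h t / k" for t y
  have "((\<lambda>t. C * s t) \<longlongrightarrow> C * 0) (at_right 0)" by (intro tendsto_intros s)
  then have "\<forall>\<^sub>F t in at_right 0. C * s t < e" by (rule order_tendstoD) (use e in simp)
  then obtain t1 where t1: "t1 > 0" "\<And>t. 0 < t \<Longrightarrow> t < t1 \<Longrightarrow> C * s t < e"
    unfolding eventually_at_right_field by auto
  define r where "r = min t0 t1 / 2"
  have r: "0 < r" "r < t0" "\<And>t. 0 < t \<Longrightarrow> t \<le> r \<Longrightarrow> t < t0 \<and> C * s t < e"
    using Z(1) t1 by (auto simp: r_def)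
  have slice_bd: "\<exists>B. \<forall>y\<in>K. \<bar>f (r, y)\<bar> \<le> B" if "smooth_on f S" for f :: "real \<times> (real^3) \<Rightarrow> real"
    by (rule smooth_on_bounded[OF smooth_on_slice[OF open_S that] compact_K K_subset_U])
      (use r in \<open>auto simp: S_def\<close>)
  obtain B1 where B1: "\<And>y. y \<in> K \<Longrightarrow> \<bar>?W (r, y)\<bar> \<le> B1" using slice_bd[OF sW] by blast
  obtain B2 where B2: "\<And>y. y \<in> K \<Longrightarrow> \<bar>V es (r, y)\<bar> \<le> B2"
    using slice_bd[OF smooth_on_dir_derivs[OF smooth_v]] by blast
  define B where "B = B1 + (B2 + e) * \<bar>h r / k\<bar> + e / \<bar>k\<bar> * \<bar>h r\<bar>"
  have bd: "\<bar>\<phi> t y\<bar> \<le> B + e / \<bar>k\<bar> * \<bar>h t\<bar>" if t: "0 < t" "t \<le> r" and y: "y \<in> K" for t y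
  proof -
    have d: "((\<lambda>t. \<phi> t y) has_real_derivative (V es (x, y) - Z y) / a x ^ 3) (at x)"
      and b: "\<bar>(V es (x, y) - Z y) / a x ^ 3\<bar> \<le> e / k * (k / a x ^ 3)" if x: "t \<le> x" "x \<le> r" for x
    proof -
      have x0: "x > 0" using x t by simp
      have a: "a x ^ 3 > 0" using a_pos[OF x0] by simp
      have "Dt ?W (x, y) = V es (x, y) / a x ^ 3"
        using dir_derivs_v[OF K_in_S[OF x0 y], of es] a by (simp add: field_simps)
      then show "((\<lambda>t. \<phi> t y) has_real_derivative (V es (x, y) - Z y) / a x ^ 3) (at x)"
        unfolding \<phi>_def
        using DERIV_diff[OF has_real_derivative_Dt[OF smooth_onD[OF sW K_in_S[OF x0 y]]]
            DERIV_cmult[OF h[OF x0], of "Z y / k"]] k by (simp add: diff_divide_distrib)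
      have "\<bar>V es (x, y) - Z y\<bar> \<le> e" using Z(3)[OF x0 _ y] r(3)[OF x0 x(2)] by force
      then have "\<bar>V es (x, y) - Z y\<bar> / a x ^ 3 \<le> e / a x ^ 3" using a by (intro divide_right_mono) auto
      then show "\<bar>(V es (x, y) - Z y) / a x ^ 3\<bar> \<le> e / k * (k / a x ^ 3)" using k a by simp
    qed
    have hd: "((\<lambda>t. e / k * h t) has_real_derivative e / k * (k / a x ^ 3)) (at x)" if "t \<le> x" for x
      by (rule DERIV_cmult[OF h]) (use that t in simp)
    have 1: "\<phi> t y + e / k * h t \<le> \<phi> r y + e / k * h r"
    proof (rule DERIV_nonneg_imp_nondecreasing[OF t(2)])
      fix x assume x: "t \<le> x" "x \<le> r"
      show "\<exists>d. ((\<lambda>t. \<phi> t y + e / k * h t) has_real_derivative d) (at x) \<and> 0 \<le> d"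
        by (rule exI, rule conjI, rule DERIV_add[OF d[OF x] hd[OF x(1)]]) (use b[OF x] in linarith)
    qed
    have 2: "\<phi> r y - e / k * h r \<le> \<phi> t y - e / k * h t"
    proof (rule DERIV_nonpos_imp_nonincreasing[OF t(2)])
      fix x assume x: "t \<le> x" "x \<le> r"
      show "\<exists>d. ((\<lambda>t. \<phi> t y - e / k * h t) has_real_derivative d) (at x) \<and> d \<le> 0"
        by (rule exI, rule conjI, rule DERIV_diff[OF d[OF x] hd[OF x(1)]]) (use b[OF x] in linarith)
    qed
    have ek: "\<bar>e / k * h x\<bar> = e / \<bar>k\<bar> * \<bar>h x\<bar>" for x using e by (simp add: abs_mult)
    have "\<bar>\<phi> t y\<bar> \<le> \<bar>\<phi> r y\<bar> + e / \<bar>k\<bar> * \<bar>h r\<bar> + e / \<bar>k\<bar> * \<bar>h t\<bar>"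
    proof -
      have "\<bar>x\<bar> \<le> \<bar>y\<bar> + \<bar>q\<bar> + \<bar>p\<bar>" if "x + p \<le> y + q" "y - q \<le> x - p" for x y p q :: real
        using that by linarith
      from this[OF 1 2] show ?thesis unfolding ek .
    qed
    moreover have "\<bar>\<phi> r y\<bar> \<le> B1 + (B2 + e) * \<bar>h r / k\<bar>"
    proof -
      have "\<bar>Z y\<bar> \<le> B2 + e" using Z(3)[OF r(1,2) y] B2[OF y] r(3)[OF r(1)] by linarith
      then have "\<bar>Z y * (h r / k)\<bar> \<le> (B2 + e) * \<bar>h r / k\<bar>" unfolding abs_mult by (intro mult_right_mono) auto
      moreover have "\<phi> r y = ?W (r, y) - Z y * (h r / k)" by (simp add: \<phi>_def)
      ultimately show ?thesis using B1[OF y] by linarith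
    qed
    ultimately show ?thesis unfolding B_def by linarith
  qed
  \<comment> \<open>The bound 1 keeps \<open>h t\<close> away from 0; beyond
    \<open>2 * B / e0\<close> the constant \<open>B\<close> costs at most
    \<open>e0 / 2\<close>.\<close>
  have "\<forall>\<^sub>F t in at_right 0. max 1 (2 * B / e0) < \<bar>h t\<bar>"
    using h_inf unfolding filterlim_at_top_dense by blast
  moreover have "\<forall>\<^sub>F t in at_right 0. 0 < t \<and> t \<le> r"
    using r(1) unfolding eventually_at_right_field by (intro exI[of _ r]) auto
  ultimately show "\<forall>\<^sub>F t in at_right 0. \<forall>y\<in>K. dist (?W (t, y) / h t) (Z y / k) < e0"
  proof (eventually_elim, intro ballI)
    fix t y assume ht: "max 1 (2 * B / e0) < \<bar>h t\<bar>" and t: "0 < t \<and> t \<le> r" and y: "y \<in> K"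
    have h0: "\<bar>h t\<bar> > 0" using ht by linarith
    have "B < e0 / 2 * \<bar>h t\<bar>" using ht \<open>e0 > 0\<close> by (simp add: field_simps)
    then have "\<bar>\<phi> t y\<bar> < e0 * \<bar>h t\<bar>" using bd[of t y] t y e(2) by (simp add: field_simps)
    moreover have "?W (t, y) / h t - Z y / k = \<phi> t y / h t"
      using h0 by (simp add: \<phi>_def diff_divide_distrib)
    ultimately show "dist (?W (t, y) / h t) (Z y / k) < e0"
      using h0 by (simp add: dist_real_def pos_divide_less_eq)
  qed
qed

text \<open>From \<open>v = a^3 * Dt u\<close> and \<open>h' = k / a^3\<close>, the derivatives of
  \<open>v\<close> and of \<open>u / h\<close> have the same limits up to the factor
  \<open>k\<close>. Smoothness of the limit is read off from \<open>v\<close>, which converges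
  together with all its spatial derivatives.\<close>

lemma cube_asymptotics:
  fixes h :: "real \<Rightarrow> real"
  assumes h: "\<And>t. 0 < t \<Longrightarrow> (h has_real_derivative k / a t ^ 3) (at t)" and k: "k \<noteq> 0"
    and h_inf: "filterlim (\<lambda>t. \<bar>h t\<bar>) at_top (at_right 0)"
  shows "\<exists>B A. open B \<and> y0 \<in> B \<and> B \<subseteq> U \<and> smooth_on A B \<and>
    (\<forall>es. uniform_limit B (\<lambda>t. dir_derivs es (\<lambda>y. u (t, y) / h t)) (dir_derivs es A) (at_right 0))"
proof -
  have "\<forall>es. \<exists>Z C. \<exists>t0>0. C \<ge> 0 \<and> (\<forall>t. 0 < t \<and> t < t0 \<longrightarrow> (\<forall>y\<in>K. \<bar>V es (t, y) - Z y\<bar> \<le> C * s t))"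
    using V_limit by blast
  then obtain Z C t0 where Z: "\<And>es. t0 es > 0" "\<And>es. C es \<ge> 0"
    "\<And>es t y. 0 < t \<Longrightarrow> t < t0 es \<Longrightarrow> y \<in> K \<Longrightarrow> \<bar>V es (t, y) - Z es y\<bar> \<le> C es * s t"
    by metis
  define B where "B = box (y0 - vec (\<rho>/8)) (y0 + vec (\<rho>/8))"
  have BK: "B \<subseteq> K" unfolding B_def K_def by (rule box_subset_cbox)
  have B: "open B" "convex B" "y0 \<in> B" "B \<subseteq> U"
    using \<rho> BK K_subset_U by (auto simp: B_def mem_box_cart)
  have V_lim: "uniform_limit B (\<lambda>t y. V es (t, y)) (Z es) (at_right 0)" for es
  proof (rule uniform_limitI)
    fix e :: real assume e: "e > 0"
    have "((\<lambda>t. C es * s t) \<longlongrightarrow> C es * 0) (at_right 0)" by (intro tendsto_intros s)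
    then have "\<forall>\<^sub>F t in at_right 0. C es * s t < e" by (rule order_tendstoD) (use e in simp)
    moreover have "\<forall>\<^sub>F t in at_right 0. 0 < t \<and> t < t0 es"
      using Z(1) unfolding eventually_at_right_field by (intro exI[of _ "t0 es"]) auto
    ultimately show "\<forall>\<^sub>F t in at_right 0. \<forall>y\<in>B. dist (V es (t, y)) (Z es y) < e"
    proof (eventually_elim, intro ballI)
      fix t y assume "C es * s t < e" "0 < t \<and> t < t0 es" "y \<in> B"
      then show "dist (V es (t, y)) (Z es y) < e"
        using Z(3)[of t es y] BK unfolding dist_real_def by auto
    qed
  qed
  \<comment> \<open>A sequence of times tending to 0 from the right, since termwise differentiation
    is stated for sequences.\<close>
  define f where "f n y = v [] (inverse (real (Suc n)), y)" for n y
  have SB: "(t, y) \<in> S" if "0 < t" "y \<in> B" for t y using that B by (auto simp: S_def)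
  have fs: "smooth_on (f n) B" for n
    unfolding f_def[abs_def] by (rule smooth_on_slice[OF open_S smooth_v]) (use SB in auto)
  have seq: "filterlim (\<lambda>n. inverse (real (Suc n))) (at_right 0) sequentially"
    unfolding filterlim_at using LIMSEQ_inverse_real_of_nat by (auto intro!: always_eventually)
  have flim: "uniform_limit B (\<lambda>n. dir_derivs es (f n)) (Z es) sequentially" for es
  proof -
    have "uniform_limit B (\<lambda>n y. V es (inverse (real (Suc n)), y)) (Z es) sequentially"
      using filterlim_compose[OF V_lim seq] .
    then show ?thesis
      by (rule uniform_limit_cong'[THEN iffD1, rotated 2])
        (auto simp: f_def[abs_def] dir_derivs_slice[OF open_S smooth_v SB])
  qed
  note Zs = uniform_limit_dir_derivs[OF B(1,2) fs flim]
  define A where "A y = inverse k * Z [] y" for y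
  have A: "smooth_on A B" unfolding A_def[abs_def] by (rule smooth_on_cmult[OF B(1) Zs(1)])
  have DA: "dir_derivs es A y = Z es y / k" if "y \<in> B" for es y
    unfolding A_def[abs_def] dir_derivs_cmult[OF B(1) Zs(1) that] Zs(2)[OF that] by (simp add: divide_inverse)
  have su: "smooth_on u S" using smooth_u by (simp add: S_def)
  have Du: "dir_derivs es (\<lambda>y. u (t, y) / h t) y = dir_derivs (map (Pair 0) es) u (t, y) / h t"
    if t: "0 < t" and y: "y \<in> B" for es t y
  proof -
    have "smooth_on (\<lambda>y. u (t, y)) B" by (rule smooth_on_slice[OF open_S su]) (use SB t in auto)
    from dir_derivs_cmult[OF B(1) this y, of es "inverse (h t)"]
    show ?thesis unfolding dir_derivs_slice[OF open_S su SB[OF t y]] by (simp add: divide_inverse mult.commute)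
  qed
  have "uniform_limit B (\<lambda>t. dir_derivs es (\<lambda>y. u (t, y) / h t)) (dir_derivs es A) (at_right 0)" for es
  proof -
    have "uniform_limit B (\<lambda>t y. dir_derivs (map (Pair 0) es) u (t, y) / h t) (\<lambda>y. Z es y / k) (at_right 0)"
      by (rule uniform_limit_on_subset[OF quotient_limit[OF h k h_inf Z] BK])
    moreover have "\<forall>\<^sub>F t in at_right (0::real). 0 < t" by (rule eventually_at_right_less)
    ultimately show ?thesis
      by (elim uniform_limit_cong[THEN iffD1, rotated 2]) (auto elim!: eventually_mono simp: DA Du)
  qed
  then show ?thesis using B A by blast
qed

end

end

section \<open>Scale factors\<close>

text \<open>The first derivative is already a smooth expression in \<open>a\<close>. Meant for
  \<open>psi_hom\<close>, whose smoothness passes to the remainder of the decomposition.\<close>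

lemma smooth_on_primitive:
  fixes h :: "real \<Rightarrow> real"
  assumes "\<And>t. 0 < t \<Longrightarrow> (h has_real_derivative k / a t ^ 3) (at t)"
    and a: "smooth_on a {0<..}" "\<And>t. 0 < t \<Longrightarrow> 0 < a t"
  shows "smooth_on h {0<..}"
proof (rule smooth_on_of_ddir)
  have d: "(h has_derivative (*) (k / a t ^ 3)) (at t)" if "t \<in> {0<..}" for t
    using assms(1) that by (simp add: has_field_derivative_def)
  then show "h differentiable (at t)" if "t \<in> {0<..}" for t using that differentiable_def by blast
  fix v
  have "smooth_on (\<lambda>t. k * v / a t ^ 3) {0<..}"
    using a(1) by (intro smooth_on_divide smooth_on_const smooth_on_power) (auto dest: a(2))
  then show "smooth_on (ddir v h) {0<..}"
    by (rule smooth_on_cong[rotated 2]) (simp_all add: ddir_eqI[OF d])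
qed

text \<open>\<open>c^2\<close> stands for \<open>8 * pi * B / 3\<close>. With the root as parameter,
  \<open>c * a powr (- p)\<close> is the expansion rate in type 0 and a lower bound for it in type
  -1.\<close>

locale friedman =
  fixes \<kappa> \<gamma> c :: real and a :: "real \<Rightarrow> real"
  assumes \<gamma>: "2/3 < \<gamma>" "\<gamma> \<le> 2" and \<kappa>: "\<kappa> = 0 \<or> \<kappa> = -1" and c: "0 < c"
    and cont: "continuous_on {0..} a" and a0: "a 0 = 0" and pos: "0 < t \<Longrightarrow> 0 < a t"
    and deriv_a: "0 < t \<Longrightarrow> (a has_real_derivative sqrt (c\<^sup>2 * a t powr (2 - 3 * \<gamma>) - \<kappa>)) (at t)"
begin

definition a' where "a' t = sqrt (c\<^sup>2 * a t powr (2 - 3 * \<gamma>) - \<kappa>)"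

definition p where "p = 3 * \<gamma> / 2 - 1"

text \<open>In type 0 this is the conformal time, the integral of \<open>1 / a\<close> from the
  singularity; in type -1 it grows faster. Being an expression in \<open>a\<close> alone, it
  inherits its limit at 0 from that of \<open>a\<close>.\<close>

definition s where "s t = a t powr p / (p * c)"

definition s' where "s' t = a t powr (p - 1) * a' t / c"

lemma p_pos: "0 < p" using \<gamma> by (simp add: p_def)

lemma a'_ge: "0 < t \<Longrightarrow> c * a t powr (- p) \<le> a' t"
proof -
  have "(c * a t powr (- p))\<^sup>2 = c\<^sup>2 * a t powr (2 - 3 * \<gamma>)"
    by (simp add: power_mult_distrib p_def power2_eq_square algebra_simps flip: powr_add)
  then show ?thesis unfolding a'_def using \<kappa> by (intro real_le_rsqrt) auto
qed

lemma a'_nonneg: "0 < t \<Longrightarrow> 0 \<le> a' t"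
  using a'_ge[of t] c by (smt (verit) mult_nonneg_nonneg powr_ge_zero)

lemma s_deriv: "0 < t \<Longrightarrow> (s has_real_derivative s' t) (at t)"
  unfolding s_def[abs_def] s'_def
  using DERIV_cdivide[OF DERIV_fun_powr[OF deriv_a[folded a'_def] pos, of t p], of "p * c"] p_pos
  by simp

lemma s'_ge: "0 < t \<Longrightarrow> 1 / a t \<le> s' t"
proof -
  assume t: "0 < t"
  have "a t powr (p - 1) * (c * a t powr (- p)) \<le> a t powr (p - 1) * a' t"
    by (intro mult_left_mono a'_ge t) simp
  moreover have "a t powr (p - 1) * a t powr (- p) = 1 / a t"
    unfolding powr_add[symmetric] using pos[OF t] by (simp add: powr_minus_divide)
  ultimately show ?thesis using c unfolding s'_def by (simp add: field_simps)
qed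

lemma cont_pos: "continuous_on {0<..} a"
  by (rule continuous_on_subset[OF cont]) auto

lemma s'_cont: "continuous_on {0<..} s'"
  unfolding s'_def a'_def
  by (intro continuous_intros continuous_on_powr cont_pos) (use c pos in \<open>auto simp: less_imp_neq[THEN not_sym]\<close>)

lemma a_lim: "(a \<longlongrightarrow> 0) (at_right 0)"
proof -
  have "(a \<longlongrightarrow> a 0) (at 0 within {0..})" using cont by (simp add: continuous_on)
  then show ?thesis unfolding a0 by (rule tendsto_within_subset) auto
qed

lemma s_lim: "(s \<longlongrightarrow> 0) (at_right 0)"
proof -
  have "((\<lambda>t. a t powr p) \<longlongrightarrow> 0 powr p) (at_right 0)"
    using p_pos pos by (intro tendsto_powr' a_lim tendsto_const)
      (auto simp: eventually_at_filter intro!: always_eventually less_imp_le)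
  from tendsto_divide[OF this tendsto_const, of "p * c"] show ?thesis
    unfolding s_def[abs_def] using p_pos c by simp
qed

lemma s_pos: "0 < t \<Longrightarrow> 0 < s t"
  unfolding s_def using p_pos c pos[of t] by (simp add: less_imp_neq[THEN not_sym])

text \<open>In type 0 the function \<open>a powr (3 * \<gamma> / 2)\<close> has the constant
  derivative \<open>3 * \<gamma> / 2 * c\<close> and vanishes at 0. The scale factor is not
  normalised, so a constant remains.\<close>

lemma flat_power:
  assumes "\<kappa> = 0" "0 < t"
  shows "a t ^ 3 = (3 * \<gamma> / 2 * c) powr (2 / \<gamma>) * t powr (2 / \<gamma>)"
proof -
  let ?d = "3 * \<gamma> / 2 * c"
  let ?f = "\<lambda>t. a t powr (3 * \<gamma> / 2) - ?d * t"
  have "?f t = ?f 0"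
  proof (rule DERIV_isconst_end[OF assms(2)])
    have "a x \<ge> 0" if "x \<in> {0..t}" for x using that pos[of x] a0 by (cases "x = 0") auto
    then show "continuous_on {0..t} ?f"
      using \<gamma> by (intro continuous_intros continuous_on_powr' continuous_on_subset[OF cont]) auto
    fix x assume x: "0 < x" "x < t"
    have "a' x = c * a x powr (- p)"
    proof -
      have "c\<^sup>2 * a x powr (2 - 3 * \<gamma>) = (c * a x powr (- p))\<^sup>2"
        by (simp add: power_mult_distrib p_def power2_eq_square algebra_simps flip: powr_add)
      then show ?thesis unfolding a'_def using assms(1) c by simp
    qed
    moreover have "a x powr (3 * \<gamma> / 2 - 1) * a x powr (- p) = 1"
      using pos[OF x(1)] by (simp add: p_def flip: powr_add)
    ultimately have eq: "3 * \<gamma> / 2 * a x powr (3 * \<gamma> / 2 - 1) * a' x = ?d" by (simp add: algebra_simps)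
    show "(?f has_real_derivative 0) (at x)"
      by (rule DERIV_cong[OF DERIV_diff[OF DERIV_fun_powr[OF deriv_a[OF x(1), folded a'_def] pos[OF x(1)]]
              DERIV_cmult[OF DERIV_ident, of ?d]]])
        (simp only: of_nat_1 mult_1_right eq diff_self)
  qed
  then have f: "a t powr (3 * \<gamma> / 2) = ?d * t" using a0 by simp
  have "a t ^ 3 = a t powr (3 * \<gamma> / 2 * (2 / \<gamma>))" using pos[OF assms(2)] \<gamma> by (simp flip: powr_numeral)
  also have "\<dots> = (?d * t) powr (2 / \<gamma>)" unfolding powr_powr[symmetric] f ..
  also have "\<dots> = ?d powr (2 / \<gamma>) * t powr (2 / \<gamma>)"
    by (rule powr_mult)
  finally show ?thesis .
qed

section \<open>The homogeneous solution in type -1\<close>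

lemma open_case_bounds:
  assumes "\<kappa> = -1" "0 \<le> t"
  shows "t \<le> a t"
proof (cases "t = 0")
  case False
  then have t: "0 < t" using assms by simp
  have "\<exists>l z. 0 < z \<and> z < t \<and> (a has_real_derivative l) (at z) \<and> a t - a 0 = (t - 0) * l"
    by (rule MVT[OF t continuous_on_subset[OF cont]])
      (use deriv_a real_differentiable_def in auto)
  then obtain l z where z: "0 < z" "(a has_real_derivative l) (at z)" "a t = t * l" using a0 by auto
  have "l = sqrt (c\<^sup>2 * a z powr (2 - 3 * \<gamma>) + 1)"
    using DERIV_unique[OF z(2) deriv_a[OF z(1)]] assms by simp
  then have "1 \<le> l" by simp
  then show ?thesis using z(3) t mult_left_mono[of 1 l t] by simp
qed (use a0 in simp)

text \<open>Comparison with \<open>s powr (-3)\<close>, by the bound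
  \<open>s \<le> a s\<close>.\<close>

lemma open_case_integrable:
  assumes "\<kappa> = -1" "0 < t"
  shows "(\<lambda>s. 1 / a s ^ 3) integrable_on {t..}"
proof (rule measurable_bounded_by_integrable_imp_integrable)
  have "continuous_on {t..} (\<lambda>s. 1 / a s ^ 3)"
    using pos assms by (intro continuous_intros continuous_on_subset[OF cont]) (auto simp: less_imp_neq[THEN not_sym])
  then show "(\<lambda>s. 1 / a s ^ 3) \<in> borel_measurable (lebesgue_on {t..})"
    by (rule continuous_imp_measurable_on_sets_lebesgue) simp
  show "(\<lambda>s. s powr (-3)) integrable_on {t..}"
    by (rule has_integral_integrable[OF has_integral_powr_to_inf]) (use assms in auto)
  fix x assume "x \<in> {t..}"
  then have x: "0 < x" "x \<le> a x" using assms open_case_bounds[of x] by auto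
  then have "1 / a x ^ 3 \<le> 1 / x ^ 3" by (intro divide_left_mono power_mono) auto
  then show "norm (1 / a x ^ 3) \<le> x powr (-3)" using x by (simp add: powr_minus powr_numeral divide_inverse)
qed simp

lemma open_case_deriv:
  assumes "\<kappa> = -1" "0 < t"
  shows "((\<lambda>t. integral {t..} (\<lambda>s. 1 / a s ^ 3)) has_real_derivative - 1 / a t ^ 3) (at t)"
proof -
  let ?f = "\<lambda>s. 1 / a s ^ 3" and ?l = "t / 2"
  \<comment> \<open>A base point to the left of \<open>x\<close> turns the improper integral into a
    constant minus a proper one, which the fundamental theorem differentiates.\<close>
  have eq: "integral {x..} ?f = integral {?l..} ?f - integral {?l..x} ?f" if x: "x \<in> {?l<..<t + 1}" for x
  proof -
    have i: "?f integrable_on {?l..x}" "?f integrable_on {x..}"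
      using integrable_on_subinterval[OF open_case_integrable[OF assms(1), of ?l], of ?l x]
        open_case_integrable[OF assms(1), of x] x assms by auto
    have "{?l..x} \<inter> {x..} = {x}" using x by auto
    from has_integral_Un[OF integrable_integral[OF i(1)] integrable_integral[OF i(2)]] this
    have "(?f has_integral integral {?l..x} ?f + integral {x..} ?f) ({?l..x} \<union> {x..})" by simp
    moreover have "{?l..x} \<union> {x..} = {?l..}" using x by auto
    ultimately show ?thesis by (simp add: integral_unique)
  qed
  have c: "continuous_on {?l..t+1} ?f"
    using pos assms by (intro continuous_intros continuous_on_subset[OF cont]) (auto simp: less_imp_neq[THEN not_sym])
  have "((\<lambda>x. integral {?l..x} ?f) has_real_derivative ?f t) (at t within {?l..t+1})"
    by (rule integral_has_real_derivative[OF c]) (use assms in auto)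
  then have "((\<lambda>x. integral {?l..x} ?f) has_real_derivative ?f t) (at t)"
    using at_within_interior[of t "{?l..t+1}"] assms by (simp add: interior_atLeastAtMost_real)
  from DERIV_diff[OF DERIV_const this, of "integral {?l..} ?f"]
  have "((\<lambda>x. integral {?l..} ?f - integral {?l..x} ?f) has_real_derivative - 1 / a t ^ 3) (at t)" by simp
  then show ?thesis
    by (rule has_field_derivative_transform_within_open[of _ _ _ "{?l<..<t + 1}"]) (use assms eq in auto)
qed

text \<open>Near the singularity \<open>a' \<le> L a\<^sup>-\<^sup>2\<close>, so that the integral of \<open>a\<^sup>-\<^sup>3\<close> dominates a multiple of
  \<open>- ln a\<close>.\<close>

lemma open_case_at_top:
  assumes \<kappa>: "\<kappa> = -1"
  shows "filterlim (\<lambda>t. integral {t..} (\<lambda>s. 1 / a s ^ 3)) at_top (at_right 0)"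
proof -
  let ?h = "\<lambda>t. integral {t..} (\<lambda>s. 1 / a s ^ 3)"
  \<comment> \<open>Where \<open>a t < 1\<close>, both \<open>a t powr (2 - 3 * \<gamma>)\<close>,
    because of \<open>\<gamma> \<le> 2\<close>, and the curvature term 1 are at most
    \<open>1 / a t ^ 4\<close>; their coefficients \<open>c^2\<close> and 1 add up to
    \<open>L^2\<close>.\<close>
  define L where "L = sqrt (c\<^sup>2 + 1)"
  have L: "0 < L" using c by (simp add: L_def add_pos_pos)
  have "\<forall>\<^sub>F t in at_right 0. a t < 1" by (rule order_tendstoD[OF a_lim]) simp
  then obtain t1 where t1: "0 < t1" "\<And>t. 0 < t \<Longrightarrow> t < t1 \<Longrightarrow> a t < 1"
    unfolding eventually_at_right_field by auto
  define t2 where "t2 = t1 / 2"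
  have t2: "0 < t2" "\<And>t. 0 < t \<Longrightarrow> t \<le> t2 \<Longrightarrow> a t < 1" using t1 by (auto simp: t2_def)
  have le: "a' t / a t \<le> L * (1 / a t ^ 3)" if t: "0 < t" "t \<le> t2" for t
  proof -
    have a: "0 < a t" "a t \<le> 1" using pos[OF t(1)] t2(2)[OF t] by auto
    have "a' t \<le> sqrt (L\<^sup>2 * (1 / (a t)\<^sup>2)\<^sup>2)"
      unfolding a'_def
    proof (rule real_sqrt_le_mono)
      have "a t powr (2 - 3 * \<gamma>) \<le> a t powr (- 4)" using a \<gamma> by (intro powr_mono') auto
      also have "a t powr (- 4) = (1 / (a t)\<^sup>2)\<^sup>2"
        using a by (simp add: powr_minus_divide power_divide)
      finally have 1: "a t powr (2 - 3 * \<gamma>) \<le> (1 / (a t)\<^sup>2)\<^sup>2" .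
      have "(a t)\<^sup>2 \<le> 1" using a by (simp add: power_le_one)
      then have 2: "1 \<le> (1 / (a t)\<^sup>2)\<^sup>2" using a by (simp add: one_le_power)
      have "c\<^sup>2 * a t powr (2 - 3 * \<gamma>) + 1 \<le> c\<^sup>2 * (1 / (a t)\<^sup>2)\<^sup>2 + (1 / (a t)\<^sup>2)\<^sup>2"
        by (intro add_mono mult_left_mono 1 2) simp
      also have "\<dots> = L\<^sup>2 * (1 / (a t)\<^sup>2)\<^sup>2" by (simp add: L_def distrib_right)
      finally show "c\<^sup>2 * a t powr (2 - 3 * \<gamma>) - \<kappa> \<le> L\<^sup>2 * (1 / (a t)\<^sup>2)\<^sup>2" using \<kappa> by simp
    qed
    also have "\<dots> = L * (1 / (a t)\<^sup>2)" using L a by (simp add: real_sqrt_mult)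
    finally have "a' t / a t \<le> L * (1 / (a t)\<^sup>2) / a t" using a by (intro divide_right_mono) auto
    then show ?thesis by (simp add: power3_eq_cube power2_eq_square)
  qed
  \<comment> \<open>By \<open>le\<close> the function \<open>L * ?h t + ln (a t)\<close> is
    nonincreasing on \<open>(0, t2]\<close>, and \<open>k\<close> is its value at
    \<open>t2\<close>.\<close>
  define k where "k = L * ?h t2 + ln (a t2)"
  have "k / L + 1 / L * - ln (a t) \<le> ?h t" if t: "0 < t" "t \<le> t2" for t
  proof -
    have "L * ?h t2 + ln (a t2) \<le> L * ?h t + ln (a t)"
    proof (rule DERIV_nonpos_imp_nonincreasing[OF t(2)])
      fix x assume x: "t \<le> x" "x \<le> t2"
      have x0: "0 < x" using x t by simp
      have "((\<lambda>t. L * ?h t + ln (a t)) has_real_derivative L * (- 1 / a x ^ 3) + 1 / a x * a' x) (at x)"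
        by (intro DERIV_add DERIV_cmult open_case_deriv[OF \<kappa> x0]
            DERIV_chain2[OF DERIV_ln_divide[OF pos[OF x0]] deriv_a[OF x0, folded a'_def]])
      then show "\<exists>d. ((\<lambda>t. L * ?h t + ln (a t)) has_real_derivative d) (at x) \<and> d \<le> 0"
        using le[OF x0 x(2)] by (intro exI[of _ "L * (- 1 / a x ^ 3) + 1 / a x * a' x"]) simp
    qed
    then have "(k - ln (a t)) / L \<le> ?h t" using L by (simp add: k_def pos_divide_le_eq mult.commute)
    then show ?thesis by (simp add: diff_divide_distrib)
  qed
  then have ev: "\<forall>\<^sub>F t in at_right 0. k / L + 1 / L * - ln (a t) \<le> ?h t"
    using t2(1) unfolding eventually_at_right_field by (intro exI[of _ t2]) auto
  have "filterlim a (at_right 0) (at_right 0)"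
    unfolding filterlim_at using a_lim by (auto simp: eventually_at_filter dest: pos intro!: always_eventually)
  then have "filterlim (\<lambda>t. ln (a t)) at_bot (at_right 0)" by (rule filterlim_compose[OF ln_at_0])
  then have "filterlim (\<lambda>t. 1 / L * - ln (a t)) at_top (at_right 0)"
    using L by (intro filterlim_tendsto_pos_mult_at_top[OF tendsto_const]) (auto simp: filterlim_uminus_at_bot)
  then have "filterlim (\<lambda>t. k / L + 1 / L * - ln (a t)) at_top (at_right 0)"
    by (rule filterlim_tendsto_add_at_top[OF tendsto_const])
  then show ?thesis using ev by (rule filterlim_at_top_mono)
qed

text \<open>The facts about \<open>psi_hom\<close> on which the asymptotics rest, so that the three
  cases merge here. The absolute value accommodates \<open>ln\<close>, which tends to minus
  infinity.\<close>

lemma psi_hom_asymptotics: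
  obtains k where "k \<noteq> 0" "\<And>t. 0 < t \<Longrightarrow> (psi_hom \<kappa> \<gamma> a has_real_derivative k / a t ^ 3) (at t)"
    "filterlim (\<lambda>t. \<bar>psi_hom \<kappa> \<gamma> a t\<bar>) at_top (at_right 0)"
proof (cases "\<kappa> = 0")
  case True
  \<comment> \<open>The ratio of \<open>a t ^ 3\<close> to \<open>t powr (2 / \<gamma>)\<close>. It
    enters \<open>k\<close> because \<open>psi_hom\<close> is written in powers of \<open>t\<close>,
    as for the normalised scale factor.\<close>
  let ?D = "(3 * \<gamma> / 2 * c) powr (2 / \<gamma>)"
  have D: "?D > 0" using \<gamma> c by simp
  show ?thesis
  proof (cases "\<gamma> < 2")
    case g: True
    have h: "psi_hom \<kappa> \<gamma> a = (\<lambda>t. t powr (1 - 2 / \<gamma>))" using True g by (simp add: psi_hom_def[abs_def])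
    show ?thesis
    proof (rule that[of "(1 - 2 / \<gamma>) * ?D"])
      show "(1 - 2 / \<gamma>) * ?D \<noteq> 0" using D g \<gamma> by (simp add: field_simps)
      show "(psi_hom \<kappa> \<gamma> a has_real_derivative (1 - 2 / \<gamma>) * ?D / a t ^ 3) (at t)" if t: "0 < t" for t
      proof -
        have "(1 - 2 / \<gamma>) * ?D / a t ^ 3 = (1 - 2 / \<gamma>) * t powr (1 - 2 / \<gamma> - 1)"
        proof -
          have "x * D / (D * T) = x * (1 / T)" if "D \<noteq> 0" for x D T :: real using that by simp
          moreover have "t powr (1 - 2 / \<gamma> - 1) = 1 / t powr (2 / \<gamma>)" by (simp add: powr_minus_divide)
          ultimately show ?thesis unfolding flat_power[OF True t] using D by (metis less_irrefl)
        qed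
        then show ?thesis unfolding h using has_real_derivative_powr[OF t, of "1 - 2 / \<gamma>"] by simp
      qed
      have "filterlim (\<lambda>t::real. - ln t) at_top (at_right 0)"
        using ln_at_0 by (simp add: filterlim_uminus_at_bot)
      moreover have "0 < 2 / \<gamma> - 1" using g \<gamma> by (simp add: field_simps)
      ultimately have "filterlim (\<lambda>t. (2 / \<gamma> - 1) * - ln t) at_top (at_right 0)"
        by (intro filterlim_tendsto_pos_mult_at_top[OF tendsto_const])
      then have "filterlim (\<lambda>t. exp ((2 / \<gamma> - 1) * - ln t)) at_top (at_right 0)"
        by (rule filterlim_compose[OF exp_at_top])
      moreover have "\<forall>\<^sub>F t in at_right 0. exp ((2 / \<gamma> - 1) * - ln t) = \<bar>psi_hom \<kappa> \<gamma> a t\<bar>"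
        unfolding h eventually_at_filter by (auto simp: powr_def algebra_simps intro!: always_eventually)
      ultimately show "filterlim (\<lambda>t. \<bar>psi_hom \<kappa> \<gamma> a t\<bar>) at_top (at_right 0)"
        by (simp add: filterlim_cong[OF refl refl])
    qed
  next
    case g: False
    then have g2: "\<gamma> = 2" using \<gamma> by simp
    have h: "psi_hom \<kappa> \<gamma> a = ln" using True g by (simp add: psi_hom_def[abs_def])
    show ?thesis
    proof (rule that[of ?D])
      show "(psi_hom \<kappa> \<gamma> a has_real_derivative ?D / a t ^ 3) (at t)" if t: "0 < t" for t
        unfolding h flat_power[OF True t] using DERIV_ln_divide[OF t] D t g2 by simp
      show "filterlim (\<lambda>t. \<bar>psi_hom \<kappa> \<gamma> a t\<bar>) at_top (at_right 0)"
        unfolding h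
      proof (rule filterlim_at_top_mono[OF _ always_eventually])
        show "filterlim (\<lambda>t::real. - ln t) at_top (at_right 0)"
          using ln_at_0 by (simp add: filterlim_uminus_at_bot)
      qed auto
    qed (use D in simp)
  qed
next
  case False
  then have \<kappa>: "\<kappa> = -1" using \<kappa> by simp
  have h: "psi_hom \<kappa> \<gamma> a = (\<lambda>t. integral {t..} (\<lambda>s. 1 / a s ^ 3))" using False by (simp add: psi_hom_def[abs_def])
  show ?thesis
  proof (rule that[of "-1"])
    show "(psi_hom \<kappa> \<gamma> a has_real_derivative -1 / a t ^ 3) (at t)" if "0 < t" for t
      unfolding h by (rule open_case_deriv[OF \<kappa> that])
    show "filterlim (\<lambda>t. \<bar>psi_hom \<kappa> \<gamma> a t\<bar>) at_top (at_right 0)"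
      unfolding h by (rule filterlim_at_top_mono[OF open_case_at_top[OF \<kappa>]]) (auto intro: always_eventually)
  qed simp
qed

end

section \<open>Charts and the asymptotics\<close>

lemma matrix_inv_mult:
  fixes A :: "real^'n^'n"
  assumes "det A \<noteq> 0"
  shows "A ** matrix_inv A = mat 1" "matrix_inv A ** A = mat 1"
proof -
  have "\<exists>B. A ** B = mat 1 \<and> B ** A = mat 1"
    using assms unfolding invertible_det_nz[symmetric] invertible_def .
  from someI_ex[OF this] show "A ** matrix_inv A = mat 1" "matrix_inv A ** A = mat 1"
    unfolding matrix_inv_def by auto
qed

text \<open>Cramer's rule presents the entries of the inverse as quotients of polynomials in the
  entries of \<open>A\<close>, from which their smoothness follows.\<close>

lemma matrix_inv_cramer:
  fixes A :: "real^'n^'n"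
  assumes "det A \<noteq> 0"
  shows "matrix_inv A $ i $ j = det (\<chi> r q. if q = i then axis j 1 $ r else A $ r $ q) / det A"
proof -
  have "A *v (matrix_inv A *v axis j 1) = axis j 1"
    by (simp add: matrix_vector_mul_assoc matrix_inv_mult[OF assms])
  then have "matrix_inv A *v axis j 1 = (\<chi> k. det (\<chi> r q. if q = k then axis j 1 $ r else A $ r $ q) / det A)"
    unfolding cramer[OF assms] .
  then have "(matrix_inv A *v axis j 1) $ i = det (\<chi> r q. if q = i then axis j 1 $ r else A $ r $ q) / det A"
    by simp
  then show ?thesis by (simp add: matrix_vector_mul_component inner_axis)
qed

lemma smooth_on_det3:
  fixes A :: "'a::euclidean_space \<Rightarrow> 3 \<Rightarrow> 3 \<Rightarrow> real"
  assumes "open U" "\<And>i j. smooth_on (\<lambda>y. A y i j) U"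
  shows "smooth_on (\<lambda>y. det (\<chi> i j. A y i j)) U"
  unfolding det_3 vec_lambda_beta
  by (intro smooth_on_add smooth_on_diff smooth_on_mult assms)

context
  fixes A :: "real^'n^'n"
  assumes sym: "transpose A = A" and pos: "\<And>v. v \<noteq> 0 \<Longrightarrow> v \<bullet> (A *v v) > 0"
begin

lemma posdef_det: "det A \<noteq> 0"
proof -
  have "A *v v \<noteq> 0" if "v \<noteq> 0" for v using pos[OF that] by auto
  then show ?thesis
    unfolding invertible_det_nz[symmetric] invertible_left_inverse matrix_left_invertible_ker by blast
qed

lemma posdef_inv_sym: "matrix_inv A $ i $ j = matrix_inv A $ j $ i"
proof -
  let ?B = "matrix_inv A"
  have "A ** transpose ?B = mat 1"
    using matrix_inv_mult(2)[OF posdef_det] sym by (metis matrix_transpose_mul transpose_mat)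
  then have "?B ** (A ** transpose ?B) = ?B" by simp
  then have "transpose ?B = ?B"
    by (simp add: matrix_mul_assoc matrix_inv_mult[OF posdef_det])
  then show ?thesis by (metis transpose_def vec_lambda_beta)
qed

text \<open>With \<open>x\<close> the inverse applied to \<open>z\<close>, the form equals
  \<open>x \<bullet> (A *v x)\<close>.\<close>

lemma posdef_inv_pos:
  assumes "z \<noteq> 0"
  shows "0 < (\<Sum>i\<in>UNIV. \<Sum>j\<in>UNIV. matrix_inv A $ i $ j * z $ i * z $ j)"
proof -
  let ?x = "matrix_inv A *v z"
  have z: "A *v ?x = z" by (simp add: matrix_vector_mul_assoc matrix_inv_mult[OF posdef_det])
  then have "?x \<noteq> 0" using assms by auto
  from pos[OF this] have "0 < ?x \<bullet> z" by (simp only: z)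
  also have "?x \<bullet> z = (\<Sum>i\<in>UNIV. \<Sum>j\<in>UNIV. matrix_inv A $ i $ j * z $ i * z $ j)"
    by (simp add: inner_vec_def matrix_vector_mult_def sum_distrib_left sum_distrib_right mult_ac)
  finally show ?thesis .
qed

end

section \<open>From charts to the manifold\<close>

lemma uniform_limit_compact_local:
  assumes "compact K" and "\<And>x. x \<in> K \<Longrightarrow> \<exists>B. open B \<and> x \<in> B \<and> uniform_limit B f l F"
  shows "uniform_limit K f l F"
proof -
  let ?C = "{B. open B \<and> uniform_limit B f l F}"
  have C: "K \<subseteq> \<Union>?C" using assms(2) by blast
  obtain D where D: "D \<subseteq> ?C" "finite D" "K \<subseteq> \<Union>D"
    by (rule compactE[OF assms(1) C]) (simp, rule that)
  show ?thesis
    by (rule uniform_limit_on_subset[OF uniform_limit_on_Union[OF D(2)] D(3)]) (use D(1) in auto)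
qed

lemma open_contains_cube:
  fixes U :: "(real^'n) set"
  assumes "open U" "y0 \<in> U"
  obtains \<rho> where "0 < \<rho>" "cbox (y0 - vec \<rho>) (y0 + vec \<rho>) \<subseteq> U"
proof -
  obtain e where e: "e > 0" "cball y0 e \<subseteq> U" using assms unfolding open_contains_cball by blast
  let ?\<rho> = "e / CARD('n)"
  have "cbox (y0 - vec ?\<rho>) (y0 + vec ?\<rho>) \<subseteq> cball y0 e"
  proof
    fix y assume "y \<in> cbox (y0 - vec ?\<rho>) (y0 + vec ?\<rho>)"
    then have "\<bar>(y - y0) $ i\<bar> \<le> ?\<rho>" for i unfolding mem_cube by blast
    then have "(\<Sum>i\<in>UNIV. \<bar>(y - y0) $ i\<bar>) \<le> (\<Sum>i\<in>(UNIV::'n set). ?\<rho>)" by (intro sum_mono)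
    then have "norm (y - y0) \<le> e" using norm_le_l1_cart[of "y - y0"] by simp
    then show "y \<in> cball y0 e" by (simp add: dist_norm norm_minus_commute)
  qed
  then show ?thesis using that[of ?\<rho>] e by auto
qed

lemma is_chartD:
  assumes "is_chart c"
  shows "open (chart_dom c)" "open (chart_image c)" "continuous_on (chart_dom c) (chart_map c)"
    "x \<in> chart_dom c \<Longrightarrow> chart_map c x \<in> chart_image c"
    "x \<in> chart_dom c \<Longrightarrow> chart_inv c (chart_map c x) = x"
    "y \<in> chart_image c \<Longrightarrow> chart_inv c y \<in> chart_dom c"
    "y \<in> chart_image c \<Longrightarrow> chart_map c (chart_inv c y) = y"
  using assms unfolding is_chart_def homeomorphism_def by auto

text \<open>\<open>chart_inv\<close> of a product chart is a choice function. Injectivity identifies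
  it on the chart image with the identity in time and \<open>chart_inv c\<close> in space, and
  smoothness on an open set depends only on the values there.\<close>

lemma smooth_fun_cylinder_atlas:
  assumes "\<forall>c\<in>\<A>. is_chart c"
  shows "smooth_fun (cylinder_atlas \<A>) F \<longleftrightarrow>
    (\<forall>c\<in>\<A>. smooth_on (\<lambda>p. F (fst p, chart_inv c (snd p))) ({0<..} \<times> chart_image c))"
proof -
  have "smooth_on (F \<circ> chart_inv c') (chart_image c') \<longleftrightarrow>
      smooth_on (\<lambda>p. F (fst p, chart_inv c (snd p))) ({0<..} \<times> chart_image c)"
    if c: "c \<in> \<A>" and c': "c' = ({0<..} \<times> chart_dom c, \<lambda>(t, p). (t, chart_map c p))" for c c'
  proof -
    note ch = is_chartD[OF assms[rule_format, OF c]]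
    let ?c = "({0::real<..} \<times> chart_dom c, \<lambda>(t, p). (t, chart_map c p))"
    have im: "chart_image c' = {0<..} \<times> chart_image c"
      unfolding c' chart_image_def by (auto simp: image_iff)
    have inj: "inj_on (\<lambda>(t, p). (t, chart_map c p)) ({0::real<..} \<times> chart_dom c)"
      by (auto intro!: inj_onI) (metis ch(5))
    have inv: "chart_inv c' (t, y) = (t, chart_inv c y)" if "t > 0" "y \<in> chart_image c" for t y
      unfolding c' chart_inv_def[of ?c] fst_conv snd_conv
      by (rule inv_into_f_eq[OF inj]) (use that ch in auto)
    have op: "open ({0::real<..} \<times> chart_image c)" using ch(2) by (intro open_Times) auto
    show ?thesis unfolding im
      by (intro iffI; erule smooth_on_cong[OF op, rotated]) (auto simp: inv)
  qed
  then show ?thesis unfolding smooth_fun_def cylinder_atlas_def by auto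
qed

lemma pderiv_coord_eq: "pderiv_coord i f = ddir (axis i 1) f"
  by (simp add: pderiv_coord_def ddir_def fun_eq_iff)

text \<open>In coordinates the Laplacian has the inverse metric as principal part and the contracted
  Christoffel symbols, with a minus sign, as first order coefficients. This makes the coordinate
  expression of \<open>\<psi>\<close> an instance of \<open>local_wave\<close>.\<close>

lemma (in friedman) chart_asymptotics:
  fixes g :: "('m::{t2_space,second_countable_topology}, real^3) chart \<Rightarrow> 'm \<Rightarrow> real^3^3"
  assumes chart: "is_chart c1" and c1: "c1 \<in> \<A>"
    and metric: "riemannian_metric \<A> g"
    and smooth_a: "smooth_on a {0<..}"
    and smooth_\<psi>: "smooth_on (\<lambda>p. \<psi> (fst p, chart_inv c1 (snd p))) ({0<..} \<times> chart_image c1)"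
    and wave: "solves_wave_equation \<A> g a \<psi>"
    and y0: "y0 \<in> chart_image c1"
  shows "\<exists>B A. open B \<and> y0 \<in> B \<and> B \<subseteq> chart_image c1 \<and> smooth_on A B \<and>
    (\<forall>es. uniform_limit B (\<lambda>t. dir_derivs es (\<lambda>y. \<psi> (t, chart_inv c1 y) / psi_hom \<kappa> \<gamma> a t))
      (dir_derivs es A) (at_right 0))"
proof -
  note ch = is_chartD[OF chart]
  let ?ci = "chart_inv c1" and ?U = "chart_image c1"
  let ?u = "\<lambda>p. \<psi> (fst p, ?ci (snd p))"
  let ?S = "{0::real<..} \<times> ?U"
  have oS: "open ?S" using ch(2) by (intro open_Times) auto
  define G where "G y = g c1 (?ci y)" for y
  define H where "H i j y = matrix_inv (G y) $ i $ j" for i j y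
  define b where "b k y = - (\<Sum>i\<in>UNIV. \<Sum>j\<in>UNIV. H i j y * christoffel G k i j y)" for k y
  have sG: "smooth_on G ?U"
    using metric c1 unfolding riemannian_metric_def G_def[abs_def] o_def by blast
  have G: "transpose (G y) = G y" "\<And>z. z \<noteq> 0 \<Longrightarrow> z \<bullet> (G y *v z) > 0" if "y \<in> ?U" for y
    using metric c1 ch(6)[OF that] unfolding riemannian_metric_def G_def by blast+
  have sGij: "smooth_on (\<lambda>y. G y $ i $ j) ?U" for i j
    using smooth_on_bounded_linear[OF bounded_linear_compose[OF bounded_linear_vec_nth bounded_linear_vec_nth] sG ch(2)] .
  have dG: "det (G y) \<noteq> 0" if "y \<in> ?U" for y by (rule posdef_det[OF G[OF that]])
  have sH: "smooth_on (H i j) ?U" for i j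
  proof (rule smooth_on_cong[OF ch(2)])
    show "det (\<chi> r q. if q = i then axis j 1 $ r else G y $ r $ q) / det (\<chi> r q. G y $ r $ q) = H i j y"
      if "y \<in> ?U" for y
      unfolding H_def matrix_inv_cramer[OF dG[OF that]] by simp
    show "smooth_on (\<lambda>y. det (\<chi> r q. if q = i then axis j 1 $ r else G y $ r $ q) / det (\<chi> r q. G y $ r $ q)) ?U"
    proof (intro smooth_on_divide smooth_on_det3 ch(2) sGij)
      show "smooth_on (\<lambda>y. if q = i then axis j 1 $ r else G y $ r $ q) ?U" for r q
        by (cases "q = i") (auto intro: smooth_on_const sGij ch(2))
    qed (use dG in auto)
  qed
  have sb: "smooth_on (b k) ?U" for k
  proof -
    have sc: "smooth_on (christoffel G k i j) ?U" for k i j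
      unfolding christoffel_def[abs_def] pderiv_coord_eq H_def[symmetric]
      by (intro smooth_on_mult smooth_on_const smooth_on_sum smooth_on_add smooth_on_diff smooth_on_ddir sGij sH ch(2))
    have "smooth_on (\<lambda>y. (-1) * (\<Sum>i\<in>UNIV. \<Sum>j\<in>UNIV. H i j y * christoffel G k i j y)) ?U"
      by (intro smooth_on_mult smooth_on_const smooth_on_sum sH sc ch(2))
    then show ?thesis unfolding b_def[abs_def] by simp
  qed
  have eq: "Dt (Dt ?u) (t, y) =
      ((\<Sum>i\<in>UNIV. \<Sum>j\<in>UNIV. H i j y * Dx i (Dx j ?u) (t, y)) + (\<Sum>k\<in>UNIV. b k y * Dx k ?u (t, y))) / (a t)\<^sup>2
        - 3 * (a' t / a t) * Dt ?u (t, y)" if t: "0 < t" and y: "y \<in> ?U" for t y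
  proof -
    have p: "(t, y) \<in> ?S" using t y by simp
    let ?x = "?ci y"
    have d1: "deriv (\<lambda>s. \<psi> (s, ?x)) r = Dt ?u (r, y)" if "0 < r" for r
      using DERIV_imp_deriv[OF has_real_derivative_Dt[OF smooth_onD[OF smooth_\<psi>], of r y]] that y by simp
    \<comment> \<open>The outer derivative sees only times near \<open>t\<close>; these are
      positive, so \<open>d1\<close> applies to them.\<close>
    have "deriv (deriv (\<lambda>s. \<psi> (s, ?x))) t = deriv (\<lambda>r. Dt ?u (r, y)) t"
      by (rule deriv_cong_ev[OF _ refl], rule eventually_mono[OF eventually_nhds_in_open[of "{0<..}" t]])
        (use t d1 in auto)
    also have "\<dots> = Dt (Dt ?u) (t, y)"
      by (rule DERIV_imp_deriv[OF has_real_derivative_Dt[OF smooth_onD[OF smooth_on_ddir[OF smooth_\<psi>] p]]])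
    finally have d2: "deriv (deriv (\<lambda>s. \<psi> (s, ?x))) t = Dt (Dt ?u) (t, y)" .
    let ?f = "\<lambda>z. \<psi> (t, ?ci z)"
    have D1: "ddir (axis i 1) ?f y = Dx i ?u (t, y)" for i
      using dir_derivs_slice[OF oS smooth_\<psi> p, of "[axis i 1]"] by simp
    have D2: "ddir (axis i 1) (ddir (axis j 1) ?f) y = Dx i (Dx j ?u) (t, y)" for i j
      using dir_derivs_slice[OF oS smooth_\<psi> p, of "[axis i 1, axis j 1]"] by simp
    have GG: "g c1 \<circ> ?ci = G" by (simp add: G_def fun_eq_iff)
    have "laplace_beltrami g c1 (\<lambda>x. \<psi> (t, x)) ?x
        = (\<Sum>i\<in>UNIV. \<Sum>j\<in>UNIV. H i j y * (Dx i (Dx j ?u) (t, y) - (\<Sum>k\<in>UNIV. christoffel G k i j y * Dx k ?u (t, y))))"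
      unfolding laplace_beltrami_def hessian_coord_def pderiv_coord_eq GG ch(7)[OF y]
      unfolding o_def D1 D2 H_def G_def[of y, symmetric] ..
    also have "\<dots> = (\<Sum>i\<in>UNIV. \<Sum>j\<in>UNIV. H i j y * Dx i (Dx j ?u) (t, y))
        - (\<Sum>i\<in>UNIV. \<Sum>j\<in>UNIV. \<Sum>k\<in>UNIV. H i j y * christoffel G k i j y * Dx k ?u (t, y))"
      by (simp add: right_diff_distrib sum_subtractf sum_distrib_left mult.assoc)
    also have "(\<Sum>i\<in>UNIV. \<Sum>j\<in>UNIV. \<Sum>k\<in>UNIV. H i j y * christoffel G k i j y * Dx k ?u (t, y))
        = - (\<Sum>k\<in>UNIV. b k y * Dx k ?u (t, y))"
    proof -
      have "(\<Sum>i\<in>UNIV. \<Sum>j\<in>UNIV. \<Sum>k\<in>UNIV. H i j y * christoffel G k i j y * Dx k ?u (t, y))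
          = (\<Sum>i\<in>UNIV. \<Sum>k\<in>UNIV. \<Sum>j\<in>UNIV. H i j y * christoffel G k i j y * Dx k ?u (t, y))"
        by (intro sum.cong refl sum.swap)
      also have "\<dots> = (\<Sum>k\<in>UNIV. \<Sum>i\<in>UNIV. \<Sum>j\<in>UNIV. H i j y * christoffel G k i j y * Dx k ?u (t, y))"
        by (rule sum.swap)
      finally show ?thesis by (simp add: b_def sum_negf flip: sum_distrib_right)
    qed
    finally have L: "laplace_beltrami g c1 (\<lambda>x. \<psi> (t, x)) ?x
        = (\<Sum>i\<in>UNIV. \<Sum>j\<in>UNIV. H i j y * Dx i (Dx j ?u) (t, y)) + (\<Sum>k\<in>UNIV. b k y * Dx k ?u (t, y))" by simp
    have da: "deriv a t = a' t" using DERIV_imp_deriv[OF deriv_a[OF t]] by (simp add: a'_def)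
    have "- deriv (deriv (\<lambda>s. \<psi> (s, ?x))) t + laplace_beltrami g c1 (\<lambda>y. \<psi> (t, y)) ?x / (a t)\<^sup>2
        - 3 * (deriv a t / a t) * deriv (\<lambda>s. \<psi> (s, ?x)) t = 0"
      using wave t c1 ch(6)[OF y] unfolding solves_wave_equation_def by blast
    then show ?thesis unfolding d1[OF t] d2 L da by linarith
  qed
  interpret local_wave ?U ?u H b a a' s s'
  proof
    show "H i j y = H j i y" if "y \<in> ?U" for i j y
      unfolding H_def by (rule posdef_inv_sym[OF G[OF that]])
    show "0 < (\<Sum>i\<in>UNIV. \<Sum>j\<in>UNIV. H i j y * z $ i * z $ j)" if "y \<in> ?U" "z \<noteq> 0" for y z
      unfolding H_def by (rule posdef_inv_pos[OF G[OF that(1)] that(2)])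
  qed (rule ch(2) smooth_\<psi> sH sb pos smooth_a deriv_a[folded a'_def] a'_nonneg eq
      s_deriv s'_ge s'_cont s_pos s_lim; assumption)+
  obtain \<rho> where \<rho>: "0 < \<rho>" "cbox (y0 - vec \<rho>) (y0 + vec \<rho>) \<subseteq> ?U"
    using open_contains_cube[OF ch(2) y0] .
  obtain k where k: "k \<noteq> 0" "\<And>t. 0 < t \<Longrightarrow> (psi_hom \<kappa> \<gamma> a has_real_derivative k / a t ^ 3) (at t)"
    "filterlim (\<lambda>t. \<bar>psi_hom \<kappa> \<gamma> a t\<bar>) at_top (at_right 0)"
    using psi_hom_asymptotics by blast
  from cube_asymptotics[OF \<rho> k(2,1,3)] show ?thesis by simp
qed

theorem theorem1p1:
  fixes \<A> :: "('m::{t2_space,second_countable_topology}, real^3) chart set"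
    and g :: "('m, real^3) chart \<Rightarrow> 'm \<Rightarrow> real^3^3"
    and \<gamma> \<kappa> :: real
    and a :: "real \<Rightarrow> real"
    and \<psi> :: "real \<times> 'm \<Rightarrow> real"
  assumes "closed_smooth_manifold \<A>"
    and "riemannian_metric \<A> g"
    and "2/3 < \<gamma>" and "\<gamma> \<le> 2"
    and "\<kappa> = 0 \<or> \<kappa> = -1"
    and "scale_factor \<kappa> \<gamma> a"
    and "smooth_fun (cylinder_atlas \<A>) \<psi>"
    and "solves_wave_equation \<A> g a \<psi>"
  shows "\<exists>A r. is_decomposition \<A> \<psi> (psi_hom \<kappa> \<gamma> a) A r \<and>
           (\<forall>A' r'. is_decomposition \<A> \<psi> (psi_hom \<kappa> \<gamma> a) A' r' \<longrightarrow>
              A' = A \<and> (\<forall>t>0. \<forall>x. r' (t, x) = r (t, x))) \<and>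
           (\<gamma> < 2 \<longrightarrow>
              Cinf_converges \<A> (\<lambda>t x. \<psi> (t, x) / psi_hom \<kappa> \<gamma> a t) A (at_right 0))"
proof -
  have charts: "\<forall>c\<in>\<A>. is_chart c" and cover: "(\<Union>c\<in>\<A>. chart_dom c) = UNIV"
    and compact: "compact (UNIV :: 'm set)"
    using assms(1) unfolding closed_smooth_manifold_def smooth_atlas_def by auto
  obtain B0 where B0: "B0 > 0" "\<And>t. t > 0 \<Longrightarrow>
      (a has_real_derivative sqrt (8 * pi * B0 / 3 * a t powr (2 - 3 * \<gamma>) - \<kappa>)) (at t)"
    using assms(6) unfolding scale_factor_def by blast
  have a: "continuous_on {0..} a" "a 0 = 0" "\<And>t. 0 < t \<Longrightarrow> 0 < a t" "smooth_on a {0<..}"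
    using assms(6) unfolding scale_factor_def by auto
  interpret friedman \<kappa> \<gamma> "sqrt (8 * pi * B0 / 3)" a
  proof
    have sq: "(sqrt (8 * pi * B0 / 3))\<^sup>2 = 8 * pi * B0 / 3" using B0(1) by simp
    show "(a has_real_derivative sqrt ((sqrt (8 * pi * B0 / 3))\<^sup>2 * a t powr (2 - 3 * \<gamma>) - \<kappa>)) (at t)"
      if "0 < t" for t unfolding sq by (rule B0(2)[OF that])
    show "0 < sqrt (8 * pi * B0 / 3)" using B0(1) by simp
  qed (rule assms(3-5) a(1-3); assumption)+
  let ?h = "psi_hom \<kappa> \<gamma> a"
  obtain k where k: "k \<noteq> 0" "\<And>t. 0 < t \<Longrightarrow> (?h has_real_derivative k / a t ^ 3) (at t)"
    "filterlim (\<lambda>t. \<bar>?h t\<bar>) at_top (at_right 0)"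
    using psi_hom_asymptotics by blast
  have smooth_h: "smooth_on ?h {0<..}" by (rule smooth_on_primitive[OF k(2) a(4,3)])
  have h_nz: "\<forall>\<^sub>F t in at_right 0. ?h t \<noteq> 0"
    using k(3) unfolding filterlim_at_top_dense by (auto elim!: allE[of _ 0] eventually_mono)
  have \<psi>: "smooth_on (\<lambda>p. \<psi> (fst p, chart_inv c (snd p))) ({0<..} \<times> chart_image c)" if "c \<in> \<A>" for c
    using assms(7) that unfolding smooth_fun_cylinder_atlas[OF charts] by blast
  \<comment> \<open>A pointwise limit on the whole manifold: the limits found in different charts
    are then restrictions of one function, and no patching is required.\<close>
  define A where "A x = Lim (at_right 0) (\<lambda>t. \<psi> (t, x) / ?h t)" for x

  have local: "\<exists>B. open B \<and> y0 \<in> B \<and> B \<subseteq> chart_image c \<and> smooth_on (A \<circ> chart_inv c) B \<and>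
      (\<forall>es. uniform_limit B (\<lambda>t. dir_derivs es (\<lambda>y. \<psi> (t, chart_inv c y) / ?h t))
        (dir_derivs es (A \<circ> chart_inv c)) (at_right 0))" if c: "c \<in> \<A>" and y0: "y0 \<in> chart_image c" for c y0
  proof -
    obtain B A0 where B: "open B" "y0 \<in> B" "B \<subseteq> chart_image c" "smooth_on A0 B"
      "\<And>es. uniform_limit B (\<lambda>t. dir_derivs es (\<lambda>y. \<psi> (t, chart_inv c y) / ?h t)) (dir_derivs es A0) (at_right 0)"
      using chart_asymptotics[OF charts[rule_format, OF c] c assms(2) a(4) \<psi>[OF c] assms(8) y0] by blast
    have A0: "A0 y = (A \<circ> chart_inv c) y" if "y \<in> B" for y
      using tendsto_Lim[OF _ tendsto_uniform_limitI[OF B(5)[of "[]"] that]] by (simp add: A_def)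
    have "smooth_on (A \<circ> chart_inv c) B" by (rule smooth_on_cong[OF B(1) A0 B(4)])
    moreover have "uniform_limit B (\<lambda>t. dir_derivs es (\<lambda>y. \<psi> (t, chart_inv c y) / ?h t))
        (dir_derivs es (A \<circ> chart_inv c)) (at_right 0)" for es
      by (rule uniform_limit_cong'[THEN iffD1, rotated 2, OF B(5)]) (simp_all add: dir_derivs_cong[OF B(1) A0] o_def)
    ultimately show ?thesis using B(1-3) by blast
  qed
  have smooth_A: "smooth_fun \<A> A"
    unfolding smooth_fun_def
  proof
    fix c assume "c \<in> \<A>"
    then show "smooth_on (A \<circ> chart_inv c) (chart_image c)"
      by (intro smooth_on_UnionI) (use local in blast)
  qed
  have Cinf: "Cinf_converges \<A> (\<lambda>t x. \<psi> (t, x) / ?h t) A (at_right 0)"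
    unfolding Cinf_converges_def Ck_converges_def
  proof (intro allI ballI impI)
    fix c K and vs :: "(real^3) list"
    assume c: "c \<in> \<A>" and K: "compact K \<and> K \<subseteq> chart_image c"
    show "uniform_limit K (\<lambda>t. dir_derivs vs ((\<lambda>x. \<psi> (t, x) / ?h t) \<circ> chart_inv c)) (dir_derivs vs (A \<circ> chart_inv c)) (at_right 0)"
      unfolding o_def
    proof (rule uniform_limit_compact_local)
      fix y assume "y \<in> K"
      then show "\<exists>B. open B \<and> y \<in> B \<and> uniform_limit B (\<lambda>t. dir_derivs vs (\<lambda>y. \<psi> (t, chart_inv c y) / ?h t))
          (dir_derivs vs (\<lambda>y. A (chart_inv c y))) (at_right 0)"
        using local[OF c, of y] K unfolding o_def by blast
    qed (use K in blast)
  qed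
  \<comment> \<open>The chart statement without derivatives, pulled back to neighbourhoods in the
    manifold, whose compactness makes it global.\<close>
  have unif: "uniform_limit UNIV (\<lambda>t x. \<psi> (t, x) / ?h t) A (at_right 0)"
  proof (rule uniform_limit_compact_local[OF compact])
    fix x :: 'm
    obtain c where c: "c \<in> \<A>" "x \<in> chart_dom c" using cover by blast
    note ch = is_chartD[OF charts[rule_format, OF c(1)]]
    obtain B where B: "open B" "chart_map c x \<in> B"
      and lim: "\<And>es. uniform_limit B (\<lambda>t. dir_derivs es (\<lambda>y. \<psi> (t, chart_inv c y) / ?h t))
        (dir_derivs es (A \<circ> chart_inv c)) (at_right 0)"
      using local[OF c(1) ch(4)[OF c(2)]] by blast
    have lim0: "uniform_limit B (\<lambda>t y. \<psi> (t, chart_inv c y) / ?h t) (\<lambda>y. A (chart_inv c y)) (at_right 0)"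
      using lim[of "[]"] by (simp add: o_def)
    let ?W = "chart_map c -` B \<inter> chart_dom c"
    have "open ?W" using ch(3) B(1) unfolding continuous_on_open_vimage[OF ch(1)] by blast
    moreover have "uniform_limit ?W (\<lambda>t x. \<psi> (t, x) / ?h t) A (at_right 0)"
    proof (rule uniform_limitI)
      fix e :: real assume "e > 0"
      from uniform_limitD[OF lim0 this]
      show "\<forall>\<^sub>F t in at_right 0. \<forall>x\<in>?W. dist (\<psi> (t, x) / ?h t) (A x) < e"
        by (rule eventually_mono) (use ch(5) in force)
    qed
    ultimately show "\<exists>W. open W \<and> x \<in> W \<and> uniform_limit W (\<lambda>t x. \<psi> (t, x) / ?h t) A (at_right 0)"
      using B(2) c(2) by blast
  qed
  define r where "r p = \<psi> p - A (snd p) * ?h (fst p)" for p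
  have smooth_r: "smooth_fun (cylinder_atlas \<A>) r"
    unfolding smooth_fun_cylinder_atlas[OF charts]
  proof
    fix c assume c: "c \<in> \<A>"
    note ch = is_chartD[OF charts[rule_format, OF c]]
    have "smooth_on (A \<circ> chart_inv c) (chart_image c)" using smooth_A c unfolding smooth_fun_def by blast
    from smooth_on_comp_snd[OF ch(2) this, of "{0<..} \<times> chart_image c"]
    have 1: "smooth_on (\<lambda>p. A (chart_inv c (snd p))) ({0<..} \<times> chart_image c)" by auto
    have 2: "smooth_on (\<lambda>p. ?h (fst p)) ({0<..} \<times> chart_image c)"
      by (rule smooth_on_comp_fst[OF _ smooth_h]) auto
    show "smooth_on (\<lambda>p. r (fst p, chart_inv c (snd p))) ({0<..} \<times> chart_image c)"
      unfolding r_def fst_conv snd_conv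
      by (intro smooth_on_diff smooth_on_mult 1 2 \<psi>[OF c] open_Times open_greaterThan ch(2))
  qed
  \<comment> \<open>Near 0 the function \<open>psi_hom\<close> has no zeros, so division turns the
    condition on the remainder into uniform convergence of the quotient. One direction gives
    existence; the other, with uniqueness of limits, determines \<open>A\<close>.\<close>
  have remainder: "uniform_limit UNIV (\<lambda>t x. (\<psi> (t, x) - A' x * ?h t) / ?h t) (\<lambda>x. 0) (at_right 0) \<longleftrightarrow>
      uniform_limit UNIV (\<lambda>t x. \<psi> (t, x) / ?h t) A' (at_right 0)" for A'
    unfolding uniform_limit_iff
  proof (intro all_cong1 imp_cong refl eventually_subst)
    show "\<forall>\<^sub>F t in at_right 0. (\<forall>x\<in>UNIV. dist ((\<psi> (t, x) - A' x * ?h t) / ?h t) 0 < e)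
        = (\<forall>x\<in>UNIV. dist (\<psi> (t, x) / ?h t) (A' x) < e)" for e
      using h_nz by (rule eventually_mono) (simp add: diff_divide_distrib dist_real_def)
  qed
  have "is_decomposition \<A> \<psi> ?h A r"
    unfolding is_decomposition_def
    using smooth_A smooth_r remainder[of A] unif by (simp add: r_def)
  moreover have "A' = A \<and> (\<forall>t>0. \<forall>x. r' (t, x) = r (t, x))" if dec: "is_decomposition \<A> \<psi> ?h A' r'" for A' r'
  proof -
    have eq: "\<psi> (t, x) = A' x * ?h t + r' (t, x)" if "t > 0" for t x
      using dec that unfolding is_decomposition_def by blast
    have "uniform_limit UNIV (\<lambda>t x. r' (t, x) / ?h t) (\<lambda>x. 0) (at_right 0)"
      using dec unfolding is_decomposition_def by blast
    then have "uniform_limit UNIV (\<lambda>t x. (\<psi> (t, x) - A' x * ?h t) / ?h t) (\<lambda>x. 0) (at_right 0)"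
    proof (rule uniform_limit_cong[THEN iffD1, rotated 2])
      show "\<forall>\<^sub>F t in at_right 0. \<forall>x\<in>UNIV. r' (t, x) / ?h t = (\<psi> (t, x) - A' x * ?h t) / ?h t"
        using eventually_at_right_less[of "0::real"] by (rule eventually_mono) (simp add: eq)
    qed simp
    then have "uniform_limit UNIV (\<lambda>t x. \<psi> (t, x) / ?h t) A' (at_right 0)" unfolding remainder .
    from tendsto_uniform_limitI[OF this] tendsto_uniform_limitI[OF unif]
    have "A' x = A x" for x by (rule tendsto_unique[OF trivial_limit_at_right_real]) simp_all
    then have "A' = A" by blast
    then show ?thesis using eq unfolding r_def by auto
  qed
  ultimately show ?thesis using Cinf by blast
qed

end
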